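(* Let $T^{n+1}$ be the flat torus with $\psi:=dy^1\wedge dz$ and $\eta:=dz$, where $(y^1,\ldots,y^n,z)$ are the standard coordinates, with periods normalised such that $[\frac{\psi}{2\pi}]\in H^2(T^{n+1},\mathbb{Z})$. Let $\pi:X\to T^{n+1}$ be the $S^1$-bundle with connection form $\theta$ determined by $\psi$ and let $\tilde g_f=2\theta\,\pi^*\eta+f\cdot\pi^*\eta^2+\pi^*g$, where $g=\sum_{i=1}^n(dy^i)^2+dz^2$ and $f\in C^\infty(T^{n+1})$ (pulled back to $X$) is sufficiently generic. Then $(X,\tilde g_f)$ is a complete compact pp-wave.
   Context: Complete means geodesically complete. A pp-wave is a Lorentzian manifold $(X,\tilde g)$ of dimension $n+2$ with reducible indecomposable holonomy such that $\mathfrak{hol}(X,\tilde g)=\mathbb{R}^n$ (in the notation below, the subalgebra with $a=0$, $A=0$). Construction of $X$, $\theta$. Let $M=T^{n+1}$. $[\frac{\psi}{2\pi}]\in H^2(M,\mathbb{Z})$ means that the closed form $\frac{\psi}{2\pi}$ represents a class in the image of $H^2(M,\mathbb{Z})\to H^2_{dR}(M,\mathbb{R})$. Let $(E,h,\nabla^E)$ be a Hermitian line bundle over $M$ with $c_1(E)=-[\frac{\psi}{2\pi}]$ and Hermitian connection of curvature $i\psi$; $\pi:X=\{v\in E:h(v,v)=1\}\to M$ is its unit circle bundle. If $s$ is a local unit section with $\nabla^E s=i\phi\otimes s$, so $d\phi=\psi$, and $x$ is the fiber coordinate defined by $e^{ix}s$, then the local forms $dx+\pi^*\phi$ glue to a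 global $1$-form $\theta$ on $X$ with $d\theta=\pi^*\psi$. Products of $1$-forms are symmetric, $2\alpha\beta=\alpha\otimes\beta+\beta\otimes\alpha$. The vertical field is $V=\frac{\partial}{\partial x}$. Holonomy. $\mathfrak{hol}(X,\tilde g_f)$ is the Lie algebra of the restricted holonomy group, acting on $T_pX$. It is indecomposable if there is no proper non-zero invariant subspace on which the metric is non-degenerate, and reducible if there is a proper non-zero invariant subspace. Here it leaves the line $\mathbb{R}V$ invariant, so in a basis $(v,e_1,\ldots,e_n,w_0)$ of $T_pX$ with $v=V$, $\langle e_i,e_j\rangle=\delta_{ij}$, $\langle v,w_0\rangle=1$, and $\langle v,v\rangle=\langle w_0,w_0\rangle=\langle v,e_i\rangle=\langle w_0,e_i\rangle=0$, it lies in $$(\mathbb{R}\oplus\mathfrak{so}(n))\ltimes\mathbb{R}^n=\left\{\begin{pmatrix}a&w^T&0\\0&A&-w\\0&0&-a\end{pmatrix}: a\in\mathbb{R}, A\in\mathfrak{so}(n), w\in\mathbb{R}^n\right\}.$$ An indecomposable algebra $\mathfrak{h}$ of this kind with $\mathfrak{g}=pr_{\mathfrak{so}(n)}(\mathfrak{h})$ is of type 4 if there is $0<\ell<n$ with $\mathfrak{g}\subset\mathfrak{so}(\ell)$, where $\mathbb{R}^n=\mathbb{R}^{n-\ell}\oplus\mathbb{R}^\ell$, and an epimorphism $\chi:\mathfrak{g}\to\mathbb{R}^{n-\ell}$ with $\chi|_{[\mathfrak{g},\mathfrak{g}]}=0$ such that $$\mathfrak{h}=\left\{\begin{pmatrix}0&\chi(A)^T&w^T&0\\0&0&0&-\chi(A)\\0&0&A&-w\\0&0&0&0\end{pmatrix}: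 A\in\mathfrak{g}, w\in\mathbb{R}^\ell\right\}.$$ The function $f$ is sufficiently generic if $\mathfrak{hol}(X,\tilde g_f)$ is indecomposable and not of type 4. *)

theory Defs
  imports "HOL-Analysis.Analysis" "HOL-Homology.Homology"
begin

section \<open>Smooth maps and manifolds\<close>

text \<open>Both notions are meant for open \<open>S\<close>: derivatives are two-sided.\<close>

primrec Ck_on :: "nat \<Rightarrow> 'a::real_normed_vector set \<Rightarrow> ('a \<Rightarrow> 'b::real_normed_vector) \<Rightarrow> bool" where
  "Ck_on 0 S f \<longleftrightarrow> continuous_on S f"
| "Ck_on (Suc k) S f \<longleftrightarrow>
     (\<forall>x\<in>S. f differentiable (at x)) \<and> (\<forall>v. Ck_on k S (\<lambda>x. frechet_derivative f (at x) v))"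

definition smooth_on :: "'a::real_normed_vector set \<Rightarrow> ('a \<Rightarrow> 'b::real_normed_vector) \<Rightarrow> bool" where
  "smooth_on S f \<longleftrightarrow> (\<forall>k. Ck_on k S f)"

text \<open>
  An atlas is a family of local parametrisations (inverse charts) \<open>param A i\<close>, each with a domain
  \<open>cdom A i\<close> in the model space. The underlying point set is the union of their images and
  carries the topology for which a set is open iff all its coordinate preimages are open.
\<close>

record ('i, 'e, 'x) atlas =
  charts :: "'i set"
  cdom :: "'i \<Rightarrow> 'e set"
  param :: "'i \<Rightarrow> 'e \<Rightarrow> 'x"

definition patch :: "('i, 'e, 'x) atlas \<Rightarrow> 'i \<Rightarrow> 'x set" where
  "patch A i = param A i ` cdom A i"

definition points :: "('i, 'e, 'x) atlas \<Rightarrow> 'x set" where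
  "points A = (\<Union>i\<in>charts A. patch A i)"

definition coord :: "('i, 'e, 'x) atlas \<Rightarrow> 'i \<Rightarrow> 'x \<Rightarrow> 'e" where
  "coord A i = inv_into (cdom A i) (param A i)"

definition mtop :: "('i, 'e::euclidean_space, 'x) atlas \<Rightarrow> 'x topology" where
  "mtop A = topology (\<lambda>W. W \<subseteq> points A \<and> (\<forall>i\<in>charts A. open {u \<in> cdom A i. param A i u \<in> W}))"

definition smooth_manifold :: "('i, 'e::euclidean_space, 'x) atlas \<Rightarrow> bool" where
  "smooth_manifold A \<longleftrightarrow>
     (\<forall>i\<in>charts A. open (cdom A i) \<and> inj_on (param A i) (cdom A i)) \<and>
     (\<forall>i\<in>charts A. \<forall>j\<in>charts A.
        open {u \<in> cdom A i. param A i u \<in> patch A j} \<and>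
        smooth_on {u \<in> cdom A i. param A i u \<in> patch A j} (coord A j \<circ> param A i)) \<and>
     Hausdorff_space (mtop A) \<and> second_countable (mtop A) \<and> connected_space (mtop A)"

text \<open>
  A tangent vector at \<open>p\<close> is given by its components with respect to all charts around \<open>p\<close>;
  the values for other indices are irrelevant.
\<close>

definition tangent :: "('i, 'e::euclidean_space, 'x) atlas \<Rightarrow> 'x \<Rightarrow> ('i \<Rightarrow> 'e) set" where
  "tangent A p = {v. \<forall>i\<in>charts A. \<forall>j\<in>charts A. p \<in> patch A i \<and> p \<in> patch A j \<longrightarrow>
     v j = frechet_derivative (coord A j \<circ> param A i) (at (coord A i p)) (v i)}"

section \<open>Lorentzian metrics, geodesics\<close>

definition lorentz_form :: "('e::euclidean_space \<Rightarrow> 'e \<Rightarrow> real) \<Rightarrow> bool" where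
  "lorentz_form B \<longleftrightarrow> bilinear B \<and> (\<forall>a b. B a b = B b a) \<and>
     (\<exists>b :: 'e \<Rightarrow> 'e. \<exists>e0\<in>Basis. \<forall>i\<in>Basis. \<forall>j\<in>Basis.
        B (b i) (b j) = (if i \<noteq> j then 0 else if i = e0 then - 1 else 1))"

text \<open>
  A \<open>(0,2)\<close>-tensor field is given by its components: \<open>G i u a b\<close> is the value on the vectors with
  components \<open>a\<close>, \<open>b\<close> in chart \<open>i\<close> at the point with coordinates \<open>u\<close>.
\<close>

type_synonym ('i, 'e) tensor02 = "'i \<Rightarrow> 'e \<Rightarrow> 'e \<Rightarrow> 'e \<Rightarrow> real"

definition lorentzian_manifold ::
    "('i, 'e::euclidean_space, 'x) atlas \<Rightarrow> ('i, 'e) tensor02 \<Rightarrow> bool" where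
  "lorentzian_manifold A G \<longleftrightarrow> smooth_manifold A \<and>
     (\<forall>i\<in>charts A. (\<forall>u\<in>cdom A i. lorentz_form (G i u)) \<and>
        (\<forall>a b. smooth_on (cdom A i) (\<lambda>u. G i u a b))) \<and>
     (\<forall>i\<in>charts A. \<forall>j\<in>charts A. \<forall>u\<in>cdom A i. param A i u \<in> patch A j \<longrightarrow>
        (let d = frechet_derivative (coord A j \<circ> param A i) (at u)
         in \<forall>a b. G i u a b = G j (coord A j (param A i u)) (d a) (d b)))"

text \<open>
  The Levi-Civita connection \<open>\<nabla>\<^sub>a b\<close> of constant coordinate fields, by the Koszul formula.
\<close>

definition christoffel :: "('i, 'e::euclidean_space) tensor02 \<Rightarrow> 'i \<Rightarrow> 'e \<Rightarrow> 'e \<Rightarrow> 'e \<Rightarrow> 'e" where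
  "christoffel G i u a b = (THE c. \<forall>e. 2 * G i u c e =
       frechet_derivative (\<lambda>u. G i u b e) (at u) a
     + frechet_derivative (\<lambda>u. G i u a e) (at u) b
     - frechet_derivative (\<lambda>u. G i u a b) (at u) e)"

definition geodesic_on ::
    "('i, 'e::euclidean_space, 'x) atlas \<Rightarrow> ('i, 'e) tensor02 \<Rightarrow> real set \<Rightarrow> (real \<Rightarrow> 'x) \<Rightarrow> bool" where
  "geodesic_on A G J \<gamma> \<longleftrightarrow>
     (\<forall>t0\<in>J. \<exists>K i u u'. open K \<and> t0 \<in> K \<and> K \<subseteq> J \<and> i \<in> charts A \<and>
        (\<forall>t\<in>K. u t \<in> cdom A i \<and> \<gamma> t = param A i (u t) \<and>
           (u has_vector_derivative u' t) (at t) \<and>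
           (u' has_vector_derivative - christoffel G i (u t) (u' t) (u' t)) (at t)))"

definition geodesically_complete ::
    "('i, 'e::euclidean_space, 'x) atlas \<Rightarrow> ('i, 'e) tensor02 \<Rightarrow> bool" where
  "geodesically_complete A G \<longleftrightarrow>
     (\<forall>J \<gamma>. open J \<and> connected J \<and> J \<noteq> {} \<and> geodesic_on A G J \<gamma> \<longrightarrow>
        (\<exists>\<gamma>'. geodesic_on A G UNIV \<gamma>' \<and> (\<forall>t\<in>J. \<gamma>' t = \<gamma> t)))"

section \<open>Holonomy\<close>

definition C1_curve_on ::
    "('i, 'e::euclidean_space, 'x) atlas \<Rightarrow> real set \<Rightarrow> (real \<Rightarrow> 'x) \<Rightarrow> bool" where
  "C1_curve_on A T \<gamma> \<longleftrightarrow>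
     (\<forall>i\<in>charts A. \<exists>u'. continuous_on {t \<in> T. \<gamma> t \<in> patch A i} u' \<and>
        (\<forall>t\<in>T. \<gamma> t \<in> patch A i \<longrightarrow>
           ((coord A i \<circ> \<gamma>) has_vector_derivative u' t) (at t within T)))"

definition piecewise_C1_path :: "('i, 'e::euclidean_space, 'x) atlas \<Rightarrow> (real \<Rightarrow> 'x) \<Rightarrow> bool" where
  "piecewise_C1_path A \<gamma> \<longleftrightarrow> pathin (mtop A) \<gamma> \<and>
     (\<exists>S. finite S \<and> (\<forall>a b. 0 \<le> a \<and> a < b \<and> b \<le> 1 \<and> {a<..<b} \<inter> S = {} \<longrightarrow> C1_curve_on A {a..b} \<gamma>))"

text \<open>
  \<open>w\<close> is a parallel vector field along the piecewise C1 path \<open>\<gamma>\<close>: the equation holds on every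
  closed subinterval on which \<open>\<gamma>\<close> is C1, with one-sided derivatives at its end points.
\<close>

definition parallel_along ::
    "('i, 'e::euclidean_space, 'x) atlas \<Rightarrow> ('i, 'e) tensor02 \<Rightarrow> (real \<Rightarrow> 'x) \<Rightarrow> (real \<Rightarrow> 'i \<Rightarrow> 'e) \<Rightarrow> bool"
  where
  "parallel_along A G \<gamma> w \<longleftrightarrow>
     (\<forall>t\<in>{0..1}. w t \<in> tangent A (\<gamma> t)) \<and>
     (\<forall>a b. 0 \<le> a \<and> a < b \<and> b \<le> 1 \<and> C1_curve_on A {a..b} \<gamma> \<longrightarrow>
        (\<forall>i\<in>charts A. \<forall>t\<in>{a..b}. \<gamma> t \<in> patch A i \<longrightarrow>
           ((\<lambda>s. w s i) has_vector_derivative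
              - christoffel G i (coord A i (\<gamma> t))
                  (vector_derivative (coord A i \<circ> \<gamma>) (at t within {a..b})) (w t i))
             (at t within {a..b})))"

text \<open>
  The restricted holonomy group at \<open>param A i u\<close>, acting on the tangent space there, which is
  identified with the model space through chart \<open>i\<close>.
\<close>

definition restricted_holonomy ::
    "('i, 'e::euclidean_space, 'x) atlas \<Rightarrow> ('i, 'e) tensor02 \<Rightarrow> 'i \<Rightarrow> 'e \<Rightarrow> ('e \<Rightarrow> 'e) set" where
  "restricted_holonomy A G i u = (let p = param A i u in
     {L. linear L \<and>
         (\<exists>\<gamma>. piecewise_C1_path A \<gamma> \<and> \<gamma> 0 = p \<and> \<gamma> 1 = p \<and>
            homotopic_with (\<lambda>h. h 0 = p \<and> h 1 = p) (top_of_set {0..1}) (mtop A) \<gamma> (\<lambda>_. p) \<and>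
            (\<forall>v. \<exists>w. parallel_along A G \<gamma> w \<and> w 0 i = v \<and> w 1 i = L v))})"

definition lin_exp :: "('e::euclidean_space \<Rightarrow> 'e) \<Rightarrow> 'e \<Rightarrow> 'e" where
  "lin_exp T x = suminf (\<lambda>k. (T ^^ k) x /\<^sub>R fact k)"

definition lie_algebra_of :: "('e::euclidean_space \<Rightarrow> 'e) set \<Rightarrow> ('e \<Rightarrow> 'e) set" where
  "lie_algebra_of H = {T. linear T \<and> (\<forall>t::real. lin_exp (\<lambda>x. t *\<^sub>R T x) \<in> H)}"

definition hol ::
    "('i, 'e::euclidean_space, 'x) atlas \<Rightarrow> ('i, 'e) tensor02 \<Rightarrow> 'i \<Rightarrow> 'e \<Rightarrow> ('e \<Rightarrow> 'e) set" where
  "hol A G i u = lie_algebra_of (restricted_holonomy A G i u)"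

definition invariant_subspace :: "('e::euclidean_space \<Rightarrow> 'e) set \<Rightarrow> 'e set \<Rightarrow> bool" where
  "invariant_subspace \<hh> W \<longleftrightarrow> subspace W \<and> (\<forall>T\<in>\<hh>. T ` W \<subseteq> W)"

definition reducible :: "('e::euclidean_space \<Rightarrow> 'e) set \<Rightarrow> bool" where
  "reducible \<hh> \<longleftrightarrow> (\<exists>W. invariant_subspace \<hh> W \<and> W \<noteq> {0} \<and> W \<noteq> UNIV)"

definition indecomposable ::
    "('e::euclidean_space \<Rightarrow> 'e \<Rightarrow> real) \<Rightarrow> ('e \<Rightarrow> 'e) set \<Rightarrow> bool" where
  "indecomposable B \<hh> \<longleftrightarrow>
     \<not> (\<exists>W. invariant_subspace \<hh> W \<and> W \<noteq> {0} \<and> W \<noteq> UNIV \<and>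
           (\<forall>x\<in>W. (\<forall>y\<in>W. B x y = 0) \<longrightarrow> x = 0))"

text \<open>The index range \<open>1, \<dots>, n\<close> is rendered as \<open>{..<n}\<close> from here on.\<close>

definition adapted_basis ::
    "nat \<Rightarrow> ('e::euclidean_space \<Rightarrow> 'e \<Rightarrow> real) \<Rightarrow> 'e \<Rightarrow> (nat \<Rightarrow> 'e) \<Rightarrow> 'e \<Rightarrow> bool" where
  "adapted_basis n B v e w0 \<longleftrightarrow>
     span ({v, w0} \<union> e ` {..<n}) = UNIV \<and>
     B v v = 0 \<and> B w0 w0 = 0 \<and> B v w0 = 1 \<and>
     (\<forall>i<n. B v (e i) = 0 \<and> B w0 (e i) = 0) \<and>
     (\<forall>i<n. \<forall>j<n. B (e i) (e j) = (if i = j then 1 else 0))"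

text \<open>
  \<open>T\<close> has, in the basis \<open>(v, e, w0)\<close>, the matrix with rows \<open>(a, w\<^sup>T, 0)\<close>, \<open>(0, Q, -w)\<close>, \<open>(0, 0, -a)\<close>.
\<close>

definition has_matrix ::
    "nat \<Rightarrow> 'e::euclidean_space \<Rightarrow> (nat \<Rightarrow> 'e) \<Rightarrow> 'e \<Rightarrow> ('e \<Rightarrow> 'e) \<Rightarrow>
     real \<Rightarrow> (nat \<Rightarrow> nat \<Rightarrow> real) \<Rightarrow> (nat \<Rightarrow> real) \<Rightarrow> bool" where
  "has_matrix n v e w0 T a Q w \<longleftrightarrow> linear T \<and>
     T v = a *\<^sub>R v \<and>
     (\<forall>j<n. T (e j) = w j *\<^sub>R v + (\<Sum>i<n. Q i j *\<^sub>R e i)) \<and>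
     T w0 = - (\<Sum>i<n. w i *\<^sub>R e i) - a *\<^sub>R w0"

definition so :: "nat \<Rightarrow> (nat \<Rightarrow> nat \<Rightarrow> real) set" where
  "so n = {Q. (\<forall>i j. Q i j = - Q j i) \<and> (\<forall>i j. n \<le> i \<longrightarrow> Q i j = 0)}"

definition pr_so ::
    "nat \<Rightarrow> 'e::euclidean_space \<Rightarrow> (nat \<Rightarrow> 'e) \<Rightarrow> 'e \<Rightarrow> ('e \<Rightarrow> 'e) set \<Rightarrow> (nat \<Rightarrow> nat \<Rightarrow> real) set" where
  "pr_so n v e w0 \<hh> = {Q \<in> so n. \<exists>T\<in>\<hh>. \<exists>a w. has_matrix n v e w0 T a Q w}"

text \<open>
  In type 4, \<open>so(l)\<close> consists of the matrices supported in the lower right block, and the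
  epimorphism \<open>\<kappa>\<close> onto the abelian Lie algebra \<open>\<real>\<^bsup>n-l\<^esup>\<close> only matters in its components below \<open>n - l\<close>.
\<close>

definition type4 ::
    "nat \<Rightarrow> ('e::euclidean_space \<Rightarrow> 'e \<Rightarrow> real) \<Rightarrow> 'e \<Rightarrow> ('e \<Rightarrow> 'e) set \<Rightarrow> bool" where
  "type4 n B v \<hh> \<longleftrightarrow> (\<exists>e w0 l \<kappa>. adapted_basis n B v e w0 \<and> 0 < l \<and> l < n \<and>
     (let \<gg> = pr_so n v e w0 \<hh>; m = n - l in
        (\<forall>Q\<in>\<gg>. \<forall>i<m. \<forall>j. Q i j = 0) \<and>
        (\<forall>Q\<in>\<gg>. \<forall>R\<in>\<gg>. \<forall>r s. \<forall>k<m.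
           \<kappa> (\<lambda>i j. r * Q i j + s * R i j) k = r * \<kappa> Q k + s * \<kappa> R k) \<and>
        (\<forall>c. \<exists>Q\<in>\<gg>. \<forall>k<m. \<kappa> Q k = c k) \<and>
        (\<forall>Q\<in>\<gg>. \<forall>R\<in>\<gg>. \<forall>k<m. \<kappa> (\<lambda>i j. \<Sum>h<n. Q i h * R h j - R i h * Q h j) k = 0) \<and>
        \<hh> = {T. \<exists>Q\<in>\<gg>. \<exists>w. (\<forall>k<m. w k = \<kappa> Q k) \<and> has_matrix n v e w0 T 0 Q w}))"

text \<open>
  The restricted holonomies at different points of a connected manifold are conjugate, so the
  conditions below do not depend on the point. \<open>V\<close> is the vertical field in chart components.
\<close>

definition generic_holonomy ::
    "nat \<Rightarrow> ('i, 'e::euclidean_space, 'x) atlas \<Rightarrow> ('i, 'e) tensor02 \<Rightarrow> ('i \<Rightarrow> 'e \<Rightarrow> 'e) \<Rightarrow> bool" where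
  "generic_holonomy n A G V \<longleftrightarrow> (\<forall>i\<in>charts A. \<forall>u\<in>cdom A i.
     indecomposable (G i u) (hol A G i u) \<and> \<not> type4 n (G i u) (V i u) (hol A G i u))"

definition pp_wave ::
    "nat \<Rightarrow> ('i, 'e::euclidean_space, 'x) atlas \<Rightarrow> ('i, 'e) tensor02 \<Rightarrow> bool" where
  "pp_wave n A G \<longleftrightarrow> lorentzian_manifold A G \<and> DIM('e) = n + 2 \<and>
     (\<forall>i\<in>charts A. \<forall>u\<in>cdom A i.
        reducible (hol A G i u) \<and> indecomposable (G i u) (hol A G i u) \<and>
        (\<exists>v e w0. adapted_basis n (G i u) v e w0 \<and>
           hol A G i u = {T. \<exists>w. has_matrix n v e w0 T 0 (\<lambda>_ _. 0) w}))"

section \<open>The torus\<close>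

text \<open>
  The torus is the quotient of \<open>'b\<close> by the lattice with period \<open>P \<bullet> k\<close> in the direction of each
  basis vector \<open>k\<close>; points are cosets. Its tangent spaces are identified with \<open>'b\<close> through the
  standard coordinates.
\<close>

definition tpt :: "'b::euclidean_space \<Rightarrow> 'b \<Rightarrow> 'b set" where
  "tpt P b = {b'. \<forall>k\<in>Basis. \<exists>m::int. (b' - b) \<bullet> k = of_int m * (P \<bullet> k)}"

definition torus :: "'b::euclidean_space \<Rightarrow> 'b set set" where
  "torus P = range (tpt P)"

definition torus_top :: "'b::euclidean_space \<Rightarrow> 'b set topology" where
  "torus_top P = topology (\<lambda>U. U \<subseteq> torus P \<and> open (tpt P -` U))"

definition torus_smooth_on ::
    "'b::euclidean_space \<Rightarrow> 'b set set \<Rightarrow> ('b set \<Rightarrow> 'c::real_normed_vector) \<Rightarrow> bool" where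
  "torus_smooth_on P U F \<longleftrightarrow> smooth_on (tpt P -` U) (F \<circ> tpt P)"

text \<open>
  A closed 2-form on the torus, given by a periodic form \<open>\<omega>\<close> on \<open>'b\<close>, represents a class in the
  image of integral cohomology iff its period over every smooth integral singular 2-cycle is an
  integer (de Rham). Smooth singular simplices lift to smooth maps into \<open>'b\<close>, written here in the
  barycentric coordinates \<open>x\<^sub>1, x\<^sub>2\<close>.
\<close>

definition integral_class :: "'b::euclidean_space \<Rightarrow> ('b \<Rightarrow> 'b \<Rightarrow> 'b \<Rightarrow> real) \<Rightarrow> bool" where
  "integral_class P \<omega> \<longleftrightarrow>
     (\<forall>c lift. singular_chain 2 (torus_top P) c \<and> chain_boundary 2 c = 0 \<and>
        (\<forall>\<sigma>\<in>Poly_Mapping.keys c. smooth_on UNIV (lift \<sigma>) \<and>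
           (\<forall>x\<in>standard_simplex 2. \<sigma> x = tpt P (lift \<sigma> (x 1, x 2)))) \<longrightarrow>
        (\<Sum>\<sigma>\<in>Poly_Mapping.keys c. of_int (Poly_Mapping.lookup c \<sigma>) *
           integral {(x, y). 0 \<le> x \<and> 0 \<le> y \<and> x + y \<le> 1}
             (\<lambda>u::real \<times> real. \<omega> (lift \<sigma> u) (frechet_derivative (lift \<sigma>) (at u) (1, 0))
                                 (frechet_derivative (lift \<sigma>) (at u) (0, 1)))) \<in> (\<int> :: real set))"

section \<open>Hermitian line bundles over the torus\<close>

text \<open>
  \<open>lframes\<close> is a family of local frames defining the smooth structure, and \<open>lconn E a t\<close> is the
  covariant derivative of the local section \<open>t\<close> in the direction of the constant coordinate field
  \<open>a\<close>. The Hermitian form is linear in its first argument.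
\<close>

record ('v, 'b) line_bundle =
  ltotal :: "'v set"
  lproj :: "'v \<Rightarrow> 'b set"
  ladd :: "'v \<Rightarrow> 'v \<Rightarrow> 'v"
  lscale :: "complex \<Rightarrow> 'v \<Rightarrow> 'v"
  lherm :: "'v \<Rightarrow> 'v \<Rightarrow> complex"
  lframes :: "('b set set \<times> ('b set \<Rightarrow> 'v)) set"
  lconn :: "'b \<Rightarrow> ('b set \<Rightarrow> 'v) \<Rightarrow> 'b set \<Rightarrow> 'v"

definition fibre :: "('v, 'b) line_bundle \<Rightarrow> 'b set \<Rightarrow> 'v set" where
  "fibre E m = {v \<in> ltotal E. lproj E v = m}"

text \<open>The first condition says that each fibre is a complex Hermitian line.\<close>

definition hermitian_line_bundle :: "'b::euclidean_space \<Rightarrow> ('v, 'b) line_bundle \<Rightarrow> bool" where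
  "hermitian_line_bundle P E \<longleftrightarrow>
     lproj E ` ltotal E \<subseteq> torus P \<and>
     (\<forall>m\<in>torus P. \<exists>\<phi>. bij_betw \<phi> UNIV (fibre E m) \<and>
        (\<forall>a b. \<phi> (a + b) = ladd E (\<phi> a) (\<phi> b) \<and> \<phi> (a * b) = lscale E a (\<phi> b) \<and>
               lherm E (\<phi> a) (\<phi> b) = a * cnj b)) \<and>
     (\<Union>(fst ` lframes E)) = torus P \<and>
     (\<forall>(U, s)\<in>lframes E. openin (torus_top P) U \<and>
        (\<forall>m\<in>U. s m \<in> fibre E m \<and> lherm E (s m) (s m) \<noteq> 0) \<and>
        torus_smooth_on P U (\<lambda>m. lherm E (s m) (s m))) \<and>
     (\<forall>(U, s)\<in>lframes E. \<forall>(U', s')\<in>lframes E. \<exists>c. torus_smooth_on P (U \<inter> U') c \<and>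
        (\<forall>m\<in>U \<inter> U'. s' m = lscale E (c m) (s m)))"

definition smooth_section ::
    "'b::euclidean_space \<Rightarrow> ('v, 'b) line_bundle \<Rightarrow> 'b set set \<Rightarrow> ('b set \<Rightarrow> 'v) \<Rightarrow> bool" where
  "smooth_section P E W t \<longleftrightarrow> openin (torus_top P) W \<and> (\<forall>m\<in>W. t m \<in> fibre E m) \<and>
     (\<forall>(U, s)\<in>lframes E. \<exists>c. torus_smooth_on P (U \<inter> W) c \<and>
        (\<forall>m\<in>U \<inter> W. t m = lscale E (c m) (s m)))"

definition hermitian_connection :: "'b::euclidean_space \<Rightarrow> ('v, 'b) line_bundle \<Rightarrow> bool" where
  "hermitian_connection P E \<longleftrightarrow>
     (\<forall>W t. smooth_section P E W t \<longrightarrow>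
        (\<forall>a. smooth_section P E W (lconn E a t)) \<and>
        (\<forall>a a' r. \<forall>m\<in>W. lconn E (r *\<^sub>R a + a') t m
            = ladd E (lscale E (of_real r) (lconn E a t m)) (lconn E a' t m)) \<and>
        (\<forall>a c b. torus_smooth_on P W c \<and> tpt P b \<in> W \<longrightarrow>
           lconn E a (\<lambda>m. lscale E (c m) (t m)) (tpt P b)
             = ladd E (lscale E (frechet_derivative (c \<circ> tpt P) (at b) a) (t (tpt P b)))
                      (lscale E (c (tpt P b)) (lconn E a t (tpt P b))))) \<and>
     (\<forall>W t t'. smooth_section P E W t \<and> smooth_section P E W t' \<longrightarrow>
        (\<forall>a. \<forall>m\<in>W. lconn E a (\<lambda>m. ladd E (t m) (t' m)) m = ladd E (lconn E a t m) (lconn E a t' m)) \<and>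
        (\<forall>a b. tpt P b \<in> W \<longrightarrow>
           frechet_derivative (\<lambda>b. lherm E (t (tpt P b)) (t' (tpt P b))) (at b) a
             = lherm E (lconn E a t (tpt P b)) (t' (tpt P b))
               + lherm E (t (tpt P b)) (lconn E a t' (tpt P b)))) \<and>
     (\<forall>W W' t t'. smooth_section P E W t \<and> smooth_section P E W' t' \<and> W' \<subseteq> W \<and> (\<forall>m\<in>W'. t m = t' m) \<longrightarrow>
        (\<forall>a. \<forall>m\<in>W'. lconn E a t m = lconn E a t' m))"

text \<open>Curvature \<open>i \<psi>\<close>; the bracket term vanishes since constant coordinate fields commute.\<close>

definition has_curvature_i ::
    "'b::euclidean_space \<Rightarrow> ('v, 'b) line_bundle \<Rightarrow> ('b \<Rightarrow> 'b \<Rightarrow> 'b \<Rightarrow> real) \<Rightarrow> bool" where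
  "has_curvature_i P E \<psi> \<longleftrightarrow>
     (\<forall>W t. smooth_section P E W t \<longrightarrow>
        (\<forall>a a' b. tpt P b \<in> W \<longrightarrow>
           lconn E a (lconn E a' t) (tpt P b)
             = ladd E (lconn E a' (lconn E a t) (tpt P b))
                      (lscale E (\<i> * of_real (\<psi> b a a')) (t (tpt P b)))))"

definition unit_section ::
    "'b::euclidean_space \<Rightarrow> ('v, 'b) line_bundle \<Rightarrow> 'b set set \<Rightarrow> ('b set \<Rightarrow> 'v) \<Rightarrow> bool" where
  "unit_section P E U s \<longleftrightarrow> smooth_section P E U s \<and> (\<forall>m\<in>U. lherm E (s m) (s m) = 1)"

section \<open>The circle bundle and its metric\<close>

text \<open>
  The unit circle bundle: a local unit section \<open>s\<close> on \<open>U\<close> gives the parametrisations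
  \<open>(x, b) \<mapsto> e\<^sup>i\<^sup>x s(b)\<close>, restricted to open sets \<open>D\<close> on which they are injective.
\<close>

type_synonym ('v, 'b) cb_index = "(real \<times> 'b) set \<times> 'b set set \<times> ('b set \<Rightarrow> 'v)"

definition circle_bundle ::
    "'b::euclidean_space \<Rightarrow> ('v, 'b) line_bundle \<Rightarrow> (('v, 'b) cb_index, real \<times> 'b, 'v) atlas" where
  "circle_bundle P E = \<lparr>
     charts = {(D, U, s). unit_section P E U s \<and> open D \<and> (\<forall>(x, b)\<in>D. tpt P b \<in> U) \<and>
                inj_on (\<lambda>(x, b). lscale E (cis x) (s (tpt P b))) D},
     cdom = (\<lambda>(D, U, s). D),
     param = (\<lambda>(D, U, s) (x, b). lscale E (cis x) (s (tpt P b))) \<rparr>"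

text \<open>\<open>\<phi>\<close> with \<open>\<nabla> s = i \<phi> \<otimes> s\<close>.\<close>

definition local_form ::
    "('v, 'b::euclidean_space) line_bundle \<Rightarrow> ('b set \<Rightarrow> 'v) \<Rightarrow> 'b set \<Rightarrow> 'b \<Rightarrow> real" where
  "local_form E s m a = (THE r. lconn E a s m = lscale E (\<i> * of_real r) (s m))"

definition theta ::
    "'b::euclidean_space \<Rightarrow> ('v, 'b) line_bundle \<Rightarrow> ('v, 'b) cb_index \<Rightarrow> real \<times> 'b \<Rightarrow> real \<times> 'b \<Rightarrow> real" where
  "theta P E = (\<lambda>(D, U, s) (x, b) (\<xi>, a). \<xi> + local_form E s (tpt P b) a)"

definition vertical :: "('v, 'b) cb_index \<Rightarrow> real \<times> 'b \<Rightarrow> real \<times> 'b::euclidean_space" where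
  "vertical i u = (1, 0)"

text \<open>The metric \<open>2 \<theta> \<pi>\<^sup>*\<eta> + f \<pi>\<^sup>*\<eta>\<^sup>2 + \<pi>\<^sup>*g\<close> with \<open>\<eta>\<close> and \<open>g\<close> constant in the standard coordinates.\<close>

definition wave_metric ::
    "'b::euclidean_space \<Rightarrow> ('v, 'b) line_bundle \<Rightarrow> ('b \<Rightarrow> real) \<Rightarrow> ('b \<Rightarrow> 'b \<Rightarrow> real) \<Rightarrow> ('b set \<Rightarrow> real) \<Rightarrow>
     (('v, 'b) cb_index, real \<times> 'b) tensor02" where
  "wave_metric P E \<eta> g f i u v v' =
     theta P E i u v * \<eta> (snd v') + theta P E i u v' * \<eta> (snd v)
     + f (tpt P (snd u)) * \<eta> (snd v) * \<eta> (snd v') + g (snd v) (snd v')"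

section \<open>The data on the torus\<close>

text \<open>
  Standard coordinates \<open>(y, z)\<close>. The index type of \<open>y\<close> carries no order, so the
  distinguished coordinate \<open>y\<^sup>1\<close> is \<open>y $ j1\<close> for a fixed index \<open>j1\<close>.
\<close>

definition eta :: "(real^'n) \<times> real \<Rightarrow> real" where
  "eta a = snd a"

definition psi :: "'n \<Rightarrow> (real^'n) \<times> real \<Rightarrow> (real^'n) \<times> real \<Rightarrow> (real^'n) \<times> real \<Rightarrow> real" where
  "psi j1 b a a' = fst a $ j1 * snd a' - fst a' $ j1 * snd a"

definition flat_metric :: "(real^'n) \<times> real \<Rightarrow> (real^'n) \<times> real \<Rightarrow> real" where
  "flat_metric a a' = (\<Sum>j\<in>UNIV. fst a $ j * fst a' $ j) + snd a * snd a'"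

end

(*
The vertical field V is parallel: it is Killing, and its dual form is the closed form eta.  The
horizontal lifts of the coordinate fields of y trivialise V^perp / V by parallel sections.  Hence
every holonomy transformation fixes V, acts trivially on the screen space and is an isometry, and
the holonomy algebra is a linear subspace of R^n.  A vector of R^n orthogonal to a proper subspace
would span a non-degenerate invariant line, so indecomposability forces the whole of R^n.

Along a geodesic c = z' is constant and the base curve solves y'' = c^2 (e_1 + (grad_y f) / 2),
an equation with periodic, hence globally Lipschitz, right hand side; so the base curve exists for
all times.  Then theta' is an explicit function of the base curve, and the geodesic is recovered
as the lift of the base curve with prescribed value of theta on its velocity, which exists on all
of R because local lifts differ by rotations of the fibre.
*)

theory Submission
  imports Defs
begin

section \<open>Calculus of smooth maps\<close>

text \<open>A compact Lorentzian manifold need not be complete, and the base equation is quadratic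
  in the velocity. What saves it: fibre rotations are isometries, so the chart components of the
  metric depend on the base point only, and the sole quadratic factor is the square of z', which is
  constant and can be frozen. The vector e_1 is psi contracted with the field of z. The fibre
  coordinate exists only up to gauge and modulo \<open>2 * pi\<close>, so nothing is continued in
  coordinates: the ratio of two lifts with the same value of theta is constant, and this replaces a
  global fibre coordinate.

  In the holonomy part parallel transport need not be constructed: a holonomy transformation comes
  with its parallel fields, and only their invariants are used. The delicate point is that the Lie
  algebra is closed under sums, because it is defined through one-parameter subgroups of a group.
  Translations commute, so the exponential of a sum is a composition, and compositions are realised
  by concatenated loops.\<close>

lemma frechet_derivative_eqI:
  "(f has_derivative f') (at x) \<Longrightarrow> frechet_derivative f (at x) = f'"
  using frechet_derivative_at by metis

text \<open>Openness of \<open>S\<close> enters because the derivatives in \<open>Ck_on\<close> are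
  two-sided: the functions must agree on a neighbourhood of each point.\<close>

lemma Ck_on_cong:
  assumes "open S" "\<And>x. x \<in> S \<Longrightarrow> f x = g x" "Ck_on k S f"
  shows "Ck_on k S g"
  using assms
proof (induction k arbitrary: f g)
  case 0
  then show ?case by (auto cong: continuous_on_cong)
next
  case (Suc k)
  have d: "(g has_derivative frechet_derivative f (at x)) (at x)" if "x \<in> S" for x
    using Suc.prems that
    by (auto intro!: has_derivative_transform_within_open[of f _ x UNIV S g] simp: frechet_derivative_works)
  have "Ck_on k S (\<lambda>x. frechet_derivative g (at x) v)" for v
    by (rule Suc.IH[of "\<lambda>x. frechet_derivative f (at x) v"])
      (use Suc.prems d in \<open>auto simp: frechet_derivative_eqI[OF d]\<close>)
  then show ?case using d unfolding Ck_on.simps differentiable_def by blast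
qed

lemma Ck_on_subset: "Ck_on k S f \<Longrightarrow> T \<subseteq> S \<Longrightarrow> Ck_on k T f"
  by (induction k arbitrary: f) (auto intro: continuous_on_subset)

lemma Ck_on_Suc_imp: "Ck_on (Suc k) S f \<Longrightarrow> Ck_on k S f"
proof (induction k arbitrary: f)
  case 0
  then show ?case
    by (auto intro!: continuous_at_imp_continuous_on differentiable_imp_continuous_within)
next
  case (Suc k)
  from Suc.prems have d: "\<forall>x\<in>S. f differentiable (at x)"
    and v: "\<And>v. Ck_on (Suc k) S (\<lambda>x. frechet_derivative f (at x) v)"
    unfolding Ck_on.simps(2)[of "Suc k" S f] by blast+
  show ?case unfolding Ck_on.simps(2)[of k S f] using d Suc.IH[OF v] by blast
qed

lemma Ck_on_imp_continuous_on: "Ck_on k S f \<Longrightarrow> continuous_on S f"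
proof (induction k)
  case (Suc k)
  then show ?case using Ck_on_Suc_imp by blast
qed simp

lemma Ck_on_local:
  assumes "\<And>x. x \<in> S \<Longrightarrow> \<exists>T. open T \<and> x \<in> T \<and> Ck_on k T f"
  shows "Ck_on k S f"
  using assms
proof (induction k arbitrary: f)
  case 0
  then show ?case
    by (metis Ck_on.simps(1) continuous_at_imp_continuous_on continuous_on_eq_continuous_at)
next
  case (Suc k)
  have "Ck_on k S (\<lambda>x. frechet_derivative f (at x) v)" for v
    by (rule Suc.IH) (use Suc.prems in fastforce)
  then show ?case using Suc.prems by fastforce
qed

text \<open>Lets an explicit derivative stand in for \<open>frechet_derivative\<close>; the
  inductions for sums, products and compositions run through it.\<close>

lemma Ck_on_SucI:
  assumes "open S" "\<And>x. x \<in> S \<Longrightarrow> (f has_derivative f' x) (at x)" "\<And>v. Ck_on k S (\<lambda>x. f' x v)"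
  shows "Ck_on (Suc k) S f"
proof -
  have "Ck_on k S (\<lambda>x. frechet_derivative f (at x) v)" for v
    by (rule Ck_on_cong[OF assms(1) _ assms(3)[of v]]) (simp add: frechet_derivative_eqI[OF assms(2)])
  then show ?thesis using assms(2) by (auto simp: differentiable_def)
qed

lemma Ck_on_SucD:
  assumes "Ck_on (Suc k) S f" 
  shows "x \<in> S \<Longrightarrow> (f has_derivative frechet_derivative f (at x)) (at x)"
    and "Ck_on k S (\<lambda>x. frechet_derivative f (at x) v)"
  using assms by (auto simp: frechet_derivative_works)

lemma Ck_on_const: "Ck_on k S (\<lambda>_. c)"
  by (induction k arbitrary: c) auto

lemma Ck_on_bounded_linear:
  assumes "open S" "bounded_linear L" "Ck_on k S f"
  shows "Ck_on k S (\<lambda>x. L (f x))"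
  using assms(3)
proof (induction k arbitrary: f)
  case 0
  then show ?case by (auto intro!: bounded_linear.continuous_on[OF assms(2)])
next
  case (Suc k)
  show ?case
    by (rule Ck_on_SucI[OF assms(1), where f' = "\<lambda>x v. L (frechet_derivative f (at x) v)"])
      (use Ck_on_SucD[OF Suc.prems] Suc.IH in \<open>auto intro!: bounded_linear.has_derivative[OF assms(2)]\<close>)
qed

lemma Ck_on_add:
  assumes "open S" "Ck_on k S f" "Ck_on k S g"
  shows "Ck_on k S (\<lambda>x. f x + g x)"
  using assms(2,3)
proof (induction k arbitrary: f g)
  case 0
  then show ?case by (auto intro!: continuous_intros)
next
  case (Suc k)
  show ?case
    by (rule Ck_on_SucI[OF assms(1),
          where f' = "\<lambda>x v. frechet_derivative f (at x) v + frechet_derivative g (at x) v"])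
      (rule has_derivative_add Suc.IH Ck_on_SucD[OF Suc.prems(1)] Ck_on_SucD[OF Suc.prems(2)] | assumption)+
qed

lemma Ck_on_sum:
  assumes "open S" "\<And>i. i \<in> I \<Longrightarrow> Ck_on k S (f i)"
  shows "Ck_on k S (\<lambda>x. \<Sum>i\<in>I. f i x)"
  using assms(2)
proof (induction I rule: infinite_finite_induct)
  case (insert i I)
  then show ?case by (simp add: Ck_on_add[OF assms(1)])
qed (auto simp: Ck_on_const)

lemma Ck_on_bilinear:
  assumes "open S" "bounded_bilinear B" "Ck_on k S f" "Ck_on k S g"
  shows "Ck_on k S (\<lambda>x. B (f x) (g x))"
  using assms(3,4)
proof (induction k arbitrary: f g)
  case 0
  then show ?case by (auto intro!: bounded_bilinear.continuous_on[OF assms(2)])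
next
  case (Suc k)
  show ?case
  proof (rule Ck_on_SucI[OF assms(1)])
    show "((\<lambda>x. B (f x) (g x)) has_derivative
       (\<lambda>v. B (f x) (frechet_derivative g (at x) v) + B (frechet_derivative f (at x) v) (g x))) (at x)"
      if "x \<in> S" for x
      using bounded_bilinear.FDERIV[OF assms(2) Ck_on_SucD(1)[OF Suc.prems(1) that] Ck_on_SucD(1)[OF Suc.prems(2) that]] .
    show "Ck_on k S (\<lambda>x. B (f x) (frechet_derivative g (at x) v) + B (frechet_derivative f (at x) v) (g x))" for v
      by (intro Ck_on_add[OF assms(1)] Suc.IH Ck_on_SucD(2)[OF Suc.prems(1)] Ck_on_SucD(2)[OF Suc.prems(2)]
           Ck_on_Suc_imp[OF Suc.prems(1)] Ck_on_Suc_imp[OF Suc.prems(2)])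
  qed
qed

text \<open>\<open>Ck_on\<close> controls the derivative of \<open>g\<close> only in fixed
  directions, while the chain rule produces the direction
  \<open>frechet_derivative f (at x) v\<close>, which moves with \<open>x\<close>. Expanding it in
  the basis of the Euclidean middle space gives a finite sum of products, to which the induction
  hypothesis applies.\<close>

lemma Ck_on_compose:
  fixes f :: "'a::real_normed_vector \<Rightarrow> 'b::euclidean_space" and g :: "'b \<Rightarrow> 'c::real_normed_vector"
  assumes "open S" "open T" "\<And>x. x \<in> S \<Longrightarrow> f x \<in> T" "Ck_on k S f" "Ck_on k T g"
  shows "Ck_on k S (\<lambda>x. g (f x))"
  using assms(4,5)
proof (induction k arbitrary: g)
  case 0
  then show ?case using assms(3) by (auto intro!: continuous_on_compose2[of T g])
next
  case (Suc k)
  have lin: "linear (frechet_derivative g (at (f x)))" if "x \<in> S" for x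
    using Suc.prems(2) assms(3)[OF that] by (auto intro!: linear_frechet_derivative)
  show ?case
  proof (rule Ck_on_SucI[OF assms(1)])
    show "((\<lambda>x. g (f x)) has_derivative
       (\<lambda>v. \<Sum>b\<in>Basis. (frechet_derivative f (at x) v \<bullet> b) *\<^sub>R frechet_derivative g (at (f x)) b)) (at x)"
      if "x \<in> S" for x
    proof -
      have "(\<lambda>w. frechet_derivative g (at (f x)) w) = (\<lambda>w.  (\<Sum>b\<in>Basis. (w \<bullet> b) *\<^sub>R frechet_derivative g (at (f x)) b))"
      proof
        fix w
        have "frechet_derivative g (at (f x)) (\<Sum>b\<in>Basis. (w \<bullet> b) *\<^sub>R b)
            = (\<Sum>b\<in>Basis. (w \<bullet> b) *\<^sub>R frechet_derivative g (at (f x)) b)"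
          by (simp only: linear_sum[OF lin[OF that]] linear_scale[OF lin[OF that]])
        then show "frechet_derivative g (at (f x)) w = (\<Sum>b\<in>Basis. (w \<bullet> b) *\<^sub>R frechet_derivative g (at (f x)) b)"
          by (simp only: euclidean_representation)
      qed
      note rep = fun_cong[OF this]
      show ?thesis
        unfolding rep[of "frechet_derivative f (at x) v" for v, symmetric]
        using has_derivative_compose[OF Ck_on_SucD(1)[OF Suc.prems(1) that] Ck_on_SucD(1)[OF Suc.prems(2) assms(3)[OF that]]] .
    qed
    show "Ck_on k S (\<lambda>x. \<Sum>b\<in>Basis. (frechet_derivative f (at x) v \<bullet> b) *\<^sub>R frechet_derivative g (at (f x)) b)" for v
      by (rule Ck_on_sum[OF assms(1) Ck_on_bilinear[OF assms(1) bounded_bilinear_scaleR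
            Ck_on_bounded_linear[OF assms(1) bounded_linear_inner_left Ck_on_SucD(2)[OF Suc.prems(1)]]
            Suc.IH[OF Ck_on_Suc_imp[OF Suc.prems(1)] Ck_on_SucD(2)[OF Suc.prems(2)]]]])
  qed
qed

text \<open>Meant for functions whose derivative is an expression in functions already under
  control, often in the function itself; it yields smoothness of \<open>inverse\<close>,
  \<open>sqrt\<close> and \<open>Ln\<close>.\<close>

lemma Ck_on_field_derivative:
  fixes g :: "'a::real_normed_field \<Rightarrow> 'a"
  assumes "open S" "\<And>x. x \<in> S \<Longrightarrow> (g has_field_derivative g' x) (at x)" "Ck_on k S g'"
  shows "Ck_on (Suc k) S g"
  by (rule Ck_on_SucI[OF assms(1) assms(2)[unfolded has_field_derivative_def]])
    (auto intro!: Ck_on_bounded_linear[OF assms(1) bounded_linear_mult_left assms(3)])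

section \<open>Smoothness of all orders, and the elementary functions\<close>

lemma smooth_onI: "(\<And>k. Ck_on k S f) \<Longrightarrow> smooth_on S f"
  by (simp add: smooth_on_def)

lemma smooth_onD: "smooth_on S f \<Longrightarrow> Ck_on k S f"
  by (simp add: smooth_on_def)

lemma smooth_on_cong:
  "open S \<Longrightarrow> (\<And>x. x \<in> S \<Longrightarrow> f x = g x) \<Longrightarrow> smooth_on S f \<Longrightarrow> smooth_on S g"
  unfolding smooth_on_def using Ck_on_cong by blast

lemma smooth_on_subset: "smooth_on S f \<Longrightarrow> T \<subseteq> S \<Longrightarrow> smooth_on T f"
  unfolding smooth_on_def using Ck_on_subset by blast

lemma smooth_on_local:
  "(\<And>x. x \<in> S \<Longrightarrow> \<exists>T. open T \<and> x \<in> T \<and> smooth_on T f) \<Longrightarrow> smooth_on S f"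
  unfolding smooth_on_def by (meson Ck_on_local)

lemma smooth_on_imp_continuous_on: "smooth_on S f \<Longrightarrow> continuous_on S f"
  unfolding smooth_on_def using Ck_on_imp_continuous_on by blast

lemma smooth_on_const [simp, intro]: "smooth_on S (\<lambda>_. c)"
  by (simp add: smooth_on_def Ck_on_const)

lemma smooth_on_bounded_linear:
  "open S \<Longrightarrow> bounded_linear L \<Longrightarrow> smooth_on S f \<Longrightarrow> smooth_on S (\<lambda>x. L (f x))"
  by (simp add: smooth_on_def Ck_on_bounded_linear)

lemma smooth_on_id: "open S \<Longrightarrow> smooth_on S (\<lambda>x. x)"
  unfolding smooth_on_def
proof
  fix k assume "open S" then show "Ck_on k S (\<lambda>x. x)"
    by (cases k) (auto intro: Ck_on_const)
qed

lemma smooth_on_linear: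
  "open S \<Longrightarrow> bounded_linear L \<Longrightarrow> smooth_on S L"
  using smooth_on_bounded_linear[OF _ _ smooth_on_id] by blast

lemma smooth_on_add:
  "open S \<Longrightarrow> smooth_on S f \<Longrightarrow> smooth_on S g \<Longrightarrow> smooth_on S (\<lambda>x. f x + g x)"
  by (simp add: smooth_on_def Ck_on_add)

lemma smooth_on_sum:
  "open S \<Longrightarrow> (\<And>i. i \<in> I \<Longrightarrow> smooth_on S (f i)) \<Longrightarrow> smooth_on S (\<lambda>x. \<Sum>i\<in>I. f i x)"
  by (simp add: smooth_on_def Ck_on_sum)

lemma smooth_on_bilinear:
  "open S \<Longrightarrow> bounded_bilinear B \<Longrightarrow> smooth_on S f \<Longrightarrow> smooth_on S g \<Longrightarrow> smooth_on S (\<lambda>x. B (f x) (g x))"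
  by (simp add: smooth_on_def Ck_on_bilinear)

lemmas smooth_on_mult = smooth_on_bilinear[OF _ bounded_bilinear_mult]
lemmas smooth_on_scaleR = smooth_on_bilinear[OF _ bounded_bilinear_scaleR]
lemmas smooth_on_inner = smooth_on_bilinear[OF _ bounded_bilinear_inner]

lemma smooth_on_compose:
  fixes f :: "'a::real_normed_vector \<Rightarrow> 'b::euclidean_space"
  shows "open S \<Longrightarrow> open T \<Longrightarrow> (\<And>x. x \<in> S \<Longrightarrow> f x \<in> T) \<Longrightarrow> smooth_on S f \<Longrightarrow> smooth_on T g
    \<Longrightarrow> smooth_on S (\<lambda>x. g (f x))"
  by (simp add: smooth_on_def Ck_on_compose)

lemma smooth_on_Pair:
  fixes f :: "'a::real_normed_vector \<Rightarrow> 'b::real_normed_vector" and g :: "'a \<Rightarrow> 'c::real_normed_vector"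
  assumes "open S" "smooth_on S f" "smooth_on S g"
  shows "smooth_on S (\<lambda>x. (f x, g x))"
proof -
  have "bounded_linear (\<lambda>x::'b. (x, 0::'c))" "bounded_linear (\<lambda>x::'c. (0::'b, x))"
    by (auto intro!: bounded_linear_Pair bounded_linear_ident bounded_linear_zero)
  from smooth_on_add[OF assms(1) smooth_on_bounded_linear[OF assms(1) this(1) assms(2)]
      smooth_on_bounded_linear[OF assms(1) this(2) assms(3)]]
  show ?thesis by simp
qed

lemma smooth_on_frechet_derivative:
  assumes "smooth_on S f"
  shows "smooth_on S (\<lambda>x. frechet_derivative f (at x) v)"
  unfolding smooth_on_def using assms Ck_on_SucD(2) smooth_on_def by blast

lemma smooth_on_has_derivative:
  "smooth_on S f \<Longrightarrow> x \<in> S \<Longrightarrow> (f has_derivative frechet_derivative f (at x)) (at x)"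
  using Ck_on_SucD(1) smooth_on_def by blast

lemma smooth_on_inverse: "smooth_on (- {0}) (inverse :: 'a::real_normed_field \<Rightarrow> 'a)"
proof (rule smooth_onI)
  fix k show "Ck_on k (- {0}) (inverse :: 'a \<Rightarrow> 'a)"
  proof (induction k)
    case 0 then show ?case by (auto intro!: continuous_intros)
  next
    case (Suc k)
    have "Ck_on k (- {0}) (\<lambda>x::'a. - (inverse x * inverse x))"
      by (intro Ck_on_bounded_linear[OF _ bounded_linear_minus[OF bounded_linear_ident]]
          Ck_on_bilinear[OF _ bounded_bilinear_mult] Suc) auto
    then show ?case
      by (rule Ck_on_field_derivative[rotated 2])
        (auto intro!: derivative_eq_intros simp: power2_eq_square)
  qed
qed

lemma smooth_on_divide:
  fixes f g :: "'a::real_normed_vector \<Rightarrow> 'b::{real_normed_field,euclidean_space}"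
  assumes "open S" "smooth_on S f" "smooth_on S g" "\<And>x. x \<in> S \<Longrightarrow> g x \<noteq> 0"
  shows "smooth_on S (\<lambda>x. f x / g x)"
  unfolding divide_inverse
  by (intro smooth_on_mult assms smooth_on_compose[OF assms(1) _ _ assms(3) smooth_on_inverse])
    (use assms in auto)

lemma smooth_on_sqrt: "smooth_on {0<..} sqrt"
proof (rule smooth_onI)
  fix k show "Ck_on k {0<..} sqrt"
  proof (induction k)
    case 0 then show ?case by (auto intro!: continuous_intros)
  next
    case (Suc k)
    have "Ck_on k {0<..} (\<lambda>x. inverse (sqrt x) / 2)"
      by (rule Ck_on_bounded_linear[OF _ bounded_linear_divide Ck_on_compose[OF _ _ _ Suc smooth_onD[OF smooth_on_inverse]]])
        (auto simp: open_Compl)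
    note k = this
    have d: "(sqrt has_field_derivative inverse (sqrt x) / 2) (at x)" if "x \<in> {0<..}" for x
      using DERIV_real_sqrt[of x] that by simp
    show ?case
      by (rule Ck_on_field_derivative[OF open_greaterThan d k])
  qed
qed

lemma smooth_on_Ln: "smooth_on (- \<real>\<^sub>\<le>\<^sub>0) Ln"
proof (rule smooth_onI)
  fix k show "Ck_on k (- \<real>\<^sub>\<le>\<^sub>0) Ln"
  proof (cases k)
    case 0 then show ?thesis by (auto intro!: continuous_intros)
  next
    case (Suc k)
    have "Ck_on k (- \<real>\<^sub>\<le>\<^sub>0) (inverse :: complex \<Rightarrow> complex)"
      by (rule Ck_on_subset[OF smooth_onD[OF smooth_on_inverse]]) auto
    then show ?thesis unfolding Suc
      by (rule Ck_on_field_derivative[rotated 2])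
        (auto intro!: derivative_eq_intros simp: field_simps)
  qed
qed

section \<open>The torus\<close>

lemma tpt_eq_iff:
  "tpt P b = tpt P b' \<longleftrightarrow> (\<forall>k\<in>Basis. \<exists>m::int. (b' - b) \<bullet> k = of_int m * (P \<bullet> k))"
proof
  assume "tpt P b = tpt P b'"
  moreover have "b' \<in> tpt P b'" by (auto simp: tpt_def intro: exI[of _ 0])
  ultimately have "b' \<in> tpt P b" by simp
  then show "\<forall>k\<in>Basis. \<exists>m::int. (b' - b) \<bullet> k = of_int m * (P \<bullet> k)" by (simp add: tpt_def)
next
  assume *: "\<forall>k\<in>Basis. \<exists>m::int. (b' - b) \<bullet> k = of_int m * (P \<bullet> k)"
  have "(\<exists>m::int. (c - b) \<bullet> k = of_int m * (P \<bullet> k)) \<longleftrightarrow> (\<exists>m::int. (c - b') \<bullet> k = of_int m * (P \<bullet> k))"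
    if "k \<in> Basis" for c k
  proof -
    from * that obtain m0 :: int where m0: "(b' - b) \<bullet> k = of_int m0 * (P \<bullet> k)" by blast
    show ?thesis
    proof
      assume "\<exists>m::int. (c - b) \<bullet> k = of_int m * (P \<bullet> k)"
      then obtain m :: int where "(c - b) \<bullet> k = of_int m * (P \<bullet> k)" by blast
      with m0 have "(c - b') \<bullet> k = of_int (m - m0) * (P \<bullet> k)"
        by (simp add: inner_diff_left algebra_simps)
      then show "\<exists>m::int. (c - b') \<bullet> k = of_int m * (P \<bullet> k)" by blast
    next
      assume "\<exists>m::int. (c - b') \<bullet> k = of_int m * (P \<bullet> k)"
      then obtain m :: int where "(c - b') \<bullet> k = of_int m * (P \<bullet> k)" by blast
      with m0 have "(c - b) \<bullet> k = of_int (m + m0) * (P \<bullet> k)"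
        by (simp add: inner_diff_left algebra_simps)
      then show "\<exists>m::int. (c - b) \<bullet> k = of_int m * (P \<bullet> k)" by blast
    qed
  qed
  then show "tpt P b = tpt P b'" by (auto simp: tpt_def)
qed

text \<open>The difference of two representatives of one point is a lattice vector, and lattice
  translations are invisible on the torus.\<close>

lemma tpt_translate: "tpt P b = tpt P b' \<Longrightarrow> tpt P (c + (b' - b)) = tpt P c"
proof -
  assume "tpt P b = tpt P b'"
  then have "tpt P c = tpt P (c + (b' - b))" unfolding tpt_eq_iff by simp
  then show ?thesis by simp
qed

lemma istopology_torus: "istopology (\<lambda>U. U \<subseteq> torus P \<and> open (tpt P -` U))"
  unfolding istopology_def by (auto simp: vimage_Union)

lemma openin_torus_iff: "openin (torus_top P) U \<longleftrightarrow> U \<subseteq> torus P \<and> open (tpt P -` U)"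
  unfolding torus_top_def using topology_inverse'[OF istopology_torus] by metis

lemma tpt_in_torus [simp]: "tpt P b \<in> torus P"
  by (simp add: torus_def)

lemma torus_cases: 
  assumes "m \<in> torus P" obtains b where "m = tpt P b"
  using assms by (auto simp: torus_def)

text \<open>Divided by the periods, the difference of two lifts has integer coordinates, and a
  continuous integer-valued function on a connected set is constant. This compares the chart
  coordinates of a geodesic with a base curve.\<close>

lemma tpt_const_diff:
  fixes b1 b2 :: "'a::topological_space \<Rightarrow> 'b::euclidean_space"
  assumes per: "\<And>k. k \<in> Basis \<Longrightarrow> 0 < P \<bullet> k"
    and "connected K" "continuous_on K b1" "continuous_on K b2"
    and eq: "\<And>t. t \<in> K \<Longrightarrow> tpt P (b1 t) = tpt P (b2 t)" and t0: "t0 \<in> K" "t \<in> K"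
  shows "b1 t - b2 t = b1 t0 - b2 t0"
proof (rule euclidean_eqI)
  fix k :: 'b assume k: "k \<in> Basis"
  define g where "g t = (b1 t - b2 t) \<bullet> k / (P \<bullet> k)" for t
  have int: "g t \<in> \<int>" if "t \<in> K" for t
  proof -
    from eq[OF that, symmetric] k obtain m :: int where "(b1 t - b2 t) \<bullet> k = of_int m * (P \<bullet> k)"
      by (auto simp: tpt_eq_iff)
    with per[OF k] show ?thesis by (simp add: g_def)
  qed
  have "g constant_on K"
  proof (rule continuous_discrete_range_constant[OF \<open>connected K\<close>])
    show "continuous_on K g" unfolding g_def
      using per[OF k] assms(3,4) by (auto intro!: continuous_intros)
    show "\<exists>e>0. \<forall>y. y \<in> K \<and> g y \<noteq> g x \<longrightarrow> e \<le> norm (g y - g x)" if "x \<in> K" for x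
      using int that by (intro exI[of _ 1]) (auto intro!: Ints_nonzero_abs_ge1)
  qed
  then have "g t = g t0" using t0 unfolding constant_on_def by metis
  then show "(b1 t - b2 t) \<bullet> k = (b1 t0 - b2 t0) \<bullet> k"
    using per[OF k] by (simp add: g_def)
qed

text \<open>The smallest period serves as radius: a lattice vector shorter than it has all its
  integer coordinates equal to zero.\<close>

lemma tpt_locally_inj:
  fixes P :: "'b::euclidean_space"
  assumes per: "\<And>k. k \<in> Basis \<Longrightarrow> 0 < P \<bullet> k"
  obtains r where "r > 0" "\<And>b b'. tpt P b = tpt P b' \<Longrightarrow> dist b b' < r \<Longrightarrow> b = b'"
proof
  let ?r = "Min ((\<lambda>k. P \<bullet> k) ` Basis)"
  show "?r > 0" using per by simp
  fix b b' assume eq: "tpt P b = tpt P b'" and d: "dist b b' < ?r"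
  show "b = b'"
  proof (rule euclidean_eqI)
    fix k :: 'b assume k: "k \<in> Basis"
    from eq k obtain m :: int where m: "(b' - b) \<bullet> k = of_int m * (P \<bullet> k)" by (auto simp: tpt_eq_iff)
    have "\<bar>(b' - b) \<bullet> k\<bar> < P \<bullet> k"
      using Basis_le_norm[OF k, of "b' - b"] d k by (fastforce simp: dist_norm norm_minus_commute)
    then have "\<bar>of_int m\<bar> * (P \<bullet> k) < 1 * (P \<bullet> k)" using per[OF k] m by (simp add: abs_mult)
    then have "\<bar>of_int m\<bar> < (1::real)" using per[OF k] mult_less_cancel_right_pos by blast
    then have "m = 0" by linarith
    with m show "b \<bullet> k = b' \<bullet> k" by (simp add: inner_diff_left)
  qed
qed

lemma tpt_fundamental_domain:
  fixes P :: "'b::euclidean_space"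
  assumes per: "\<And>k. k \<in> Basis \<Longrightarrow> 0 < P \<bullet> k"
  shows "\<exists>b'\<in>cbox 0 P. tpt P b = tpt P b'"
proof
  let ?b = "\<Sum>k\<in>Basis. (b \<bullet> k - of_int \<lfloor>b \<bullet> k / (P \<bullet> k)\<rfloor> * (P \<bullet> k)) *\<^sub>R k"
  have fl: "0 \<le> b \<bullet> k - of_int \<lfloor>b \<bullet> k / (P \<bullet> k)\<rfloor> * (P \<bullet> k)" 
    "b \<bullet> k - of_int \<lfloor>b \<bullet> k / (P \<bullet> k)\<rfloor> * (P \<bullet> k) \<le> P \<bullet> k" if "k \<in> Basis" for k
  proof -
    note floor_divide_lower[OF per[OF that], of "b \<bullet> k"] floor_divide_upper[OF per[OF that], of "b \<bullet> k"]
    then show "0 \<le> b \<bullet> k - of_int \<lfloor>b \<bullet> k / (P \<bullet> k)\<rfloor> * (P \<bullet> k)" 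
    "b \<bullet> k - of_int \<lfloor>b \<bullet> k / (P \<bullet> k)\<rfloor> * (P \<bullet> k) \<le> P \<bullet> k"
      by (auto simp: algebra_simps)
  qed
  show "?b \<in> cbox 0 P" using fl by (auto simp: mem_box)
  show "tpt P b = tpt P ?b"
    unfolding tpt_eq_iff
    by (auto simp: inner_diff_left intro!: exI[of _ "- \<lfloor>b \<bullet> k / (P \<bullet> k)\<rfloor>" for k])
qed

text \<open>Compactness of the torus, seen on the universal cover: all values are already taken on
  the compact cell \<open>cbox 0 P\<close>.\<close>

lemma periodic_bounded:
  fixes P :: "'b::euclidean_space" and g :: "'b \<Rightarrow> 'c::real_normed_vector"
  assumes per: "\<And>k. k \<in> Basis \<Longrightarrow> 0 < P \<bullet> k"
    and g: "continuous_on UNIV g" "\<And>b b'. tpt P b = tpt P b' \<Longrightarrow> g b = g b'"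
  obtains C where "C > 0" "\<And>b. norm (g b) \<le> C"
proof -
  have "bounded (g ` cbox 0 P)"
    by (intro compact_imp_bounded compact_continuous_image continuous_on_subset[OF g(1)]) auto
  then obtain C where "C > 0" "\<And>b. b \<in> cbox 0 P \<Longrightarrow> norm (g b) \<le> C"
    unfolding bounded_pos by auto
  then show thesis
    using that[of C] tpt_fundamental_domain[OF per] g(2) by metis
qed

lemma periodic_frechet_derivative:
  fixes P :: "'b::euclidean_space"
  assumes "\<And>b b'. tpt P b = tpt P b' \<Longrightarrow> g b = g b'" "tpt P b = tpt P b'"
    and "g differentiable (at b)"
  shows "frechet_derivative g (at b) = frechet_derivative g (at b')"
proof -
  have b: "b = b' + (b - b')" by simp
  have "(g has_derivative frechet_derivative g (at b)) (at (b' + (b - b')))"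
    using assms(3) by (simp add: frechet_derivative_works)
  then have "((\<lambda>x. g (x + (b - b'))) has_derivative frechet_derivative g (at b)) (at b')"
    by (auto intro!: derivative_eq_intros has_derivative_compose[of "\<lambda>x. x + (b - b')" "\<lambda>x. x" b' UNIV g])
  moreover have "g (x + (b - b')) = g x" for x
    using assms(1)[OF tpt_translate[of P b' b x]] assms(2) by simp
  ultimately show ?thesis by (simp add: frechet_derivative_eqI)
qed

section \<open>The topology of an atlas\<close>

lemma openin_mtop_iff:
  "openin (mtop A) W \<longleftrightarrow> W \<subseteq> points A \<and> (\<forall>i\<in>charts A. open {u \<in> cdom A i. param A i u \<in> W})"
proof -
  have "istopology (\<lambda>W. W \<subseteq> points A \<and> (\<forall>i\<in>charts A. open {u \<in> cdom A i. param A i u \<in> W}))"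
    unfolding istopology_def
  proof (intro conjI allI impI ballI)
    fix W W' i assume *: "W \<subseteq> points A \<and> (\<forall>i\<in>charts A. open {u \<in> cdom A i. param A i u \<in> W})"
      "W' \<subseteq> points A \<and> (\<forall>i\<in>charts A. open {u \<in> cdom A i. param A i u \<in> W'})" "i \<in> charts A"
    have eq: "{u \<in> cdom A i. param A i u \<in> W \<inter> W'}
        = {u \<in> cdom A i. param A i u \<in> W} \<inter> {u \<in> cdom A i. param A i u \<in> W'}" by auto
    show "open {u \<in> cdom A i. param A i u \<in> W \<inter> W'}"
      unfolding eq by (rule open_Int) (use * in blast)+
  next
    fix K i assume *: "\<forall>W\<in>K. W \<subseteq> points A \<and> (\<forall>i\<in>charts A. open {u \<in> cdom A i. param A i u \<in> W})"
      "i \<in> charts A"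
    have eq: "{u \<in> cdom A i. param A i u \<in> \<Union>K} = (\<Union>W\<in>K. {u \<in> cdom A i. param A i u \<in> W})" by auto
    show "open {u \<in> cdom A i. param A i u \<in> \<Union>K}"
      unfolding eq by (rule open_UN) (use * in blast)
  qed auto
  from topology_inverse'[OF this] show ?thesis unfolding mtop_def by (rule fun_cong)
qed

text \<open>The part of \<open>smooth_manifold\<close> that concerns charts and transition maps,
  with continuity in place of smoothness. It isolates what \<open>mtop\<close> depends on, so that
  the topological axioms of a manifold can be proved with its help.\<close>

definition continuous_atlas :: "('i, 'e::euclidean_space, 'x) atlas \<Rightarrow> bool" where
  "continuous_atlas A \<longleftrightarrow>
     (\<forall>i\<in>charts A. open (cdom A i) \<and> inj_on (param A i) (cdom A i)) \<and>
     (\<forall>i\<in>charts A. \<forall>j\<in>charts A.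
        open {u \<in> cdom A i. param A i u \<in> patch A j} \<and>
        continuous_on {u \<in> cdom A i. param A i u \<in> patch A j} (coord A j \<circ> param A i))"

lemma coord_param: "inj_on (param A i) (cdom A i) \<Longrightarrow> u \<in> cdom A i \<Longrightarrow> coord A i (param A i u) = u"
  by (simp add: coord_def)

lemma param_coord: "p \<in> patch A i \<Longrightarrow> param A i (coord A i p) = p"
  by (simp add: coord_def patch_def f_inv_into_f)

lemma coord_in_cdom: "p \<in> patch A i \<Longrightarrow> coord A i p \<in> cdom A i"
  by (simp add: coord_def patch_def inv_into_into)

lemma param_in_patch: "u \<in> cdom A i \<Longrightarrow> param A i u \<in> patch A i"
  by (simp add: patch_def)

context
  fixes A :: "('i, 'e::euclidean_space, 'x) atlas"
  assumes atl: "continuous_atlas A"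
begin

lemma open_cdom: "i \<in> charts A \<Longrightarrow> open (cdom A i)"
  and inj_param: "i \<in> charts A \<Longrightarrow> inj_on (param A i) (cdom A i)"
  using atl by (auto simp: continuous_atlas_def)

text \<open>In another chart the image becomes the preimage of \<open>Q\<close> under the transition
  map, which is continuous on an open set.\<close>

lemma openin_param_image:
  assumes i: "i \<in> charts A" and Q: "open Q" "Q \<subseteq> cdom A i"
  shows "openin (mtop A) (param A i ` Q)"
  unfolding openin_mtop_iff
proof (intro conjI ballI)
  show "param A i ` Q \<subseteq> points A" using i Q by (auto simp: points_def patch_def)
  fix j assume j: "j \<in> charts A"
  let ?D = "{u \<in> cdom A j. param A j u \<in> patch A i}"
  have "{u \<in> cdom A j. param A j u \<in> param A i ` Q} = ?D \<inter> (coord A i \<circ> param A j) -` Q"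
    using Q(2) by (auto simp: coord_param[OF inj_param[OF i]] subset_eq patch_def intro!: image_eqI)
  moreover have "open (?D \<inter> (coord A i \<circ> param A j) -` Q)"
    by (rule continuous_open_preimage) (use atl i j Q(1) in \<open>auto simp: continuous_atlas_def\<close>)
  ultimately show "open {u \<in> cdom A j. param A j u \<in> param A i ` Q}" by (simp only:)
qed

lemma openin_patch: "i \<in> charts A \<Longrightarrow> openin (mtop A) (patch A i)"
  using openin_param_image[of i "cdom A i"] by (simp add: open_cdom patch_def)

lemma topspace_mtop: "topspace (mtop A) = points A"
proof
  show "topspace (mtop A) \<subseteq> points A"
    using openin_mtop_iff[of A "topspace (mtop A)"] by simp
  show "points A \<subseteq> topspace (mtop A)"
    unfolding points_def using openin_patch openin_subset by blast
qed

lemma second_countable_mtop: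
  assumes "countable I" "I \<subseteq> charts A" "points A = (\<Union>i\<in>I. patch A i)"
  shows "second_countable (mtop A)"
proof -
  obtain C :: "'e set set" where C: "countable C" "topological_basis C" using ex_countable_basis by blast
  let ?B = "(\<lambda>(i, Q). param A i ` (Q \<inter> cdom A i)) ` (I \<times> C)"
  show ?thesis unfolding second_countable_def
  proof (intro exI[of _ ?B] conjI ballI allI impI)
    show "countable ?B" using assms(1) C(1) by auto
    show "openin (mtop A) V" if "V \<in> ?B" for V
      using that assms(2) topological_basis_open[OF C(2)]
      by (auto intro!: openin_param_image simp: open_cdom subset_eq)
    fix U x assume U: "openin (mtop A) U \<and> x \<in> U"
    then have "x \<in> points A" by (auto simp: openin_mtop_iff)
    then obtain i where i: "i \<in> I" "x \<in> patch A i" using assms(3) by auto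
    then obtain u where u: "u \<in> cdom A i" "x = param A i u" by (auto simp: patch_def)
    let ?Q = "{u \<in> cdom A i. param A i u \<in> U}"
    have "open ?Q" "u \<in> ?Q" using U i u assms(2) by (auto simp: openin_mtop_iff)
    then obtain Q' where Q': "Q' \<in> C" "u \<in> Q'" "Q' \<subseteq> ?Q" by (rule topological_basisE[OF C(2)])
    show "\<exists>V\<in>?B. x \<in> V \<and> V \<subseteq> U"
    proof (intro bexI conjI)
      show "param A i ` (Q' \<inter> cdom A i) \<in> ?B" using i(1) Q'(1) by force
      show "x \<in> param A i ` (Q' \<inter> cdom A i)" using u Q'(2) by blast
      show "param A i ` (Q' \<inter> cdom A i) \<subseteq> U" using Q'(3) by blast
    qed
  qed
qed

end

section \<open>Hermitian line bundles\<close>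

lemma torus_smooth_on_cong:
  assumes "openin (torus_top P) U" "\<And>m. m \<in> U \<Longrightarrow> f m = g m" "torus_smooth_on P U f"
  shows "torus_smooth_on P U g"
  using assms unfolding torus_smooth_on_def openin_torus_iff
  by (auto intro: smooth_on_cong[of _ "f \<circ> tpt P"])

lemma torus_smooth_on_subset: "torus_smooth_on P U f \<Longrightarrow> V \<subseteq> U \<Longrightarrow> torus_smooth_on P V f"
  unfolding torus_smooth_on_def by (auto elim!: smooth_on_subset)

lemma smooth_section_cong:
  assumes "smooth_section P E W t" "\<And>m. m \<in> W \<Longrightarrow> t m = t' m"
  shows "smooth_section P E W t'"
proof -
  have "\<exists>c. torus_smooth_on P (U \<inter> W) c \<and> (\<forall>m\<in>U \<inter> W. t' m = lscale E (c m) (s m))"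
    if Us: "(U, s) \<in> lframes E" for U s
  proof -
    from assms(1) Us obtain c where "torus_smooth_on P (U \<inter> W) c" "\<forall>m\<in>U \<inter> W. t m = lscale E (c m) (s m)"
      unfolding smooth_section_def by blast
    with assms(2) show ?thesis by (intro exI[of _ c]) simp
  qed
  moreover have "openin (torus_top P) W" "\<forall>m\<in>W. t' m \<in> fibre E m"
    using assms by (auto simp: smooth_section_def)
  ultimately show ?thesis unfolding smooth_section_def by blast
qed

lemma smooth_section_subset:
  assumes "smooth_section P E W t" "openin (torus_top P) W'" "W' \<subseteq> W"
  shows "smooth_section P E W' t"
proof -
  have "\<exists>c. torus_smooth_on P (U \<inter> W') c \<and> (\<forall>m\<in>U \<inter> W'. t m = lscale E (c m) (s m))"
    if "(U, s) \<in> lframes E" for U s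
  proof -
    from assms(1) that obtain c where c: "torus_smooth_on P (U \<inter> W) c" "\<forall>m\<in>U \<inter> W. t m = lscale E (c m) (s m)"
      unfolding smooth_section_def by blast
    have "torus_smooth_on P (U \<inter> W') c" using torus_smooth_on_subset[OF c(1)] assms(3) by blast
    with c(2) assms(3) show ?thesis by blast
  qed
  with assms show ?thesis unfolding smooth_section_def by blast
qed

section \<open>Algebra of the fibres, unit sections and their transition functions\<close>

locale hermitian_bundle =
  fixes P :: "'b::euclidean_space" and E :: "('v, 'b) line_bundle"
  assumes periods: "\<And>k. k \<in> Basis \<Longrightarrow> 0 < P \<bullet> k"
    and line_bundle_E: "hermitian_line_bundle P E"
begin

lemma fibre_in_torus: "v \<in> fibre E m \<Longrightarrow> m \<in> torus P"
  using line_bundle_E by (auto simp: hermitian_line_bundle_def fibre_def)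

text \<open>A linear isometry between the complex plane and the fibre. The algebraic facts that
  follow are pulled back along it to identities between complex numbers.\<close>

lemma fibre_chart:
  assumes "v \<in> fibre E m"
  obtains h where "bij_betw h UNIV (fibre E m)" "\<And>a b. h (a + b) = ladd E (h a) (h b)"
    "\<And>a b. h (a * b) = lscale E a (h b)" "\<And>a b. lherm E (h a) (h b) = a * cnj b"
proof -
  from line_bundle_E have "\<forall>m\<in>torus P. \<exists>h. bij_betw h UNIV (fibre E m) \<and>
        (\<forall>a b. h (a + b) = ladd E (h a) (h b) \<and> h (a * b) = lscale E a (h b) \<and>
               lherm E (h a) (h b) = a * cnj b)"
    unfolding hermitian_line_bundle_def by (elim conjE)
  with fibre_in_torus[OF assms] obtain h where "bij_betw h UNIV (fibre E m) \<and>
        (\<forall>a b. h (a + b) = ladd E (h a) (h b) \<and> h (a * b) = lscale E a (h b) \<and>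
               lherm E (h a) (h b) = a * cnj b)"
    by (auto dest: bspec)
  then show thesis by (intro that[of h]) simp_all
qed

context
  fixes m v assumes v: "v \<in> fibre E m"
begin

lemma lscale_in_fibre: "lscale E a v \<in> fibre E m"
  and lscale_lscale: "lscale E a (lscale E b v) = lscale E (a * b) v"
  and lscale_one: "lscale E 1 v = v"
  and ladd_lscale: "ladd E (lscale E a v) (lscale E b v) = lscale E (a + b) v"
  and lherm_self: "lherm E v v = of_real (Re (lherm E v v))" "Re (lherm E v v) \<ge> 0"
proof -
  obtain h where h: "bij_betw h UNIV (fibre E m)" "\<And>a b. h (a + b) = ladd E (h a) (h b)"
    "\<And>a b. h (a * b) = lscale E a (h b)" "\<And>a b. lherm E (h a) (h b) = a * cnj b" 
    using fibre_chart[OF v] by metis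
  from v h(1) obtain z where z: "v = h z" unfolding bij_betw_def by auto
  have in': "h c \<in> fibre E m" for c using h(1) unfolding bij_betw_def by auto
  show "lscale E a v \<in> fibre E m" by (simp add: z in' flip: h(3))
  show "lscale E a (lscale E b v) = lscale E (a * b) v" by (simp add: z mult.assoc flip: h(3))
  show "lscale E 1 v = v" by (simp add: z flip: h(3))
  show "ladd E (lscale E a v) (lscale E b v) = lscale E (a + b) v"
    by (simp add: z distrib_right flip: h(2,3))
  show "lherm E v v = of_real (Re (lherm E v v))" "Re (lherm E v v) \<ge> 0"
    by (simp_all add: z h(4) complex_mult_cnj)
qed

lemma lherm_lscale:
  assumes w: "w \<in> fibre E m"
  shows "lherm E (lscale E a v) (lscale E b w) = a * cnj b * lherm E v w"
proof -
  obtain h where h: "bij_betw h UNIV (fibre E m)" 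
    "\<And>a b. h (a * b) = lscale E a (h b)" "\<And>a b. lherm E (h a) (h b) = a * cnj b" 
    using fibre_chart[OF v] by metis
  from v h(1) obtain z where z: "v = h z" unfolding bij_betw_def by auto
  from w h(1) obtain z' where z': "w = h z'" unfolding bij_betw_def by auto
  show ?thesis by (simp add: z z' h(3) flip: h(2))
qed

lemma lscale_coefficient:
  assumes w: "w \<in> fibre E m" and nz: "lherm E v v \<noteq> 0"
  shows "\<exists>c. w = lscale E c v"
proof -
  obtain h where h: "bij_betw h UNIV (fibre E m)" 
    "\<And>a b. h (a * b) = lscale E a (h b)" "\<And>a b. lherm E (h a) (h b) = a * cnj b" 
    using fibre_chart[OF v] by metis
  from v h(1) obtain z where z: "v = h z" unfolding bij_betw_def by auto
  from w h(1) obtain z' where z': "w = h z'" unfolding bij_betw_def by auto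
  have "z \<noteq> 0" using nz by (auto simp: z h(3))
  then have "w = lscale E (z' / z) v" by (simp add: z z' flip: h(2))
  then show ?thesis by blast
qed

lemma lscale_inject:
  assumes nz: "lherm E v v \<noteq> 0"
  shows "lscale E a v = lscale E b v \<longleftrightarrow> a = b"
proof -
  obtain h where h: "bij_betw h UNIV (fibre E m)" 
    "\<And>a b. h (a * b) = lscale E a (h b)" "\<And>a b. lherm E (h a) (h b) = a * cnj b" 
    using fibre_chart[OF v] by metis
  from v h(1) obtain z where z: "v = h z" unfolding bij_betw_def by auto
  have "z \<noteq> 0" using nz by (auto simp: z h(3))
  moreover have "inj h" using h(1) bij_betw_imp_inj_on by blast
  ultimately show ?thesis by (simp add: z inj_eq flip: h(2))
qed

text \<open>In a Hermitian line the coefficient with respect to a unit vector is the scalar product.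
  Coefficients and transition functions thereby become explicit and accessible to smoothness
  arguments.\<close>

lemma lscale_unit_coefficient:
  assumes "w \<in> fibre E m" and one: "lherm E v v = 1"
  shows "w = lscale E (lherm E w v) v"
proof -
  obtain c where c: "w = lscale E c v" using lscale_coefficient[OF assms(1)] one by auto
  have "lherm E w v = lherm E (lscale E c v) (lscale E 1 v)" using c lscale_one by simp
  also have "\<dots> = c" using lherm_lscale[OF v, of c 1] one by simp
  finally show ?thesis using c by simp
qed

end

lemma frame_properties:
  assumes "(U, s) \<in> lframes E"
  shows "openin (torus_top P) U" "\<And>m. m \<in> U \<Longrightarrow> s m \<in> fibre E m"
    "\<And>m. m \<in> U \<Longrightarrow> lherm E (s m) (s m) \<noteq> 0" "torus_smooth_on P U (\<lambda>m. lherm E (s m) (s m))"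
proof -
  from line_bundle_E have "\<forall>(U, s)\<in>lframes E. openin (torus_top P) U \<and>
        (\<forall>m\<in>U. s m \<in> fibre E m \<and> lherm E (s m) (s m) \<noteq> 0) \<and>
        torus_smooth_on P U (\<lambda>m. lherm E (s m) (s m))"
    unfolding hermitian_line_bundle_def by (elim conjE)
  from bspec[OF this assms]
  show "openin (torus_top P) U" "\<And>m. m \<in> U \<Longrightarrow> s m \<in> fibre E m"
    "\<And>m. m \<in> U \<Longrightarrow> lherm E (s m) (s m) \<noteq> 0" "torus_smooth_on P U (\<lambda>m. lherm E (s m) (s m))"
    by simp_all
qed

lemma frame_transition:
  assumes "(U, s) \<in> lframes E" "(U', s') \<in> lframes E"
  shows "\<exists>c. torus_smooth_on P (U \<inter> U') c \<and> (\<forall>m\<in>U \<inter> U'. s' m = lscale E (c m) (s m))"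
proof -
  from line_bundle_E have "\<forall>(U, s)\<in>lframes E. \<forall>(U', s')\<in>lframes E. \<exists>c. torus_smooth_on P (U \<inter> U') c \<and>
        (\<forall>m\<in>U \<inter> U'. s' m = lscale E (c m) (s m))"
    unfolding hermitian_line_bundle_def by (elim conjE)
  from bspec[OF this assms(1)] show ?thesis using assms(2) by auto
qed

lemma frame_at:
  assumes "m \<in> torus P"
  obtains U s where "(U, s) \<in> lframes E" "m \<in> U"
proof -
  from line_bundle_E have "\<Union>(fst ` lframes E) = torus P"
    unfolding hermitian_line_bundle_def by (elim conjE)
  with assms have "m \<in> \<Union>(fst ` lframes E)" by (simp only:)
  then show thesis using that by auto
qed

text \<open>A frame is divided by its length; the squared length is smooth and positive, so the
  square root is smooth as well.\<close>

lemma ex_unit_section: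
  assumes "m \<in> torus P"
  obtains U s where "m \<in> U" "unit_section P E U s"
proof -
  obtain U s where Us: "(U, s) \<in> lframes E" "m \<in> U" using frame_at[OF assms] by blast
  note fr = frame_properties[OF Us(1)]
  define r where "r m = 1 / sqrt (Re (lherm E (s m) (s m)))" for m
  define t where "t m = lscale E (of_real (r m)) (s m)" for m
  have pos: "Re (lherm E (s m) (s m)) > 0" if "m \<in> U" for m
    using lherm_self[OF fr(2)[OF that]] fr(3)[OF that] by (metis of_real_0 order_le_less)
  have one: "lherm E (t m) (t m) = 1" if "m \<in> U" for m
  proof -
    have "lherm E (t m) (t m) = of_real (r m * r m * Re (lherm E (s m) (s m)))"
      using lherm_lscale[OF fr(2)[OF that] fr(2)[OF that], of "of_real (r m)" "of_real (r m)"] 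
        lherm_self[OF fr(2)[OF that]] by (simp add: t_def)
    also have "\<dots> = 1" using pos[OF that] by (simp add: r_def real_sqrt_mult_self flip: real_sqrt_mult)
    finally show ?thesis .
  qed
  have oU: "open (tpt P -` U)" using fr(1) by (simp add: openin_torus_iff)
  have "smooth_on (tpt P -` U) (\<lambda>b. Re (lherm E (s (tpt P b)) (s (tpt P b))))"
    using smooth_on_bounded_linear[OF oU bounded_linear_Re] fr(4) by (auto simp: torus_smooth_on_def o_def)
  then have "smooth_on (tpt P -` U) (\<lambda>b. sqrt (Re (lherm E (s (tpt P b)) (s (tpt P b)))))"
    using pos by (intro smooth_on_compose[OF oU open_greaterThan _ _ smooth_on_sqrt]) auto
  then have "smooth_on (tpt P -` U) (\<lambda>b. 1 / sqrt (Re (lherm E (s (tpt P b)) (s (tpt P b)))))"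
    by (rule smooth_on_divide[OF oU smooth_on_const]) (use pos in fastforce)
  then have smr: "smooth_on (tpt P -` U) (\<lambda>b. complex_of_real (r (tpt P b)))"
    unfolding r_def by (rule smooth_on_bounded_linear[OF oU bounded_linear_of_real])
  have "\<exists>c. torus_smooth_on P (U' \<inter> U) c \<and> (\<forall>m\<in>U' \<inter> U. t m = lscale E (c m) (s' m))"
    if Us': "(U', s') \<in> lframes E" for U' s'
  proof -
    obtain c where c: "torus_smooth_on P (U' \<inter> U) c" "\<forall>m\<in>U' \<inter> U. s m = lscale E (c m) (s' m)"
      using frame_transition[OF Us' Us(1)] by blast
    have o: "open (tpt P -` (U' \<inter> U))"
      using oU frame_properties(1)[OF Us'] by (auto simp: openin_torus_iff vimage_Int)
    show ?thesis
    proof (intro exI conjI ballI)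
      show "torus_smooth_on P (U' \<inter> U) (\<lambda>m. of_real (r m) * c m)"
        unfolding torus_smooth_on_def o_def
        by (rule smooth_on_mult[OF o smooth_on_subset[OF smr]]) (use c(1) in \<open>auto simp: torus_smooth_on_def o_def\<close>)
      show "t m = lscale E (of_real (r m) * c m) (s' m)" if "m \<in> U' \<inter> U" for m
        using c(2) that lscale_lscale[OF frame_properties(2)[OF Us']] by (simp add: t_def)
    qed
  qed
  then have "unit_section P E U t"
    using fr(1,2) one lscale_in_fibre unfolding unit_section_def smooth_section_def
    by (auto simp: t_def)
  with Us(2) that show thesis by blast
qed

lemma unit_sectionD:
  assumes "unit_section P E U s"
  shows "openin (torus_top P) U" "open (tpt P -` U)" "\<And>m. m \<in> U \<Longrightarrow> s m \<in> fibre E m"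
    "\<And>m. m \<in> U \<Longrightarrow> lherm E (s m) (s m) = 1" "smooth_section P E U s"
  using assms by (auto simp: unit_section_def smooth_section_def openin_torus_iff)

text \<open>Both sections are compared with a local frame e: if s = a e and t = a' e, the
  coefficient is a' times the conjugate of a times the smooth function h(e, e). Smoothness is local
  and frames exist around every point.\<close>

lemma section_coefficient:
  assumes s: "unit_section P E U s" and t: "smooth_section P E W t"
  shows "torus_smooth_on P (U \<inter> W) (\<lambda>m. lherm E (t m) (s m))"
    and "\<And>m. m \<in> U \<inter> W \<Longrightarrow> t m = lscale E (lherm E (t m) (s m)) (s m)"
proof -
  have tf: "t m \<in> fibre E m" if "m \<in> W" for m using t that by (auto simp: smooth_section_def)
  show "t m = lscale E (lherm E (t m) (s m)) (s m)" if "m \<in> U \<inter> W" for m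
    using that by (intro lscale_unit_coefficient[OF unit_sectionD(3)[OF s] tf unit_sectionD(4)[OF s]]) auto
  show "torus_smooth_on P (U \<inter> W) (\<lambda>m. lherm E (t m) (s m))"
    unfolding torus_smooth_on_def
  proof (rule smooth_on_local)
    fix b assume b: "b \<in> tpt P -` (U \<inter> W)"
    obtain V e where Ve: "(V, e) \<in> lframes E" "tpt P b \<in> V" using frame_at[OF tpt_in_torus] by blast
    note fr = frame_properties[OF Ve(1)]
    obtain a where a: "torus_smooth_on P (V \<inter> U) a" "\<forall>m\<in>V \<inter> U. s m = lscale E (a m) (e m)"
      using unit_sectionD(5)[OF s] Ve(1) unfolding smooth_section_def by blast
    obtain a' where a': "torus_smooth_on P (V \<inter> W) a'" "\<forall>m\<in>V \<inter> W. t m = lscale E (a' m) (e m)"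
      using t Ve(1) unfolding smooth_section_def by blast
    let ?T = "tpt P -` (V \<inter> U \<inter> W)"
    have o: "open ?T"
      using fr(1) t s by (auto simp: smooth_section_def unit_section_def openin_torus_iff vimage_Int)
    have "smooth_on ?T (\<lambda>b. a' (tpt P b) * cnj (a (tpt P b)) * lherm E (e (tpt P b)) (e (tpt P b)))"
      by (intro smooth_on_mult[OF o] smooth_on_bounded_linear[OF o bounded_linear_cnj])
        (use a(1) a'(1) fr(4) in \<open>auto simp: torus_smooth_on_def o_def elim!: smooth_on_subset\<close>)
    then have "smooth_on ?T ((\<lambda>m. lherm E (t m) (s m)) \<circ> tpt P)"
      by (rule smooth_on_cong[OF o, rotated]) (use a(2) a'(2) lherm_lscale[OF fr(2) fr(2)] in auto)
    then show "\<exists>T. open T \<and> b \<in> T \<and> smooth_on T ((\<lambda>m. lherm E (t m) (s m)) \<circ> tpt P)"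
      using o b Ve(2) by blast
  qed
qed

lemma norm_unit_coefficient:
  assumes s: "unit_section P E U s" and s': "unit_section P E U' s'" and m: "m \<in> U \<inter> U'"
  shows "cmod (lherm E (s' m) (s m)) = 1"
proof -
  let ?c = "lherm E (s' m) (s m)"
  have "1 = lherm E (s' m) (s' m)" using unit_sectionD(4)[OF s'] m by simp
  also have "\<dots> = ?c * cnj ?c"
    using section_coefficient(2)[OF s unit_sectionD(5)[OF s'] m] m unit_sectionD[OF s]
      lherm_lscale[of "s m" m "s m" ?c ?c] by simp
  also have "\<dots> = of_real ((cmod ?c)\<^sup>2)" by (simp only: complex_norm_square)
  finally have "(cmod ?c)\<^sup>2 = 1" by (metis of_real_1 of_real_eq_iff)
  then show ?thesis by (smt (verit) norm_ge_zero power2_eq_1_iff)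
qed

end

text \<open>The local connection form of \<open>s\<close>, as a covector field on the universal cover of the torus.\<close>

definition conn_form ::
    "'b::euclidean_space \<Rightarrow> ('v, 'b) line_bundle \<Rightarrow> ('b set \<Rightarrow> 'v) \<Rightarrow> 'b \<Rightarrow> 'b" where
  "conn_form P E s b = (\<Sum>k\<in>Basis. local_form E s (tpt P b) k *\<^sub>R k)"

lemma conn_form_cong: "tpt P b = tpt P b' \<Longrightarrow> conn_form P E s b = conn_form P E s b'"
  by (simp add: conn_form_def)

section \<open>Connection forms of unit sections, gauge law and curvature\<close>

locale hermitian_bundle_with_connection = hermitian_bundle P E
  for P :: "'b::euclidean_space" and E :: "('v, 'b) line_bundle" +
  assumes connection: "hermitian_connection P E"
begin

abbreviation "\<Phi> \<equiv> conn_form P E"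

lemma conn_smooth: "smooth_section P E W t \<Longrightarrow> smooth_section P E W (lconn E a t)"
  using connection unfolding hermitian_connection_def by (elim conjE) simp

lemma conn_linear:
  assumes "smooth_section P E W t" "m \<in> W"
  shows "lconn E (r *\<^sub>R a + a') t m = ladd E (lscale E (of_real r) (lconn E a t m)) (lconn E a' t m)"
  using connection assms unfolding hermitian_connection_def by (elim conjE) simp

lemma conn_Leibniz:
  assumes "smooth_section P E W t" "torus_smooth_on P W c" "tpt P b \<in> W"
  shows "lconn E a (\<lambda>m. lscale E (c m) (t m)) (tpt P b)
             = ladd E (lscale E (frechet_derivative (c \<circ> tpt P) (at b) a) (t (tpt P b)))
                      (lscale E (c (tpt P b)) (lconn E a t (tpt P b)))"
proof -
  from connection have "\<forall>W t. smooth_section P E W t \<longrightarrow>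
        (\<forall>a. smooth_section P E W (lconn E a t)) \<and>
        (\<forall>a a' r. \<forall>m\<in>W. lconn E (r *\<^sub>R a + a') t m
            = ladd E (lscale E (of_real r) (lconn E a t m)) (lconn E a' t m)) \<and>
        (\<forall>a c b. torus_smooth_on P W c \<and> tpt P b \<in> W \<longrightarrow>
           lconn E a (\<lambda>m. lscale E (c m) (t m)) (tpt P b)
             = ladd E (lscale E (frechet_derivative (c \<circ> tpt P) (at b) a) (t (tpt P b)))
                      (lscale E (c (tpt P b)) (lconn E a t (tpt P b))))"
    unfolding hermitian_connection_def by (elim conjE)
  with assms show ?thesis by blast
qed

lemma conn_metric:
  assumes "smooth_section P E W t" "smooth_section P E W t'" "tpt P b \<in> W"
  shows "frechet_derivative (\<lambda>b. lherm E (t (tpt P b)) (t' (tpt P b))) (at b) a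
             = lherm E (lconn E a t (tpt P b)) (t' (tpt P b))
               + lherm E (t (tpt P b)) (lconn E a t' (tpt P b))"
proof -
  from connection have "\<forall>W t t'. smooth_section P E W t \<and> smooth_section P E W t' \<longrightarrow>
        (\<forall>a. \<forall>m\<in>W. lconn E a (\<lambda>m. ladd E (t m) (t' m)) m = ladd E (lconn E a t m) (lconn E a t' m)) \<and>
        (\<forall>a b. tpt P b \<in> W \<longrightarrow>
           frechet_derivative (\<lambda>b. lherm E (t (tpt P b)) (t' (tpt P b))) (at b) a
             = lherm E (lconn E a t (tpt P b)) (t' (tpt P b))
               + lherm E (t (tpt P b)) (lconn E a t' (tpt P b)))"
    unfolding hermitian_connection_def by (elim conjE)
  with assms show ?thesis by blast
qed

lemma conn_local:
  assumes "smooth_section P E W t" "smooth_section P E W' t'" "W' \<subseteq> W" "\<And>m. m \<in> W' \<Longrightarrow> t m = t' m" "m \<in> W'"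
  shows "lconn E a t m = lconn E a t' m"
proof -
  from connection have "\<forall>W W' t t'. smooth_section P E W t \<and> smooth_section P E W' t' \<and> W' \<subseteq> W \<and> (\<forall>m\<in>W'. t m = t' m) \<longrightarrow>
        (\<forall>a. \<forall>m\<in>W'. lconn E a t m = lconn E a t' m)"
    unfolding hermitian_connection_def by (elim conjE)
  from this[rule_format, of W t W' t' m a] assms show ?thesis by blast
qed

context
  fixes U s assumes s: "unit_section P E U s"
begin

text \<open>Differentiating h(s, s) = 1 with the metric property gives z + cnj z = 0 for the
  coefficient z of the covariant derivative, so z is imaginary. This makes the definite description
  in \<open>local_form\<close> meaningful.\<close>

lemma conn_coefficient:
  assumes "m \<in> U"
  shows "lconn E a s m = lscale E (\<i> * of_real (local_form E s m a)) (s m)"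
    and "lconn E a s m = lscale E (\<i> * of_real r) (s m) \<Longrightarrow> local_form E s m a = r"
    and "lherm E (lconn E a s m) (s m) = \<i> * of_real (local_form E s m a)"
proof -
  note us = unit_sectionD[OF s]
  have sm: "s m \<in> fibre E m" and one: "lherm E (s m) (s m) = 1" using us(3,4) assms by auto
  have nz: "lherm E (s m) (s m) \<noteq> 0" using one by simp
  have t: "lconn E a s m \<in> fibre E m"
    using conn_smooth[OF us(5)] assms by (auto simp: smooth_section_def)
  define z where "z = lherm E (lconn E a s m) (s m)"
  have lz: "lconn E a s m = lscale E z (s m)"
    unfolding z_def by (rule lscale_unit_coefficient[OF sm t one])
  obtain b where b: "m = tpt P b" using torus_cases[OF fibre_in_torus[OF sm]] .
  have "((\<lambda>b. lherm E (s (tpt P b)) (s (tpt P b))) has_derivative (\<lambda>_. 0)) (at b)"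
    by (rule has_derivative_transform_within_open[OF has_derivative_const us(2)])
      (use us(4) assms b in auto)
  from frechet_derivative_eqI[OF this] conn_metric[OF us(5) us(5), of b a] assms b
  have "lherm E (lconn E a s m) (s m) + lherm E (s m) (lconn E a s m) = 0" by simp
  moreover have "lherm E (s m) (lconn E a s m) = cnj z"
    using lherm_lscale[OF sm sm, of 1 z] by (simp add: lz lscale_one[OF sm] one)
  ultimately have "z + cnj z = 0" by (simp add: z_def)
  then have "Re z = 0" by (simp add: complex_eq_iff)
  then have zi: "z = \<i> * of_real (Im z)" by (simp add: complex_eq_iff)
  have un: "r = r'" if "lconn E a s m = lscale E (\<i> * of_real r) (s m)" "lconn E a s m = lscale E (\<i> * of_real r') (s m)" for r r'
    using that lscale_inject[OF sm nz, of "\<i> * of_real r" "\<i> * of_real r'"] by simp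
  have lf: "local_form E s m a = Im z"
    unfolding local_form_def using lz zi un by (intro the_equality) metis+
  show "lconn E a s m = lscale E (\<i> * of_real (local_form E s m a)) (s m)"
    using lz zi lf by metis
  then show "lconn E a s m = lscale E (\<i> * of_real r) (s m) \<Longrightarrow> local_form E s m a = r"
    using un by blast
  show "lherm E (lconn E a s m) (s m) = \<i> * of_real (local_form E s m a)"
    using zi lf by (simp add: z_def)
qed

lemma local_form_linear:
  assumes "m \<in> U"
  shows "local_form E s m (r *\<^sub>R a + a') = r * local_form E s m a + local_form E s m a'"
proof (rule conn_coefficient(2)[OF assms])
  have sm: "s m \<in> fibre E m" using unit_sectionD(3)[OF s] assms by auto
  show "lconn E (r *\<^sub>R a + a') s m = lscale E (\<i> * of_real (r * local_form E s m a + local_form E s m a')) (s m)"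
    using conn_linear[OF unit_sectionD(5)[OF s] assms, of r a a']
    by (simp add: conn_coefficient(1)[OF assms] lscale_lscale[OF sm] ladd_lscale[OF sm] algebra_simps)
qed

text \<open>Linearity turns the connection form into the scalar product with a vector field, so that
  smoothness and derivatives can be treated for one vector-valued map.\<close>

lemma local_form_conn_form:
  assumes "tpt P b \<in> U"
  shows "local_form E s (tpt P b) a = \<Phi> s b \<bullet> a"
proof -
  have lin: "linear (local_form E s (tpt P b))"
  proof
    show "local_form E s (tpt P b) (x + y) = local_form E s (tpt P b) x + local_form E s (tpt P b) y" for x y
      using local_form_linear[OF assms, of 1 x y] by simp
    show "local_form E s (tpt P b) (c *\<^sub>R x) = c *\<^sub>R local_form E s (tpt P b) x" for x c
      using local_form_linear[OF assms, of c x 0] local_form_linear[OF assms, of 1 0 0] by simp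
  qed
  have "local_form E s (tpt P b) (\<Sum>k\<in>Basis. (a \<bullet> k) *\<^sub>R k) = (\<Sum>k\<in>Basis. (a \<bullet> k) * local_form E s (tpt P b) k)"
    by (simp only: linear_sum[OF lin] linear_scale[OF lin] real_scaleR_def)
  then have "local_form E s (tpt P b) a = (\<Sum>k\<in>Basis. (a \<bullet> k) * local_form E s (tpt P b) k)"
    by (simp only: euclidean_representation)
  then show ?thesis
    by (simp add: conn_form_def inner_sum_left mult.commute inner_commute[of a])
qed

lemma smooth_on_conn_form: "smooth_on (tpt P -` U) (\<Phi> s)"
proof -
  note us = unit_sectionD[OF s]
  have "smooth_on (tpt P -` U) (\<lambda>b. local_form E s (tpt P b) k)" for k
  proof -
    have "smooth_on (tpt P -` U) (\<lambda>b. Im (lherm E (lconn E k s (tpt P b)) (s (tpt P b))))"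
      using section_coefficient(1)[OF s conn_smooth[OF us(5)], of k]
      by (intro smooth_on_bounded_linear[OF us(2) bounded_linear_Im]) (simp add: torus_smooth_on_def o_def)
    then show ?thesis
      by (rule smooth_on_cong[OF us(2), rotated]) (simp add: conn_coefficient(3))
  qed
  then show ?thesis unfolding conn_form_def[abs_def]
    by (intro smooth_on_sum[OF us(2)] smooth_on_scaleR[OF us(2)]) auto
qed

lemma conn_form_eq:
  "tpt P b \<in> U \<Longrightarrow> lconn E a s (tpt P b) = lscale E (\<i> * of_real (\<Phi> s b \<bullet> a)) (s (tpt P b))"
  using conn_coefficient(1) local_form_conn_form by metis

end

text \<open>The gauge law: the Leibniz rule for s' = c s, compared with the connection form of s',
  gives dc = i (phi' - phi) c.\<close>

lemma frechet_derivative_transition: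
  assumes s: "unit_section P E U s" and s': "unit_section P E U' s'" and b: "tpt P b \<in> U" "tpt P b \<in> U'"
  defines "c \<equiv> \<lambda>m. lherm E (s' m) (s m)"
  shows "frechet_derivative (c \<circ> tpt P) (at b) a
    = \<i> * of_real ((\<Phi> s' b - \<Phi> s b) \<bullet> a) * c (tpt P b)"
proof -
  let ?W = "U \<inter> U'" and ?m = "tpt P b"
  note us = unit_sectionD[OF s] and us' = unit_sectionD[OF s']
  have W: "openin (torus_top P) ?W" "?m \<in> ?W" using us us' b by auto
  have sW: "smooth_section P E ?W s" "smooth_section P E ?W s'"
    using smooth_section_subset[OF _ W(1)] us(5) us'(5) by auto
  have sm: "s ?m \<in> fibre E ?m" using us(3) b by auto
  have nz: "lherm E (s ?m) (s ?m) \<noteq> 0" using us(4) b by auto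
  have cs: "torus_smooth_on P ?W c" "\<And>m. m \<in> ?W \<Longrightarrow> s' m = lscale E (c m) (s m)"
    unfolding c_def using section_coefficient[OF s us'(5)] by auto
  have csW: "smooth_section P E ?W (\<lambda>m. lscale E (c m) (s m))"
    by (rule smooth_section_cong[OF sW(2) cs(2)])
  have "lconn E a s' ?m = lconn E a (\<lambda>m. lscale E (c m) (s m)) ?m"
    by (rule conn_local[OF sW(2) csW]) (use cs(2) W in auto)
  also have "\<dots> = lscale E (frechet_derivative (c \<circ> tpt P) (at b) a + c ?m * (\<i> * of_real (\<Phi> s b \<bullet> a))) (s ?m)"
    using conn_Leibniz[OF sW(1) cs(1) W(2)] conn_form_eq[OF s b(1)] 
    by (simp add: lscale_lscale[OF sm] ladd_lscale[OF sm])
  also have "lconn E a s' ?m = lscale E (\<i> * of_real (\<Phi> s' b \<bullet> a) * c ?m) (s ?m)"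
    using conn_form_eq[OF s' b(2)] cs(2)[OF W(2)] by (simp add: lscale_lscale[OF sm])
  finally have "\<i> * of_real (\<Phi> s' b \<bullet> a) * c ?m
      = frechet_derivative (c \<circ> tpt P) (at b) a + c ?m * (\<i> * of_real (\<Phi> s b \<bullet> a))"
    using lscale_inject[OF sm nz] by blast
  then show ?thesis by (simp add: algebra_simps)
qed

text \<open>Each second covariant derivative of \<open>s\<close> contributes a product of two values
  of phi, symmetric in the two directions. In the commutator only the derivatives of phi survive,
  which is the structure equation d phi = psi.\<close>

lemma conn_form_curvature:
  assumes curvature: "has_curvature_i P E \<psi>" and s: "unit_section P E U s" and b: "tpt P b \<in> U"
  defines "D \<equiv> frechet_derivative (\<Phi> s) (at b)"
  shows "D a \<bullet> a' - D a' \<bullet> a = \<psi> b a a'"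
proof -
  let ?m = "tpt P b"
  note us = unit_sectionD[OF s]
  have sm: "s ?m \<in> fibre E ?m" using us(3) b by auto
  have nz: "lherm E (s ?m) (s ?m) \<noteq> 0" using us(4) b by auto
  have dPhi: "(\<Phi> s has_derivative D) (at b)"
    unfolding D_def by (rule smooth_on_has_derivative[OF smooth_on_conn_form[OF s]]) (use b in auto)
  have second: "lconn E a (lconn E a' s) ?m = lscale E (\<i> * of_real (D a \<bullet> a') - of_real ((\<Phi> s b \<bullet> a') * (\<Phi> s b \<bullet> a))) (s ?m)" for a a'
  proof -
    define c where "c m = \<i> * of_real (local_form E s m a')" for m
    have csm: "torus_smooth_on P U c"
      using torus_smooth_on_cong[OF us(1) _ section_coefficient(1)[OF s conn_smooth[OF us(5), of a'], simplified], of c] 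
      by (simp add: c_def conn_coefficient(3)[OF s])
    have eq: "lconn E a' s m = lscale E (c m) (s m)" if "m \<in> U" for m
      using conn_coefficient(1)[OF s that] by (simp add: c_def)
    have sec: "smooth_section P E U (\<lambda>m. lscale E (c m) (s m))"
      by (rule smooth_section_cong[OF conn_smooth[OF us(5)] eq])
    have "((\<lambda>b. \<i> * of_real (\<Phi> s b \<bullet> a')) has_derivative (\<lambda>v. \<i> * of_real (D v \<bullet> a'))) (at b)"
      by (intro has_derivative_mult_right has_derivative_of_real has_derivative_inner_left dPhi)
    then have "((c \<circ> tpt P) has_derivative (\<lambda>v. \<i> * of_real (D v \<bullet> a'))) (at b)"
      by (rule has_derivative_transform_within_open[OF _ us(2)])
        (use b in \<open>auto simp: c_def local_form_conn_form[OF s]\<close>)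
    note dc = frechet_derivative_eqI[OF this]
    \<comment> \<open>The inner derivative is a multiple of \<open>s\<close> only on
      \<open>U\<close>, so locality of the connection is invoked before the Leibniz rule.\<close>
    have "lconn E a (lconn E a' s) ?m = lconn E a (\<lambda>m. lscale E (c m) (s m)) ?m"
      by (rule conn_local[OF conn_smooth[OF us(5)] sec]) (use eq b in auto)
    also have "\<dots> = lscale E (\<i> * of_real (D a \<bullet> a') + c ?m * (\<i> * of_real (\<Phi> s b \<bullet> a))) (s ?m)"
      using conn_Leibniz[OF us(5) csm b] conn_form_eq[OF s b] dc
      by (simp add: lscale_lscale[OF sm] ladd_lscale[OF sm])
    finally show ?thesis by (simp add: c_def local_form_conn_form[OF s b] algebra_simps)
  qed
  have "lconn E a (lconn E a' s) ?m
             = ladd E (lconn E a' (lconn E a s) ?m) (lscale E (\<i> * of_real (\<psi> b a a')) (s ?m))"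
    using curvature us(5) b unfolding has_curvature_i_def by blast
  then have "\<i> * of_real (D a \<bullet> a') - of_real ((\<Phi> s b \<bullet> a') * (\<Phi> s b \<bullet> a))
      = \<i> * of_real (D a' \<bullet> a) - of_real ((\<Phi> s b \<bullet> a) * (\<Phi> s b \<bullet> a')) + \<i> * of_real (\<psi> b a a')"
    using lscale_inject[OF sm nz] by (simp only: second ladd_lscale[OF sm])
  from arg_cong[OF this, of Im] show ?thesis by simp
qed

end

section \<open>The circle bundle\<close>

text \<open>In contrast to a chart map it is not restricted to a domain of injectivity: it is
  periodic in the angle and in the torus coordinates, and one map serves all domains
  \<open>D\<close> belonging to the same section.\<close>

definition bundle_param ::
    "'b::euclidean_space \<Rightarrow> ('v, 'b) line_bundle \<Rightarrow> ('b set \<Rightarrow> 'v) \<Rightarrow> real \<times> 'b \<Rightarrow> 'v" where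
  "bundle_param P E s u = lscale E (cis (fst u)) (s (tpt P (snd u)))"

lemma circle_bundle_simps [simp]:
  "cdom (circle_bundle P E) (D, U, s) = D"
  "param (circle_bundle P E) (D, U, s) = bundle_param P E s"
  by (auto simp: circle_bundle_def bundle_param_def fun_eq_iff split: prod.splits)

lemma charts_circle_bundle:
  "(D, U, s) \<in> charts (circle_bundle P E) \<longleftrightarrow>
     unit_section P E U s \<and> open D \<and> D \<subseteq> UNIV \<times> tpt P -` U \<and> inj_on (bundle_param P E s) D"
  by (auto simp: circle_bundle_def bundle_param_def[abs_def] case_prod_unfold subset_eq)

lemma cis_eq_imp_eq:
  assumes "cis x = cis y" "\<bar>x - y\<bar> < 2 * pi" shows "x = y"
proof -
  have "cis (x - y) = 1" using assms(1) by (simp flip: cis_divide)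
  then have "cos (x - y) = 1" by (simp add: complex_eq_iff)
  then obtain n :: int where n: "x - y = of_int n * 2 * pi" using cos_one_2pi_int by auto
  have "\<bar>of_int n\<bar> * (2 * pi) < 1 * (2 * pi)" using assms(2) n by (simp add: abs_mult)
  then have "\<bar>of_int n\<bar> < (1::real)" by (simp only: mult_less_cancel_right_pos pi_gt_zero zero_less_mult_iff zero_less_numeral simp_thms)
  then have "n = 0" by linarith
  with n show ?thesis by simp
qed

context hermitian_bundle
begin

abbreviation "\<Psi> \<equiv> bundle_param P E"

abbreviation "CB \<equiv> circle_bundle P E"

lemma bundle_param_in_fibre:
  assumes "unit_section P E U s" "tpt P b \<in> U"
  shows "\<Psi> s (x, b) \<in> fibre E (tpt P b)"
    and "lherm E (\<Psi> s (x, b)) (\<Psi> s (x, b)) = 1"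
  using lscale_in_fibre unit_sectionD(3,4)[OF assms(1,2)] lherm_lscale
  by (auto simp: bundle_param_def cis_mult cis_cnj)

lemma bundle_param_fibre_eq:
  assumes "unit_section P E U s" "tpt P b \<in> U" "unit_section P E U' s'" "tpt P b' \<in> U'"
    "\<Psi> s (x, b) = \<Psi> s' (x', b')"
  shows "tpt P b = tpt P b'"
  using bundle_param_in_fibre(1)[OF assms(1,2), of x] bundle_param_in_fibre(1)[OF assms(3,4), of x'] assms(5)
  by (simp add: fibre_def)

text \<open>Both points are expressed through the unit vector given by \<open>s'\<close> at the
  common base point, where only phases remain to be compared.\<close>

lemma bundle_param_eq_iff:
  assumes s: "unit_section P E U s" and s': "unit_section P E U' s'" and m: "tpt P b \<in> U" "tpt P b \<in> U'"
    and b': "tpt P b' = tpt P b"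
  shows "\<Psi> s (x, b) = \<Psi> s' (x', b')
    \<longleftrightarrow> cis x * lherm E (s (tpt P b)) (s' (tpt P b)) = cis x'"
proof -
  let ?m = "tpt P b"
  have sm: "s' ?m \<in> fibre E ?m" "lherm E (s' ?m) (s' ?m) = 1" using unit_sectionD[OF s'] m by auto
  have e: "s ?m = lscale E (lherm E (s ?m) (s' ?m)) (s' ?m)"
    using section_coefficient(2)[OF s' unit_sectionD(5)[OF s]] m by auto
  have "\<Psi> s (x, b) = lscale E (cis x * lherm E (s ?m) (s' ?m)) (s' ?m)"
    using arg_cong[OF e, of "lscale E (cis x)"] by (simp add: bundle_param_def lscale_lscale[OF sm(1)])
  then show ?thesis
    using lscale_inject[OF sm(1)] sm(2) b' by (simp add: bundle_param_def)
qed

lemma bundle_param_surj: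
  assumes s: "unit_section P E U s" and "tpt P b \<in> U" and v: "v \<in> fibre E (tpt P b)" "lherm E v v = 1"
  obtains x where "0 \<le> x" "x \<le> 2 * pi" "v = \<Psi> s (x, b)"
proof -
  let ?m = "tpt P b"
  have sm: "s ?m \<in> fibre E ?m" "lherm E (s ?m) (s ?m) = 1" using unit_sectionD[OF s] assms(2) by auto
  obtain c where c: "v = lscale E c (s ?m)" using lscale_coefficient[OF sm(1) v(1)] sm(2) by auto
  have "c * cnj c = 1" using lherm_lscale[OF sm(1) sm(1), of c c] sm(2) v(2) c by simp
  then have "of_real ((cmod c)\<^sup>2) = (1::complex)" by (simp only: complex_norm_square)
  then have "(cmod c)\<^sup>2 = 1" by (metis of_real_1 of_real_eq_iff)
  then have "cmod c = 1" by (smt (verit) norm_ge_zero power2_eq_1_iff)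
  then obtain t where "0 \<le> t" "t < 2 * pi" "c = cis t"
    using complex_unimodular_polar[of c] by (metis cis.ctr)
  with c that[of t] show thesis by (simp add: bundle_param_def)
qed

lemma ex_chart:
  assumes s: "unit_section P E U s" and b: "tpt P b \<in> U" and N: "open N" "(x, b) \<in> N"
  obtains D where "(x, b) \<in> D" "D \<subseteq> N" "(D, U, s) \<in> charts CB"
proof -
  obtain r where r: "r > 0" "\<And>b b'. tpt P b = tpt P b' \<Longrightarrow> dist b b' < r \<Longrightarrow> b = b'"
    using tpt_locally_inj[OF periods] by blast
  \<comment> \<open>Angles in \<open>ball x 1\<close> differ by less than 2, hence by less than
    \<open>2 * pi\<close>, and base points in a ball of radius \<open>r/2\<close> differ by less
    than \<open>r\<close>; so neither periodicity spoils injectivity.\<close>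
  define D where "D = N \<inter> (ball x 1 \<times> (ball b (r/2) \<inter> tpt P -` U))"
  have "open D" unfolding D_def using N(1) unit_sectionD(2)[OF s] by (intro open_Int open_Times) auto
  moreover have "inj_on (\<Psi> s) D"
  proof (rule inj_onI, clarify)
    fix y c y' c' assume D: "(y, c) \<in> D" "(y', c') \<in> D" and
      eq: "\<Psi> s (y, c) = \<Psi> s (y', c')"
    have t: "tpt P c = tpt P c'"
      using bundle_param_fibre_eq[OF s _ s _ eq] D by (auto simp: D_def)
    have "dist c c' < r" using D dist_triangle_half_l[of c b r c'] by (auto simp: D_def dist_commute)
    with t r have c: "c = c'" by blast
    have "cis y = cis y'"
      using bundle_param_eq_iff[OF s s _ _ t[symmetric], of y y'] eq D unit_sectionD(4)[OF s] by (auto simp: D_def)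
    moreover have "\<bar>y - y'\<bar> < 2 * pi"
      using D pi_gt3 by (auto simp: D_def dist_real_def)
    ultimately show "y = y' \<and> c = c'" using c cis_eq_imp_eq by blast
  qed
  moreover have "(x, b) \<in> D" using N b r(1) by (auto simp: D_def)
  ultimately show thesis
    using that[of D] s by (auto simp: charts_circle_bundle D_def)
qed

lemma points_circle_bundle:
  "v \<in> points CB \<longleftrightarrow> (\<exists>b. v \<in> fibre E (tpt P b) \<and> lherm E v v = 1)"
proof
  assume "v \<in> points CB"
  then obtain D U s where c: "(D, U, s) \<in> charts CB" "v \<in> patch CB (D, U, s)"
    unfolding points_def by auto
  then obtain x b where "(x, b) \<in> D" "v = \<Psi> s (x, b)" by (auto simp: patch_def)
  then show "\<exists>b. v \<in> fibre E (tpt P b) \<and> lherm E v v = 1"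
    using c(1) bundle_param_in_fibre[of U s b x] by (auto simp: charts_circle_bundle)
next
  assume "\<exists>b. v \<in> fibre E (tpt P b) \<and> lherm E v v = 1"
  then obtain b where v: "v \<in> fibre E (tpt P b)" "lherm E v v = 1" by blast
  obtain U s where s: "tpt P b \<in> U" "unit_section P E U s" using ex_unit_section[OF tpt_in_torus] by blast
  obtain x where x: "v = \<Psi> s (x, b)" using bundle_param_surj[OF s(2,1) v] by blast
  obtain D where "(x, b) \<in> D" "D \<subseteq> UNIV" "(D, U, s) \<in> charts CB"
    by (rule ex_chart[OF s(2,1) open_UNIV UNIV_I])
  then show "v \<in> points CB"
    using x by (auto simp: points_def patch_def intro!: bexI[of _ "(D, U, s)"])
qed

lemma point_cases:
  assumes "v \<in> points CB"
  obtains U s x b where "unit_section P E U s" "tpt P b \<in> U" "0 \<le> x" "x \<le> 2 * pi" "b \<in> cbox 0 P"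
    "v = \<Psi> s (x, b)"
proof -
  obtain b where v: "v \<in> fibre E (tpt P b)" "lherm E v v = 1" using assms points_circle_bundle by blast
  obtain b' where b': "b' \<in> cbox 0 P" "tpt P b = tpt P b'" using tpt_fundamental_domain[OF periods] by blast
  obtain U s where s: "tpt P b' \<in> U" "unit_section P E U s" using ex_unit_section[OF tpt_in_torus] by blast
  show thesis
    using bundle_param_surj[OF s(2,1) v[unfolded b'(2)]] that[OF s(2,1) _ _ b'(1)] by blast
qed

end

section \<open>Transition maps between the charts of the circle bundle\<close>

context hermitian_bundle_with_connection
begin

text \<open>The change of angle is the argument of the transition function and needs a continuous
  branch. The transition function is therefore divided by its value at the given point, which makes
  it 1 there, where the principal logarithm is smooth; the constants \<open>x1 - x0\<close> and
  \<open>b1 - b0\<close> restore the prescribed representatives.\<close>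

lemma transition:
  assumes i: "(D, U, s) \<in> charts CB" and j: "(D', U', s') \<in> charts CB"
    and u0: "(x0, b0) \<in> D" and v0: "(x1, b1) \<in> D'"
    and eq: "\<Psi> s (x0, b0) = \<Psi> s' (x1, b1)"
  obtains N T where "open N" "(x0, b0) \<in> N" "N \<subseteq> D" "smooth_on N T"
    "\<forall>u\<in>N. T u \<in> D' \<and> \<Psi> s' (T u) = \<Psi> s u"
    "(T has_derivative (\<lambda>(\<xi>, a). (\<xi> + (\<Phi> s b0 - \<Phi> s' b1) \<bullet> a, a))) (at (x0, b0))"
proof -
  have s: "unit_section P E U s" and s': "unit_section P E U' s'" and oD: "open D" "open D'"
    and tU: "\<And>x b. (x, b) \<in> D \<Longrightarrow> tpt P b \<in> U" and tU': "\<And>x b. (x, b) \<in> D' \<Longrightarrow> tpt P b \<in> U'"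
    using i j by (auto simp: charts_circle_bundle)
  note us = unit_sectionD[OF s] and us' = unit_sectionD[OF s']
  have m: "tpt P b0 = tpt P b1"
    using bundle_param_fibre_eq[OF s tU[OF u0] s' tU'[OF v0] eq] .
  define c where "c m = lherm E (s m) (s' m)" for m
  define W where "W = tpt P -` (U \<inter> U')"
  have W: "open W" "b0 \<in> W" using us(2) us'(2) tU[OF u0] tU'[OF v0] m by (auto simp: W_def)
  have c1: "cmod (c (tpt P b)) = 1" if "b \<in> W" for b
    using norm_unit_coefficient[OF s' s] that by (auto simp: W_def c_def)
  have cx: "cis x0 * c (tpt P b0) = cis x1"
    using bundle_param_eq_iff[OF s s' _ _ m[symmetric], of x0 x1] eq W(2) by (auto simp: c_def W_def)
  define q where "q b = c (tpt P b) / c (tpt P b0)" for b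
  have csm: "smooth_on W (c \<circ> tpt P)"
    using section_coefficient(1)[OF s' us(5)] unfolding torus_smooth_on_def W_def c_def by (simp add: Int_commute)
  have nz0: "c (tpt P b0) \<noteq> 0" using c1[OF W(2)] by auto
  have qsm: "smooth_on W q"
    using smooth_on_bounded_linear[OF W(1) bounded_linear_divide csm] by (simp add: q_def[abs_def] o_def)
  \<comment> \<open>The right half plane keeps away from the branch cut of
    \<open>Ln\<close>.\<close>
  define W1 where "W1 = W \<inter> q -` {z. Re z > 0}"
  have W1: "open W1" unfolding W1_def
    by (rule continuous_open_preimage[OF smooth_on_imp_continuous_on[OF qsm] W(1) open_halfspace_Re_gt])
  have b0: "b0 \<in> W1" using W(2) nz0 by (simp add: W1_def q_def)
  have Lnsm: "smooth_on W1 (\<lambda>b. Im (Ln (q b)))"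
  proof (rule smooth_on_bounded_linear[OF W1 bounded_linear_Im])
    show "smooth_on W1 (\<lambda>b. Ln (q b))"
      by (rule smooth_on_compose[OF W1 _ _ smooth_on_subset[OF qsm] smooth_on_Ln])
        (auto simp: W1_def complex_nonpos_Reals_iff)
  qed
  define T where "T u = (fst u + (x1 - x0) + Im (Ln (q (snd u))), snd u + (b1 - b0))" for u
  define N1 where "N1 = D \<inter> (UNIV \<times> W1)"
  have N1: "open N1" unfolding N1_def using oD W1 by (intro open_Int open_Times) auto
  have Tsm: "smooth_on N1 T"
    unfolding T_def[abs_def]
    by (intro smooth_on_Pair[OF N1] smooth_on_add[OF N1] smooth_on_const smooth_on_linear[OF N1] 
       bounded_linear_fst bounded_linear_snd smooth_on_compose[OF N1 W1 _ _ Lnsm])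
      (auto simp: N1_def)
  define N where "N = N1 \<inter> T -` D'"
  show thesis
  proof (rule that)
    show "open N" unfolding N_def
      by (rule continuous_open_preimage[OF smooth_on_imp_continuous_on[OF Tsm] N1 oD(2)])
    have "T (x0, b0) = (x1, b1)" using nz0 by (simp add: T_def q_def)
    then show "(x0, b0) \<in> N" using u0 v0 b0 by (simp add: N_def N1_def)
    show "N \<subseteq> D" by (auto simp: N_def N1_def)
    show "smooth_on N T" by (rule smooth_on_subset[OF Tsm]) (auto simp: N_def)
    show "\<forall>u\<in>N. T u \<in> D' \<and> \<Psi> s' (T u) = \<Psi> s u"
    proof (intro ballI conjI)
      fix u assume u: "u \<in> N"
      then show "T u \<in> D'" by (simp add: N_def)
      obtain x b where xb: "u = (x, b)" by (cases u)
      have b: "b \<in> W" using u by (simp add: xb N_def N1_def W1_def)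
      have tb: "tpt P (b + (b1 - b0)) = tpt P b" by (rule tpt_translate[OF m])
      have nq: "cmod (q b) = 1" using c1[OF b] c1[OF W(2)] by (simp add: q_def norm_divide)
      then have "exp (\<i> * of_real (Im (Ln (q b)))) = q b"
      proof -
        have "q b \<noteq> 0" using nq by auto
        then have "Re (Ln (q b)) = 0" using nq by simp
        then have "\<i> * of_real (Im (Ln (q b))) = Ln (q b)" by (simp add: complex_eq_iff)
        with \<open>q b \<noteq> 0\<close> show ?thesis by simp
      qed
      then have "cis (Im (Ln (q b))) = q b" by (simp add: cis_conv_exp)
      then have "cis (fst (T u)) = cis x * (cis x1 / cis x0) * q b"
        by (simp add: T_def xb flip: cis_mult cis_divide)
      also have "\<dots> = cis x * c (tpt P b)" using cx nz0 by (simp add: q_def flip: cx)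
      finally show "\<Psi> s' (T u) = \<Psi> s u"
        using bundle_param_eq_iff[OF s s' _ _ tb, of x "fst (T u)"] b
        by (simp add: T_def xb W_def c_def)
    qed
    have dq: "(q has_derivative (\<lambda>a. \<i> * of_real ((\<Phi> s b0 - \<Phi> s' b1) \<bullet> a))) (at b0)"
    proof -
      have "frechet_derivative (c \<circ> tpt P) (at b0) a / c (tpt P b0)
          = \<i> * of_real ((\<Phi> s b0 - \<Phi> s' b1) \<bullet> a)" for a
        using frechet_derivative_transition[OF s' s, of b0 a] W(2) nz0 conn_form_cong[OF m, of E s']
        by (simp add: W_def c_def[abs_def])
      moreover have "(q has_derivative (\<lambda>a. frechet_derivative (c \<circ> tpt P) (at b0) a / c (tpt P b0))) (at b0)"
        using bounded_linear.has_derivative[OF bounded_linear_divide smooth_on_has_derivative[OF csm W(2)]]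
        by (simp add: q_def[abs_def] o_def)
      ultimately show ?thesis by simp
    qed
    \<comment> \<open>At 1 the derivative of \<open>Ln\<close> is the identity, so the derivative of
      the angle is the imaginary part of that of \<open>q\<close>.\<close>
    have "q b0 = 1" using nz0 by (simp add: q_def)
    then have "((\<lambda>b. Ln (q b)) has_derivative (\<lambda>a. 1 * (\<i> * of_real ((\<Phi> s b0 - \<Phi> s' b1) \<bullet> a)))) (at b0)"
      by (intro has_derivative_compose[OF dq has_field_derivative_imp_has_derivative] derivative_eq_intros) auto
    then have "((\<lambda>b. Im (Ln (q b))) has_derivative (\<lambda>a. (\<Phi> s b0 - \<Phi> s' b1) \<bullet> a)) (at b0)"
      using bounded_linear.has_derivative[OF bounded_linear_Im] by fastforce
    then have dIm: "((\<lambda>u. Im (Ln (q (snd u)))) has_derivative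
        (\<lambda>v. (\<Phi> s b0 - \<Phi> s' b1) \<bullet> snd v)) (at (x0, b0))"
      using has_derivative_compose[OF has_derivative_snd[OF has_derivative_ident], of "\<lambda>b. Im (Ln (q b))" _ "(x0, b0)"]
      by simp
    have "(T has_derivative (\<lambda>v. (fst v + 0 + (\<Phi> s b0 - \<Phi> s' b1) \<bullet> snd v, snd v + 0))) (at (x0, b0))"
      unfolding T_def[abs_def]
      by (intro has_derivative_Pair has_derivative_add has_derivative_const has_derivative_fst
          has_derivative_snd has_derivative_ident dIm)
    then show "(T has_derivative (\<lambda>(\<xi>, a). (\<xi> + (\<Phi> s b0 - \<Phi> s' b1) \<bullet> a, a))) (at (x0, b0))"
      by (simp add: case_prod_unfold)
  qed
qed

end

context hermitian_bundle_with_connection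
begin

lemma coord_eqI:
  assumes "(D, U, s) \<in> charts CB" "u \<in> D" "\<Psi> s u = p"
  shows "coord CB (D, U, s) p = u"
  using coord_param[of CB "(D, U, s)" u] assms by (auto simp: charts_circle_bundle)

text \<open>The angle component changes by phi - phi', exactly what makes the angle component plus
  phi of the base component, and with it theta, independent of the chart.\<close>

lemma coord_transition:
  assumes i: "(D, U, s) \<in> charts CB" and j: "(D', U', s') \<in> charts CB"
    and u0: "u0 \<in> D" "\<Psi> s u0 \<in> patch CB (D', U', s')"
  defines "v0 \<equiv> coord CB (D', U', s') (\<Psi> s u0)"
  shows "\<exists>N. open N \<and> u0 \<in> N \<and> N \<subseteq> {u \<in> D. \<Psi> s u \<in> patch CB (D', U', s')} \<and>
      smooth_on N (coord CB (D', U', s') \<circ> \<Psi> s)"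
    and "((coord CB (D', U', s') \<circ> \<Psi> s) has_derivative
      (\<lambda>v. (fst v + (\<Phi> s (snd u0) - \<Phi> s' (snd v0)) \<bullet> snd v, snd v))) (at u0)"
proof -
  have v0: "v0 \<in> D'" "\<Psi> s' v0 = \<Psi> s u0"
    using coord_in_cdom[OF u0(2)] param_coord[OF u0(2)] by (auto simp: v0_def)
  obtain x0 b0 where u: "u0 = (x0, b0)" by (cases u0)
  obtain x1 b1 where v: "v0 = (x1, b1)" by (cases v0)
  have tr: "(x0, b0) \<in> D" "(x1, b1) \<in> D'" "\<Psi> s (x0, b0) = \<Psi> s' (x1, b1)"
    using u0(1) v0 by (simp_all add: u v)
  obtain N T where N: "open N" "u0 \<in> N" "N \<subseteq> D" "smooth_on N T"
    "\<forall>u\<in>N. T u \<in> D' \<and> \<Psi> s' (T u) = \<Psi> s u"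
    "(T has_derivative (\<lambda>(\<xi>, a). (\<xi> + (\<Phi> s b0 - \<Phi> s' b1) \<bullet> a, a))) (at u0)"
    unfolding u by (rule transition[OF i j tr])
  have T: "(coord CB (D', U', s') \<circ> \<Psi> s) u = T u" if "u \<in> N" for u
    using coord_eqI[OF j] bspec[OF N(5) that] by auto
  have sub: "N \<subseteq> {u \<in> D. \<Psi> s u \<in> patch CB (D', U', s')}"
  proof
    fix u assume "u \<in> N"
    with N(3,5) param_in_patch[of "T u" CB "(D', U', s')"]
    show "u \<in> {u \<in> D. \<Psi> s u \<in> patch CB (D', U', s')}" by auto
  qed
  show "\<exists>N. open N \<and> u0 \<in> N \<and> N \<subseteq> {u \<in> D. \<Psi> s u \<in> patch CB (D', U', s')} \<and>
      smooth_on N (coord CB (D', U', s') \<circ> \<Psi> s)"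
    using N(1,2) sub smooth_on_cong[OF N(1) T[symmetric] N(4)] by blast
  have "((coord CB (D', U', s') \<circ> \<Psi> s) has_derivative
      (\<lambda>(\<xi>, a). (\<xi> + (\<Phi> s b0 - \<Phi> s' b1) \<bullet> a, a))) (at u0)"
    by (rule has_derivative_transform_within_open[OF N(6,1,2) T[symmetric]])
  then show "((coord CB (D', U', s') \<circ> \<Psi> s) has_derivative
      (\<lambda>v. (fst v + (\<Phi> s (snd u0) - \<Phi> s' (snd v0)) \<bullet> snd v, snd v))) (at u0)"
    by (simp add: u v case_prod_unfold)
qed

lemma overlap:
  assumes i: "i \<in> charts CB" and j: "j \<in> charts CB"
  shows "open {u \<in> cdom CB i. param CB i u \<in> patch CB j}"
    and "smooth_on {u \<in> cdom CB i. param CB i u \<in> patch CB j} (coord CB j \<circ> param CB i)"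
proof -
  obtain D U s where i': "i = (D, U, s)" by (cases i)
  obtain D' U' s' where j': "j = (D', U', s')" by (cases j)
  let ?S = "{u \<in> cdom CB i. param CB i u \<in> patch CB j}"
  have *: "\<exists>N. open N \<and> u \<in> N \<and> N \<subseteq> ?S \<and> smooth_on N (coord CB j \<circ> param CB i)" if "u \<in> ?S" for u
    using coord_transition(1)[OF i[unfolded i'] j[unfolded j'], of u] that by (simp add: i' j')
  show "open ?S" by (subst open_subopen) (use * in blast)
  show "smooth_on ?S (coord CB j \<circ> param CB i)" by (rule smooth_on_local) (use * in blast)
qed

section \<open>Topology of the total space of the circle bundle\<close>

lemma continuous_atlas_CB: "continuous_atlas CB"
  unfolding continuous_atlas_def
proof (intro conjI ballI)
  fix i j assume i: "i \<in> charts CB" and j: "j \<in> charts CB"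
  show "open {u \<in> cdom CB i. param CB i u \<in> patch CB j}" by (rule overlap(1)[OF i j])
  show "continuous_on {u \<in> cdom CB i. param CB i u \<in> patch CB j} (coord CB j \<circ> param CB i)"
    by (rule smooth_on_imp_continuous_on[OF overlap(2)[OF i j]])
qed (auto simp: charts_circle_bundle)

lemma topspace_CB: "topspace (mtop CB) = points CB"
  by (rule topspace_mtop[OF continuous_atlas_CB])

lemma bundle_param_in_points:
  "unit_section P E U s \<Longrightarrow> tpt P b \<in> U \<Longrightarrow> \<Psi> s (x, b) \<in> points CB"
  using bundle_param_in_fibre points_circle_bundle by blast

text \<open>A chart sees only a small domain \<open>D\<close>; letting \<open>D\<close> vary
  transfers openness to the whole cylinder over \<open>U\<close>, where \<open>\<Psi> s\<close> is
  not injective.\<close>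

lemma open_bundle_param_vimage:
  assumes s: "unit_section P E U s" and W: "openin (mtop CB) W"
  shows "open {u \<in> UNIV \<times> tpt P -` U. \<Psi> s u \<in> W}" (is "open ?S")
proof (subst open_subopen, intro ballI)
  fix u assume u: "u \<in> ?S"
  obtain x b where xb: "u = (x, b)" by (cases u)
  obtain D where D: "u \<in> D" "D \<subseteq> UNIV" "(D, U, s) \<in> charts CB"
    using ex_chart[OF s _ open_UNIV UNIV_I, of b x] u unfolding xb by auto
  have "open {u \<in> D. \<Psi> s u \<in> W}" using W D(3) unfolding openin_mtop_iff by force
  moreover have "u \<in> {u \<in> D. \<Psi> s u \<in> W}" using u D(1) by simp
  moreover have "{u \<in> D. \<Psi> s u \<in> W} \<subseteq> ?S" using D(3) by (auto simp: charts_circle_bundle)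
  ultimately show "\<exists>T. open T \<and> u \<in> T \<and> T \<subseteq> ?S" by blast
qed

lemma continuous_map_bundle_param:
  assumes s: "unit_section P E U s"
  shows "continuous_map (top_of_set (UNIV \<times> tpt P -` U)) (mtop CB) (\<Psi> s)"
  unfolding continuous_map_def
proof (intro conjI allI impI)
  show "\<Psi> s \<in> topspace (top_of_set (UNIV \<times> tpt P -` U)) \<rightarrow> topspace (mtop CB)"
    using bundle_param_in_points[OF s] by (auto simp: topspace_CB)
  fix W assume "openin (mtop CB) W"
  from open_bundle_param_vimage[OF s this]
  show "openin (top_of_set (UNIV \<times> tpt P -` U)) {u \<in> topspace (top_of_set (UNIV \<times> tpt P -` U)). \<Psi> s u \<in> W}"
    by (auto simp: openin_open)
qed

lemma openin_bundle_param_image: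
  assumes s: "unit_section P E U s" and S: "open S" "S \<subseteq> UNIV \<times> tpt P -` U"
  shows "openin (mtop CB) (\<Psi> s ` S)"
proof (subst openin_subopen, intro ballI)
  fix p assume "p \<in> \<Psi> s ` S"
  then obtain x b where xb: "(x, b) \<in> S" "p = \<Psi> s (x, b)" by auto
  obtain D where D: "(x, b) \<in> D" "D \<subseteq> S" "(D, U, s) \<in> charts CB"
    using ex_chart[OF s _ S(1) xb(1)] xb(1) S(2) by auto
  have "openin (mtop CB) (patch CB (D, U, s))" by (rule openin_patch[OF continuous_atlas_CB D(3)])
  moreover have "patch CB (D, U, s) = \<Psi> s ` D" by (simp add: patch_def)
  ultimately show "\<exists>T. openin (mtop CB) T \<and> p \<in> T \<and> T \<subseteq> \<Psi> s ` S"
    using D(1,2) xb(2) by (intro exI[of _ "\<Psi> s ` D"]) auto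
qed

text \<open>Over a closed ball inside one trivialising set, the bundle is the continuous image of
  \<open>{0..2 * pi}\<close> times the ball. Finitely many of the open balls cover the fundamental
  cell, and every point lies over that cell.\<close>

lemma compact_space_CB: "compact_space (mtop CB)"
proof -
  have "\<exists>N. open N \<and> b \<in> N \<and> (\<exists>K. compactin (mtop CB) K \<and>
      (\<forall>v\<in>points CB. \<forall>b'\<in>N. v \<in> fibre E (tpt P b') \<longrightarrow> v \<in> K))" for b
  proof -
    obtain U s where s: "tpt P b \<in> U" "unit_section P E U s" using ex_unit_section[OF tpt_in_torus] by blast
    obtain r where r: "r > 0" "cball b r \<subseteq> tpt P -` U"
      using unit_sectionD(2)[OF s(2)] s(1) open_contains_cball by (metis vimage_eq)
    let ?K = "\<Psi> s ` ({0..2 * pi} \<times> cball b r)"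
    have "compactin (mtop CB) ?K"
      by (rule image_compactin[OF _ continuous_map_bundle_param[OF s(2)]])
        (use r in \<open>auto simp: compactin_subtopology intro!: compact_Times\<close>)
    moreover have "v \<in> ?K" if v: "v \<in> points CB" and b': "b' \<in> ball b r" and vf: "v \<in> fibre E (tpt P b')" for v b'
    proof -
      have "lherm E v v = 1" using v unfolding points_circle_bundle by blast
      moreover have "tpt P b' \<in> U" using r b' by (auto simp: subset_eq)
      ultimately obtain x where "0 \<le> x" "x \<le> 2 * pi" "v = \<Psi> s (x, b')"
        using bundle_param_surj[OF s(2) _ vf] by blast
      then show ?thesis using b' by auto
    qed
    ultimately show ?thesis using r(1) by (intro exI[of _ "ball b r"]) auto
  qed
  then obtain N K where NK: "\<And>b. open (N b)" "\<And>b. b \<in> N b" "\<And>b. compactin (mtop CB) (K b)"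
    "\<And>b v b'. v \<in> points CB \<Longrightarrow> b' \<in> N b \<Longrightarrow> v \<in> fibre E (tpt P b') \<Longrightarrow> v \<in> K b"
    by metis
  obtain F where F: "finite F" "cbox 0 P \<subseteq> (\<Union>b\<in>F. N b)"
    using compactE_image[OF compact_cbox, of "cbox 0 P" N 0 P] NK(1,2) by (metis UN_I subsetI)
  have "points CB = (\<Union>b\<in>F. K b)"
  proof
    show "(\<Union>b\<in>F. K b) \<subseteq> points CB"
      using NK(3) compactin_subset_topspace topspace_CB by blast
    show "points CB \<subseteq> (\<Union>b\<in>F. K b)"
    proof
      fix v assume v: "v \<in> points CB"
      obtain U s x b where u: "unit_section P E U s" "tpt P b \<in> U" "0 \<le> x" "x \<le> 2 * pi" "b \<in> cbox 0 P"
        "v = \<Psi> s (x, b)" by (rule point_cases[OF v])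
      then have "v \<in> fibre E (tpt P b)" using bundle_param_in_fibre by blast
      then show "v \<in> (\<Union>b\<in>F. K b)" using F(2) u(5) NK(4)[OF v] by blast
    qed
  qed
  then show ?thesis
    unfolding compact_space_def topspace_CB using compactin_Union[of "K ` F" "mtop CB"] F(1) NK(3) by auto
qed

text \<open>Compactness leaves finitely many charts, so countability of a basis passes from the
  model space to the total space.\<close>

lemma second_countable_CB: "second_countable (mtop CB)"
proof -
  obtain F where F: "finite F" "F \<subseteq> patch CB ` charts CB" "points CB \<subseteq> \<Union>F"
  proof -
    have "\<forall>\<U>. (\<forall>U\<in>\<U>. openin (mtop CB) U) \<and> points CB \<subseteq> \<Union>\<U> \<longrightarrow> (\<exists>F. finite F \<and> F \<subseteq> \<U> \<and> points CB \<subseteq> \<Union>F)"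
      using compact_space_CB unfolding compact_space_def compactin_def topspace_CB by (elim conjE)
    from this[rule_format, of "patch CB ` charts CB"] show thesis
      using openin_patch[OF continuous_atlas_CB] that by (auto simp: points_def)
  qed
  obtain I where I: "finite I" "I \<subseteq> charts CB" "F = patch CB ` I"
    using finite_subset_image[OF F(1,2)] by blast
  show ?thesis
  proof (rule second_countable_mtop[OF continuous_atlas_CB countable_finite[OF I(1)] I(2)])
    show "points CB = (\<Union>i\<in>I. patch CB i)" using F(3) I(2,3) by (auto simp: points_def)
  qed
qed

text \<open>Every fibre is an image of the real line, so a clopen set is a union of whole fibres. It
  is therefore determined by its projection, whose preimage \<open>?B\<close> in the universal cover
  of the torus is again clopen.\<close>

lemma connected_space_CB: "connected_space (mtop CB)"
  unfolding connected_space_clopen_in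
proof (intro allI impI)
  fix W assume W: "openin (mtop CB) W \<and> closedin (mtop CB) W"
  have fib: "\<Psi> s (x, b) \<in> W \<longleftrightarrow> \<Psi> s (y, b) \<in> W"
    if s: "unit_section P E U s" "tpt P b \<in> U" for U s b x y
  proof -
    have o: "open {t. \<Psi> s (t, b) \<in> V}" if "openin (mtop CB) V" for V
    proof -
      have "{t. \<Psi> s (t, b) \<in> V} = (\<lambda>t. (t, b)) -` {u \<in> UNIV \<times> tpt P -` U. \<Psi> s u \<in> V}"
        using s by auto
      moreover have "open ((\<lambda>t. (t, b)) -` {u \<in> UNIV \<times> tpt P -` U. \<Psi> s u \<in> V})"
        by (rule open_vimage[OF open_bundle_param_vimage[OF s(1) that]]) (intro continuous_intros)
      ultimately show ?thesis by (simp only:)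
    qed
    let ?A = "{t. \<Psi> s (t, b) \<in> W}"
    have "- ?A = {t. \<Psi> s (t, b) \<in> points CB - W}"
      using bundle_param_in_points[OF s] by auto
    then have "open ?A" "closed ?A"
      using o[of W] o[of "points CB - W"] W by (auto simp: closed_def closedin_def topspace_CB)
    then have "?A = {} \<or> ?A = UNIV" by (metis clopen)
    then show ?thesis by blast
  qed
  let ?B = "\<lambda>V. {b. \<exists>v\<in>V. v \<in> fibre E (tpt P b)}"
  have o: "open (?B V)" if V: "openin (mtop CB) V" for V
  proof (subst open_subopen, intro ballI)
    fix b assume "b \<in> ?B V"
    then obtain v where v: "v \<in> V" "v \<in> fibre E (tpt P b)" by blast
    have "v \<in> points CB" using v V openin_subset topspace_CB by blast
    then have one: "lherm E v v = 1" unfolding points_circle_bundle by blast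
    obtain U s where s: "tpt P b \<in> U" "unit_section P E U s" using ex_unit_section[OF tpt_in_torus] by blast
    obtain x where x: "v = \<Psi> s (x, b)" using bundle_param_surj[OF s(2,1) v(2) one] by blast
    let ?T = "(\<lambda>b. (x, b)) -` {u \<in> UNIV \<times> tpt P -` U. \<Psi> s u \<in> V}"
    have "open ?T" by (rule open_vimage[OF open_bundle_param_vimage[OF s(2) V]]) (intro continuous_intros)
    moreover have "b \<in> ?T" using s x v by auto
    moreover have "?T \<subseteq> ?B V" using bundle_param_in_fibre(1)[OF s(2)] by auto
    ultimately show "\<exists>T. open T \<and> b \<in> T \<and> T \<subseteq> ?B V" by blast
  qed
  have "?B (points CB - W) = - ?B W"
  proof (rule Set.set_eqI)
    fix b
    obtain U s where s: "tpt P b \<in> U" "unit_section P E U s" using ex_unit_section[OF tpt_in_torus] by blast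
    have "\<Psi> s (0, b) \<in> W \<longleftrightarrow> (\<exists>v\<in>W. v \<in> fibre E (tpt P b))"
      "\<Psi> s (0, b) \<notin> W \<longleftrightarrow> (\<exists>v\<in>points CB - W. v \<in> fibre E (tpt P b))"
    proof -
      have *: "\<exists>x. v = \<Psi> s (x, b)" if v: "v \<in> fibre E (tpt P b)" "v \<in> points CB" for v
      proof -
        have "lherm E v v = 1" using v(2) unfolding points_circle_bundle by blast
        then show ?thesis using bundle_param_surj[OF s(2,1) v(1)] by metis
      qed
      have WX: "W \<subseteq> points CB" using W openin_subset topspace_CB by blast
      have z: "\<Psi> s (0, b) \<in> fibre E (tpt P b)" "\<Psi> s (0, b) \<in> points CB"
        using bundle_param_in_fibre(1)[OF s(2,1)] bundle_param_in_points[OF s(2,1)] by auto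
      show "\<Psi> s (0, b) \<in> W \<longleftrightarrow> (\<exists>v\<in>W. v \<in> fibre E (tpt P b))"
        using z * fib[OF s(2,1)] WX by blast
      show "\<Psi> s (0, b) \<notin> W \<longleftrightarrow> (\<exists>v\<in>points CB - W. v \<in> fibre E (tpt P b))"
        using z * fib[OF s(2,1)] WX by blast
    qed
    then show "b \<in> ?B (points CB - W) \<longleftrightarrow> b \<in> - ?B W" by auto
  qed
  moreover have "open (?B W)" "open (?B (points CB - W))"
    using o W by (auto simp: closedin_def topspace_CB)
  ultimately have "?B W = {} \<or> ?B W = UNIV" by (metis clopen closed_def)
  then show "W = {} \<or> W = topspace (mtop CB)"
  proof
    have WX: "W \<subseteq> points CB" using W openin_subset topspace_CB by blast
    assume "?B W = {}"
    moreover have "v \<notin> W" if "\<And>b. v \<notin> fibre E (tpt P b)" for v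
      using that WX points_circle_bundle by blast
    ultimately have "W = {}" using WX points_circle_bundle by blast
    then show ?thesis by blast
  next
    have WX: "W \<subseteq> points CB" using W openin_subset topspace_CB by blast
    assume "?B W = UNIV"
    then have "?B (points CB - W) = {}" using \<open>?B (points CB - W) = - ?B W\<close> by simp
    then have "points CB - W = {}" using points_circle_bundle by blast
    then show ?thesis using WX topspace_CB by blast
  qed
qed

text \<open>Points of one fibre are separated by their phases in a trivialisation. Points of
  different fibres are separated on the base by the periodic function \<open>g\<close>, the
  exponential of a torus coordinate in which they do not differ by a multiple of the period.\<close>

lemma Hausdorff_CB: "Hausdorff_space (mtop CB)"
  unfolding Hausdorff_space_def topspace_CB
proof (intro allI impI, elim conjE)
  fix p q assume pq: "p \<in> points CB" "q \<in> points CB" "p \<noteq> q"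
  obtain U s x b where p: "unit_section P E U s" "tpt P b \<in> U" "p = \<Psi> s (x, b)"
    using point_cases[OF pq(1)] by metis
  obtain U' s' y c where q: "unit_section P E U' s'" "tpt P c \<in> U'" "q = \<Psi> s' (y, c)"
    using point_cases[OF pq(2)] by metis
  show "\<exists>V W. openin (mtop CB) V \<and> openin (mtop CB) W \<and> p \<in> V \<and> q \<in> W \<and> disjnt V W"
  proof (cases "tpt P b = tpt P c")
    case True
    obtain z where z: "q = \<Psi> s (z, b)"
    proof -
      have "q \<in> fibre E (tpt P b)" "lherm E q q = 1"
        using bundle_param_in_fibre[OF q(1,2)] q(3) True by auto
      then show thesis using bundle_param_surj[OF p(1,2)] that by metis
    qed
    have ne: "cis x \<noteq> cis z" using pq(3) p z by (auto simp: bundle_param_def)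
    obtain V W where VW: "open V" "open W" "cis x \<in> V" "cis z \<in> W" "V \<inter> W = {}"
      using hausdorff[OF ne] by blast
    let ?S = "\<lambda>V. (\<lambda>u. cis (fst u)) -` V \<inter> (UNIV \<times> tpt P -` U)"
    have oS: "open (?S V)" if "open V" for V
      using that unit_sectionD(2)[OF p(1)]
      by (intro open_Int open_Times open_vimage) (auto intro!: continuous_intros continuous_on_cis)
    have "disjnt (\<Psi> s ` ?S V) (\<Psi> s ` ?S W)"
    proof -
      have False if uv: "u \<in> ?S V" "v \<in> ?S W" "\<Psi> s u = \<Psi> s v" for u v
      proof -
        obtain x1 b1 y1 c1 where e: "u = (x1, b1)" "v = (y1, c1)" by (cases u, cases v)
        have t: "tpt P b1 = tpt P c1"
          using bundle_param_fibre_eq[OF p(1) _ p(1)] uv unfolding e by auto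
        have "cis x1 = cis y1"
          using bundle_param_eq_iff[OF p(1) p(1) _ _ t[symmetric], of x1 y1] uv unit_sectionD(4)[OF p(1)]
          unfolding e by auto
        then show False using uv VW(5) unfolding e by auto
      qed
      then show ?thesis unfolding disjnt_def by blast
    qed
    moreover have "p \<in> \<Psi> s ` ?S V" "q \<in> \<Psi> s ` ?S W"
      using p z VW by auto
    moreover have "openin (mtop CB) (\<Psi> s ` ?S V)" "openin (mtop CB) (\<Psi> s ` ?S W)"
      by (rule openin_bundle_param_image[OF p(1) oS]; use VW in blast)+
    ultimately show ?thesis by blast
  next
    case False
    then obtain k where k: "k \<in> Basis" "\<And>m::int. (c - b) \<bullet> k \<noteq> of_int m * (P \<bullet> k)"
      unfolding tpt_eq_iff by blast
    define g where "g e = cis (2 * pi * (e \<bullet> k) / (P \<bullet> k))" for e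
    have per: "g e = g e'" if "tpt P e = tpt P e'" for e e'
    proof -
      obtain m :: int where m: "(e' - e) \<bullet> k = of_int m * (P \<bullet> k)"
        using \<open>tpt P e = tpt P e'\<close> k(1) unfolding tpt_eq_iff by blast
      then have "e' \<bullet> k = e \<bullet> k + of_int m * (P \<bullet> k)" by (simp add: inner_diff_left)
      then have "2 * pi * (e' \<bullet> k) / (P \<bullet> k) = 2 * pi * (e \<bullet> k) / (P \<bullet> k) + 2 * pi * of_int m"
        using periods[OF k(1)] by (simp add: field_simps)
      then show ?thesis by (simp add: g_def flip: cis_mult)
    qed
    have ne: "g b \<noteq> g c"
    proof
      assume "g b = g c"
      then have "cis (2 * pi * (c \<bullet> k) / (P \<bullet> k) - 2 * pi * (b \<bullet> k) / (P \<bullet> k)) = 1"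
        by (simp add: g_def flip: cis_divide)
      then have "cos (2 * pi * (c \<bullet> k) / (P \<bullet> k) - 2 * pi * (b \<bullet> k) / (P \<bullet> k)) = 1" by (simp add: complex_eq_iff)
      then obtain n :: int where "2 * pi * (c \<bullet> k) / (P \<bullet> k) - 2 * pi * (b \<bullet> k) / (P \<bullet> k) = of_int n * 2 * pi"
        using cos_one_2pi_int by auto
      then have "2 * pi * ((c - b) \<bullet> k) = 2 * pi * (of_int n * (P \<bullet> k))"
        using periods[OF k(1)] by (simp add: field_simps inner_diff_left)
      then show False using k(2)[of n] by simp
    qed
    obtain V W where VW: "open V" "open W" "g b \<in> V" "g c \<in> W" "V \<inter> W = {}"
      using hausdorff[OF ne] by blast
    have cg: "continuous_on UNIV g" unfolding g_def[abs_def]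
      using periods[OF k(1)] by (intro continuous_on_cis continuous_intros) auto
    let ?S = "\<lambda>U V. UNIV \<times> (g -` V \<inter> tpt P -` U)"
    have oS: "open (?S U V)" if "open V" "unit_section P E U s" for U s V
      using unit_sectionD(2)[OF that(2)] open_vimage[OF that(1) cg] by (intro open_Times open_Int) auto
    have "disjnt (\<Psi> s ` ?S U V) (\<Psi> s' ` ?S U' W)"
    proof -
      have False if uv: "u \<in> ?S U V" "v \<in> ?S U' W" "\<Psi> s u = \<Psi> s' v" for u v
      proof -
        obtain x1 b1 y1 c1 where e: "u = (x1, b1)" "v = (y1, c1)" by (cases u, cases v)
        have t: "tpt P b1 = tpt P c1"
          using bundle_param_fibre_eq[OF p(1) _ q(1)] uv unfolding e by auto
        then show False using per[OF t] uv VW(5) unfolding e by auto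
      qed
      then show ?thesis unfolding disjnt_def by blast
    qed
    moreover have "p \<in> \<Psi> s ` ?S U V" "q \<in> \<Psi> s' ` ?S U' W"
      using p q VW by auto
    moreover have "openin (mtop CB) (\<Psi> s ` ?S U V)"
      by (rule openin_bundle_param_image[OF p(1) oS[OF VW(1) p(1)]]) auto
    moreover have "openin (mtop CB) (\<Psi> s' ` ?S U' W)"
      by (rule openin_bundle_param_image[OF q(1) oS[OF VW(2) q(1)]]) auto
    ultimately show ?thesis by blast
  qed
qed

lemma smooth_manifold_CB: "smooth_manifold CB"
  unfolding smooth_manifold_def
proof (intro conjI ballI)
  fix i j assume ij: "i \<in> charts CB" "j \<in> charts CB"
  show "open {u \<in> cdom CB i. param CB i u \<in> patch CB j}"
    "smooth_on {u \<in> cdom CB i. param CB i u \<in> patch CB j} (coord CB j \<circ> param CB i)"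
    using overlap[OF ij] by auto
qed (auto simp: charts_circle_bundle Hausdorff_CB second_countable_CB connected_space_CB)

end

section \<open>The metric and its Levi-Civita connection\<close>

locale wave_bundle = hermitian_bundle_with_connection P E
  for P :: "(real^'n) \<times> real" and E :: "('v, (real^'n) \<times> real) line_bundle" +
  fixes j1 :: 'n and f :: "((real^'n) \<times> real) set \<Rightarrow> real"
  assumes curvature: "has_curvature_i P E (psi j1)"
    and smooth_f: "torus_smooth_on P (torus P) f"
begin

abbreviation "G \<equiv> wave_metric P E eta flat_metric f"

definition F :: "(real^'n) \<times> real \<Rightarrow> real" where "F b = f (tpt P b)"

abbreviation "dF b \<equiv> frechet_derivative F (at b)"

abbreviation "d\<Phi> s b \<equiv> frechet_derivative (\<Phi> s) (at b)"

text \<open>The metric in the charts built from \<open>s\<close>. The fibre coordinate is no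
  argument: rotations of the fibres are isometries.\<close>

definition met :: "(((real^'n) \<times> real) set \<Rightarrow> 'v) \<Rightarrow> (real^'n) \<times> real \<Rightarrow>
    real \<times> (real^'n) \<times> real \<Rightarrow> real \<times> (real^'n) \<times> real \<Rightarrow> real" where
  "met s b v w = (fst v + \<Phi> s b \<bullet> snd v) * snd (snd w) + (fst w + \<Phi> s b \<bullet> snd w) * snd (snd v)
     + F b * snd (snd v) * snd (snd w) + snd v \<bullet> snd w"

definition dmet :: "(((real^'n) \<times> real) set \<Rightarrow> 'v) \<Rightarrow> (real^'n) \<times> real \<Rightarrow> (real^'n) \<times> real \<Rightarrow>
    real \<times> (real^'n) \<times> real \<Rightarrow> real \<times> (real^'n) \<times> real \<Rightarrow> real" where
  "dmet s b \<beta> v w = (d\<Phi> s b \<beta> \<bullet> snd v) * snd (snd w) + (d\<Phi> s b \<beta> \<bullet> snd w) * snd (snd v)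
     + dF b \<beta> * snd (snd v) * snd (snd w)"

text \<open>\<open>force b\<close> is the acceleration of the torus coordinates of a geodesic with \<open>z' = 1\<close>.\<close>

definition force :: "(real^'n) \<times> real \<Rightarrow> (real^'n) \<times> real" where
  "force b = ((\<chi> j. (if j = j1 then 1 else 0) + dF b (axis j 1, 0) / 2), 0)"

text \<open>Twice the fraction is the coefficient of the z-component of the test vector in the
  Koszul formula, once the curvature identity has been used. The last summand compensates what the
  base component of the Christoffel vector contributes to the metric through the connection
  form.\<close>

definition fibre_chr :: "(((real^'n) \<times> real) set \<Rightarrow> 'v) \<Rightarrow> (real^'n) \<times> real \<Rightarrow>
    (real^'n) \<times> real \<Rightarrow> (real^'n) \<times> real \<Rightarrow> real" where
  "fibre_chr s b a a' = (d\<Phi> s b a \<bullet> a' + d\<Phi> s b a' \<bullet> a + dF b a * snd a' + dF b a' * snd a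
     + fst a $ j1 * snd a' + fst a' $ j1 * snd a - dF b (0, 1) * snd a * snd a') / 2
     + snd a * snd a' * (\<Phi> s b \<bullet> force b)"

definition chr :: "(((real^'n) \<times> real) set \<Rightarrow> 'v) \<Rightarrow> (real^'n) \<times> real \<Rightarrow>
    real \<times> (real^'n) \<times> real \<Rightarrow> real \<times> (real^'n) \<times> real \<Rightarrow> real \<times> (real^'n) \<times> real" where
  "chr s b v w = (fibre_chr s b (snd v) (snd w), - (snd (snd v) * snd (snd w)) *\<^sub>R force b)"

lemma smooth_F: "smooth_on UNIV F"
proof -
  have "tpt P -` torus P = UNIV" by auto
  then show ?thesis using smooth_f by (simp add: torus_smooth_on_def F_def[abs_def] o_def)
qed

lemma F_cong: "tpt P b = tpt P b' \<Longrightarrow> F b = F b'"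
  by (simp add: F_def)

lemma has_derivative_F: "(F has_derivative dF b) (at b)"
  by (rule smooth_on_has_derivative[OF smooth_F UNIV_I])

lemma linear_dF: "linear (dF b)"
  by (rule has_derivative_linear[OF has_derivative_F])

lemma dF_cong: "tpt P b = tpt P b' \<Longrightarrow> dF b = dF b'"
  by (rule periodic_frechet_derivative[where P = P, OF _ _ differentiableI[OF has_derivative_F]])
    (rule F_cong, assumption+)

lemma force_cong: "tpt P b = tpt P b' \<Longrightarrow> force b = force b'"
  using dF_cong[of b b'] by (simp add: force_def)

lemma flat_metric_inner: "flat_metric a b = a \<bullet> b"
  by (simp add: flat_metric_def inner_prod_def inner_vec_def)

lemma metric_eq:
  assumes "(D, U, s) \<in> charts CB" "u \<in> D"
  shows "G (D, U, s) u v w = met s (snd u) v w"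
proof -
  obtain x b where u: "u = (x, b)" by (cases u)
  have s: "unit_section P E U s" and m: "tpt P b \<in> U"
    using assms by (auto simp: charts_circle_bundle u)
  show ?thesis
    by (simp add: u wave_metric_def theta_def met_def eta_def flat_metric_inner F_def
        local_form_conn_form[OF s m] case_prod_unfold)
qed

lemma force_inner: "force b \<bullet> a = fst a $ j1 + dF b (fst a, 0) / 2"
proof -
  have "(fst a, 0::real) = (\<Sum>j\<in>UNIV. (fst a $ j) *\<^sub>R (axis j 1, 0))"
    by (simp add: prod_eq_iff fst_sum snd_sum vec_eq_iff axis_def if_distrib sum.delta cong: if_cong)
  then have "dF b (fst a, 0) = (\<Sum>j\<in>UNIV. fst a $ j * dF b (axis j 1, 0))"
    by (simp only: linear_sum[OF linear_dF] linear_scale[OF linear_dF] real_scaleR_def)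
  moreover have "force b \<bullet> a = (\<Sum>j\<in>UNIV. (if j = j1 then fst a $ j else 0) + fst a $ j * dF b (axis j 1, 0) / 2)"
    unfolding force_def inner_prod_def inner_vec_def by (auto intro!: sum.cong simp: algebra_simps)
  ultimately show ?thesis
    by (simp add: sum.distrib flip: sum_divide_distrib)
qed

lemma dF_split: "dF b a = dF b (fst a, 0) + snd a * dF b (0, 1)"
proof -
  have "a = (fst a, 0) + snd a *\<^sub>R (0, 1)" by (simp add: prod_eq_iff)
  then show ?thesis using linear_add[OF linear_dF] linear_scale[OF linear_dF] by (metis real_scaleR_def)
qed

lemma metric_symmetric: "met s b v w = met s b w v"
  by (simp add: met_def inner_commute[of "snd v" "snd w"])

lemma bilinear_met: "bilinear (met s b)"
  unfolding bilinear_def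
  by (intro conjI allI linearI) (simp_all add: met_def inner_add_right inner_add_left algebra_simps)

lemma dmet_symmetric: "dmet s b \<beta> v w = dmet s b \<beta> w v"
  by (simp add: dmet_def)

context
  fixes U s assumes s: "unit_section P E U s"
begin

lemma has_derivative_conn_form:
  "tpt P b \<in> U \<Longrightarrow> (\<Phi> s has_derivative d\<Phi> s b) (at b)"
  by (rule smooth_on_has_derivative[OF smooth_on_conn_form[OF s]]) simp

lemma curvature_psi: "tpt P b \<in> U \<Longrightarrow> d\<Phi> s b a \<bullet> a' - d\<Phi> s b a' \<bullet> a = fst a $ j1 * snd a' - fst a' $ j1 * snd a"
  using conn_form_curvature[OF curvature s, of b a a'] by (simp add: psi_def)

text \<open>The curvature identity expresses the derivatives of the connection form along
  \<open>v\<close> and \<open>w\<close>, paired with \<open>e\<close>, through those along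
  \<open>e\<close>; these then cancel. The remainder psi supplies the constant unit vector in
  \<open>force\<close>.\<close>

lemma Koszul:
  assumes "tpt P b \<in> U"
  shows "2 * met s b (chr s b v w) e = dmet s b (snd v) w e + dmet s b (snd w) v e - dmet s b (snd e) v w"
proof -
  have "met s b (chr s b v w) e = (fibre_chr s b (snd v) (snd w) - snd (snd v) * snd (snd w) * (\<Phi> s b \<bullet> force b)) * snd (snd e)
      - snd (snd v) * snd (snd w) * (force b \<bullet> snd e)"
    by (simp add: met_def chr_def) (simp add: force_def algebra_simps)
  moreover have c: "d\<Phi> s b (snd v) \<bullet> snd e = d\<Phi> s b (snd e) \<bullet> snd v + (fst (snd v) $ j1 * snd (snd e) - fst (snd e) $ j1 * snd (snd v))"
    "d\<Phi> s b (snd w) \<bullet> snd e = d\<Phi> s b (snd e) \<bullet> snd w + (fst (snd w) $ j1 * snd (snd e) - fst (snd e) $ j1 * snd (snd w))"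
    using curvature_psi[OF assms, of "snd v" "snd e"] curvature_psi[OF assms, of "snd w" "snd e"] by linarith+
  ultimately show ?thesis
    by (simp only: fibre_chr_def dmet_def force_inner c dF_split[of b "snd e"]) (simp add: field_simps)
qed

lemma has_derivative_met:
  assumes "tpt P (snd u) \<in> U"
  shows "((\<lambda>u. met s (snd u) v w) has_derivative (\<lambda>\<beta>. dmet s (snd u) (snd \<beta>) v w)) (at u)"
proof -
  have dP: "((\<lambda>u. \<Phi> s (snd u)) has_derivative (\<lambda>\<beta>. d\<Phi> s (snd u) (snd \<beta>))) (at u)"
    by (rule has_derivative_compose[OF has_derivative_snd[OF has_derivative_ident] has_derivative_conn_form[OF assms]])
  have dF: "((\<lambda>u. F (snd u)) has_derivative (\<lambda>\<beta>. dF (snd u) (snd \<beta>))) (at u)"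
    by (rule has_derivative_compose[OF has_derivative_snd[OF has_derivative_ident] has_derivative_F])
  have "((\<lambda>u. met s (snd u) v w) has_derivative
      (\<lambda>\<beta>. (0 + d\<Phi> s (snd u) (snd \<beta>) \<bullet> snd v) * snd (snd w) + (0 + d\<Phi> s (snd u) (snd \<beta>) \<bullet> snd w) * snd (snd v)
         + dF (snd u) (snd \<beta>) * snd (snd v) * snd (snd w) + 0)) (at u)"
    unfolding met_def
    by (intro has_derivative_add has_derivative_mult_left has_derivative_const has_derivative_inner_left dP dF)
  then show ?thesis by (simp add: dmet_def)
qed

end

lemma metric_nondegenerate:
  assumes "\<And>e. met s b c e = 0" shows "c = 0"
proof -
  have z: "snd (snd c) = 0" using assms[of "(1, 0)"] by (simp add: met_def)
  have "fst (snd c) $ j = 0" for j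
  proof -
    have "snd c \<bullet> (axis j 1, 0) = fst (snd c) $ j" by (simp add: inner_prod_def inner_axis)
    then show ?thesis using assms[of "(0, axis j 1, 0)"] z by (simp add: met_def)
  qed
  then have y: "snd c = 0" using z by (simp add: prod_eq_iff vec_eq_iff)
  then have "fst c = 0" using assms[of "(0, 0, 1)"] by (simp add: met_def)
  with y show ?thesis by (simp add: prod_eq_iff)
qed

text \<open>Nondegeneracy of the metric makes the solution of the Koszul identity unique, which
  settles the definite description.\<close>

lemma christoffel_eq:
  assumes i: "(D, U, s) \<in> charts CB" and u: "u \<in> D"
  shows "christoffel G (D, U, s) u v w = chr s (snd u) v w"
proof -
  have s: "unit_section P E U s" and m: "tpt P (snd u) \<in> U" and oD: "open D"
    using i u by (auto simp: charts_circle_bundle)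
  have d: "frechet_derivative (\<lambda>u. G (D, U, s) u v w) (at u) e = dmet s (snd u) (snd e) v w" for v w e
    by (subst frechet_derivative_eqI[OF has_derivative_transform_within_open[OF has_derivative_met[OF s m, of v w] oD u]])
      (simp_all add: metric_eq[OF i])
  show ?thesis
    unfolding christoffel_def d metric_eq[OF i u]
  proof (rule the_equality)
    show "\<forall>e. 2 * met s (snd u) (chr s (snd u) v w) e = dmet s (snd u) (snd v) w e + dmet s (snd u) (snd w) v e - dmet s (snd u) (snd e) v w"
      using Koszul[OF s m] by blast
    fix c assume c: "\<forall>e. 2 * met s (snd u) c e = dmet s (snd u) (snd v) w e + dmet s (snd u) (snd w) v e - dmet s (snd u) (snd e) v w"
    have "met s (snd u) (c - chr s (snd u) v w) e = 0" for e
      using c Koszul[OF s m, of v w e] bilinear_lsub[OF bilinear_met, of s "snd u" c "chr s (snd u) v w" e]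
      by (metis eq_iff_diff_eq_0 mult_cancel_left zero_neq_numeral)
    then show "c = chr s (snd u) v w" using metric_nondegenerate by (metis eq_iff_diff_eq_0)
  qed
qed

section \<open>The Lorentzian manifold: compatibility of charts, smoothness, signature\<close>

lemma coord_transition_derivative:
  assumes i: "(D, U, s) \<in> charts CB" and j: "(D', U', s') \<in> charts CB"
    and u: "u \<in> D" "\<Psi> s u \<in> patch CB (D', U', s')"
  shows "frechet_derivative (coord CB (D', U', s') \<circ> \<Psi> s) (at u) v =
      (fst v + (\<Phi> s (snd u) - \<Phi> s' (snd (coord CB (D', U', s') (\<Psi> s u)))) \<bullet> snd v, snd v)"
  using frechet_derivative_eqI[OF coord_transition(2)[OF i j u]] by simp

lemma coord_base:
  assumes i: "(D, U, s) \<in> charts CB" and j: "(D', U', s') \<in> charts CB"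
    and u: "u \<in> D" "\<Psi> s u \<in> patch CB (D', U', s')"
  shows "tpt P (snd (coord CB (D', U', s') (\<Psi> s u))) = tpt P (snd u)"
proof -
  let ?v = "coord CB (D', U', s') (\<Psi> s u)"
  have v: "?v \<in> D'" "\<Psi> s' ?v = \<Psi> s u"
    using coord_in_cdom[OF u(2)] param_coord[OF u(2)] by auto
  obtain x b y c where e: "u = (x, b)" "?v = (y, c)" by (cases u, cases ?v)
  have "tpt P c = tpt P b"
  proof (rule bundle_param_fibre_eq)
    show "unit_section P E U' s'" "unit_section P E U s" using i j by (simp_all add: charts_circle_bundle)
    show "tpt P c \<in> U'" "tpt P b \<in> U" 
      using i j v(1)[unfolded e(2)] u(1)[unfolded e(1)] by (auto simp: charts_circle_bundle)
    show "\<Psi> s' (y, c) = \<Psi> s (x, b)" using v(2)[unfolded e(2)] unfolding e(1) .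
  qed
  then show ?thesis using e by simp
qed

lemma metric_compatible:
  assumes i: "(D, U, s) \<in> charts CB" and j: "(D', U', s') \<in> charts CB"
    and u: "u \<in> D" "\<Psi> s u \<in> patch CB (D', U', s')"
  defines "d \<equiv> frechet_derivative (coord CB (D', U', s') \<circ> \<Psi> s) (at u)"
  shows "G (D, U, s) u v w = G (D', U', s') (coord CB (D', U', s') (\<Psi> s u)) (d v) (d w)"
proof -
  let ?v = "coord CB (D', U', s') (\<Psi> s u)"
  have "?v \<in> D'" using coord_in_cdom[OF u(2)] by simp
  then show ?thesis
    using F_cong[OF coord_base[OF i j u]]
    by (simp add: metric_eq[OF i u(1)] metric_eq[OF j] d_def coord_transition_derivative[OF i j u] met_def inner_diff_left algebra_simps)
qed

lemma smooth_on_metric: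
  assumes i: "(D, U, s) \<in> charts CB"
  shows "smooth_on D (\<lambda>u. G (D, U, s) u v w)"
proof -
  have s: "unit_section P E U s" and oD: "open D" and DU: "\<And>u. u \<in> D \<Longrightarrow> snd u \<in> tpt P -` U"
    using i by (auto simp: charts_circle_bundle)
  have snd: "smooth_on D snd" by (rule smooth_on_linear[OF oD bounded_linear_snd])
  have P: "smooth_on D (\<lambda>u. \<Phi> s (snd u))"
    by (rule smooth_on_compose[OF oD unit_sectionD(2)[OF s] DU snd smooth_on_conn_form[OF s]])
  have F: "smooth_on D (\<lambda>u. F (snd u))"
    by (rule smooth_on_compose[OF oD open_UNIV UNIV_I snd smooth_F])
  have "smooth_on D (\<lambda>u. met s (snd u) v w)" unfolding met_def
    by (intro smooth_on_add[OF oD] smooth_on_mult[OF oD] smooth_on_const smooth_on_inner[OF oD] P F)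
  then show ?thesis by (rule smooth_on_cong[OF oD, rotated]) (simp add: metric_eq[OF i])
qed

text \<open>The first entry is forced by nullity: a vector over the field of z has square 2 theta +
  F + 1, where 1 is its square in the flat metric, so theta has to be
  \<open>- (F b + 1) / 2\<close>.\<close>

definition null_frame :: "(((real^'n) \<times> real) set \<Rightarrow> 'v) \<Rightarrow> (real^'n) \<times> real \<Rightarrow> real \<times> (real^'n) \<times> real" where
  "null_frame s b = (- (\<Phi> s b \<bullet> (0, 1)) - (F b + 1) / 2, 0, 1)"

text \<open>The lift of a coordinate field of y that lies in the kernel of theta.\<close>

definition horizontal :: "(((real^'n) \<times> real) set \<Rightarrow> 'v) \<Rightarrow> (real^'n) \<times> real \<Rightarrow> 'n \<Rightarrow> real \<times> (real^'n) \<times> real" where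
  "horizontal s b j = (- (\<Phi> s b \<bullet> (axis j 1, 0)), axis j 1, 0)"

lemma frame_products:
  "met s b (1, 0) (1, 0) = 0" "met s b (null_frame s b) (null_frame s b) = 0" "met s b (1, 0) (null_frame s b) = 1"
  "met s b (1, 0) (horizontal s b j) = 0" "met s b (null_frame s b) (horizontal s b j) = 0"
  "met s b (horizontal s b j) (horizontal s b k) = (if j = k then 1 else 0)"
proof -
  show "met s b (null_frame s b) (null_frame s b) = 0"
    by (simp add: met_def null_frame_def field_simps)
  show "met s b (horizontal s b j) (horizontal s b k) = (if j = k then 1 else 0)"
    by (simp add: met_def horizontal_def inner_axis_axis)
qed (simp_all add: met_def null_frame_def horizontal_def)

lemma frame_span: "v = (fst v + \<Phi> s b \<bullet> snd v + snd (snd v) * (F b + 1) / 2) *\<^sub>R (1, 0)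
    + (\<Sum>j\<in>UNIV. (fst (snd v) $ j) *\<^sub>R horizontal s b j) + snd (snd v) *\<^sub>R null_frame s b"
proof -
  have y: "(\<Sum>j\<in>UNIV. (fst (snd v) $ j) *\<^sub>R axis j 1) = fst (snd v)"
    by (simp add: vec_eq_iff axis_def if_distrib sum.delta cong: if_cong)
  have "snd v = (fst (snd v), 0) + snd (snd v) *\<^sub>R (0, 1)" by (simp add: prod_eq_iff)
  then have "\<Phi> s b \<bullet> snd v = \<Phi> s b \<bullet> (\<Sum>j\<in>UNIV. (fst (snd v) $ j) *\<^sub>R axis j 1, 0) + snd (snd v) * (\<Phi> s b \<bullet> (0, 1))"
    unfolding y by (metis inner_add_right inner_scaleR_right)
  moreover have "(\<Sum>j\<in>UNIV. (fst (snd v) $ j) *\<^sub>R axis j (1::real), 0::real) = (\<Sum>j\<in>UNIV. (fst (snd v) $ j) *\<^sub>R (axis j 1, 0))"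
    by (simp add: prod_eq_iff fst_sum snd_sum)
  ultimately have "\<Phi> s b \<bullet> snd v = (\<Sum>j\<in>UNIV. (fst (snd v) $ j) * (\<Phi> s b \<bullet> (axis j 1, 0))) + snd (snd v) * (\<Phi> s b \<bullet> (0, 1))"
    by (simp only: inner_sum_right inner_scaleR_right)
  then show ?thesis
    by (simp add: prod_eq_iff fst_sum snd_sum horizontal_def null_frame_def y sum_negf algebra_simps add_divide_distrib)
qed

lemma lorentz_form_met: "lorentz_form (met s b)"
  unfolding lorentz_form_def
proof (intro conjI allI exI bexI ballI)
  show "bilinear (met s b)" by (rule bilinear_met)
  show "met s b v w = met s b w v" for v w by (rule metric_symmetric)
  let ?e0 = "(1, 0) :: real \<times> (real^'n) \<times> real"
  \<comment> \<open>The null vectors \<open>(1, 0)\<close> and \<open>null_frame s b\<close> have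
    product 1, so their combinations with factors -1/2 and 1/2 are orthogonal with squares -1 and
    1.\<close>
  let ?t = "null_frame s b - (1/2) *\<^sub>R (1, 0)" and ?z = "null_frame s b + (1/2) *\<^sub>R (1, 0)"
  \<comment> \<open>Elements of \<open>Basis\<close> serve as mere labels for the orthonormal frame:
    \<open>?e0\<close> labels the timelike vector although \<open>?e0\<close> itself is
    null.\<close>
  define B where "B v = (if v = ?e0 then ?t else if v = (0, 0, 1) then ?z else horizontal s b (SOME j. v = (0, axis j 1, 0)))"
    for v :: "real \<times> (real^'n) \<times> real"
  have Bh: "B (0, axis j 1, 0) = horizontal s b j" for j
  proof -
    have "(SOME j'. (0::real, axis j 1, 0::real) = (0, axis j' (1::real), 0)) = j"
      by (rule some_equality) (auto simp: axis_eq_axis)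
    then show ?thesis by (simp add: B_def)
  qed
  note lin = bilinear_ladd[OF bilinear_met] bilinear_radd[OF bilinear_met] bilinear_lsub[OF bilinear_met]
    bilinear_rsub[OF bilinear_met] bilinear_lmul[OF bilinear_met] bilinear_rmul[OF bilinear_met]
  note fp = frame_products[of s b] frame_products(3,4,5)[of s b, unfolded metric_symmetric[of s b "(1, 0)"] metric_symmetric[of s b "null_frame s b" "horizontal s b j" for j]]
  show "?e0 \<in> Basis" by (auto simp: Basis_prod_def)
  have cases: "v = ?e0 \<or> v = (0, 0, 1) \<or> (\<exists>j. v = (0, axis j 1, 0))"
    if "v \<in> Basis" for v :: "real \<times> (real^'n) \<times> real"
    using that by (auto simp: Basis_prod_def Basis_vec_def)
  have sym: "met s b (null_frame s b) (1, 0) = 1" "met s b (horizontal s b j) (1, 0) = 0"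
     "met s b (horizontal s b j) (null_frame s b) = 0" for j
    using frame_products(3,4,5) metric_symmetric by metis+
  show "met s b (B v) (B w) = (if v \<noteq> w then 0 else if v = ?e0 then - 1 else 1)"
    if vw: "v \<in> Basis" "w \<in> Basis" for v w
  proof -
    have B0: "B ?e0 = ?t" "B (0, 0, 1) = ?z" by (simp_all add: B_def)
    have "axis j (1::real) \<noteq> 0" for j :: 'n by (simp add: axis_eq_0_iff)
    then show ?thesis
      using cases[OF vw(1)] cases[OF vw(2)]
      by (elim disjE exE) (simp_all add: Bh B0 lin frame_products sym axis_eq_axis del: scaleR_Pair)
  qed
qed

lemma lorentzian_manifold_CB: "lorentzian_manifold CB G"
  unfolding lorentzian_manifold_def
proof (intro conjI ballI allI impI)
  show "smooth_manifold CB" by (rule smooth_manifold_CB)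
next
  fix i u assume "i \<in> charts CB" "u \<in> cdom CB i"
  then obtain D U s where i: "i = (D, U, s)" "(D, U, s) \<in> charts CB" "u \<in> D" by (cases i) auto
  have "G i u = met s (snd u)" using metric_eq[OF i(2,3)] i(1) by (simp add: fun_eq_iff)
  then show "lorentz_form (G i u)" using lorentz_form_met by simp
next
  fix i a b assume "i \<in> charts CB"
  then show "smooth_on (cdom CB i) (\<lambda>u. G i u a b)"
    using smooth_on_metric by (cases i) auto
next
  fix i j u assume ij: "i \<in> charts CB" "j \<in> charts CB" and u: "u \<in> cdom CB i" "param CB i u \<in> patch CB j"
  then show "let d = frechet_derivative (coord CB j \<circ> param CB i) (at u)
         in \<forall>a b. G i u a b = G j (coord CB j (param CB i u)) (d a) (d b)"
    unfolding Let_def using metric_compatible by (cases i, cases j) auto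
qed

end

section \<open>Lie algebras of translations\<close>

lemma has_vector_derivative_quadratic_remainder:
  fixes g :: "real \<Rightarrow> 'a::real_normed_vector"
  assumes "\<And>t. \<bar>t\<bar> \<le> 1 \<Longrightarrow> norm (g t - g 0 - t *\<^sub>R v) \<le> C * t\<^sup>2" 
  shows "(g has_vector_derivative v) (at 0)"
  unfolding has_vector_derivative_def has_derivative_at_alt
proof (intro conjI allI impI)
  show "bounded_linear (\<lambda>t. t *\<^sub>R v)" by (rule bounded_linear_scaleR_left)
  fix e :: real assume e: "e > 0"
  define d where "d = min 1 (e / (\<bar>C\<bar> + 1))"
  have d: "d > 0" using e by (simp add: d_def)
  have "norm (g t - g 0 - (t - 0) *\<^sub>R v) \<le> e * norm (t - 0)" if t: "norm (t - 0) < d" for t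
  proof -
    have "\<bar>C\<bar> * \<bar>t\<bar> \<le> (\<bar>C\<bar> + 1) * (e / (\<bar>C\<bar> + 1))"
      using t by (intro mult_mono) (auto simp: d_def)
    then have ct: "\<bar>C\<bar> * \<bar>t\<bar> \<le> e" by simp
    have "norm (g t - g 0 - t *\<^sub>R v) \<le> C * t\<^sup>2" using assms[of t] t by (simp add: d_def)
    also have "\<dots> \<le> \<bar>C\<bar> * t\<^sup>2" by (intro mult_right_mono) auto
    also have "\<dots> = (\<bar>C\<bar> * \<bar>t\<bar>) * \<bar>t\<bar>" by (simp add: power2_eq_square abs_mult_self_eq)
    also have "\<dots> \<le> e * \<bar>t\<bar>" using ct by (intro mult_right_mono) auto
    finally show ?thesis by simp
  qed
  with d show "\<exists>d>0. \<forall>t. norm (t - 0) < d \<longrightarrow> norm (g t - g 0 - (t - 0) *\<^sub>R v) \<le> e * norm (t - 0)"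
    by blast
qed

lemma funpow_scaleR:
  fixes T :: "'e::real_vector \<Rightarrow> 'e"
  assumes "linear T"
  shows "((\<lambda>x. t *\<^sub>R T x) ^^ k) x = t ^ k *\<^sub>R (T ^^ k) x"
  by (induction k) (simp_all add: linear_scale[OF assms] mult.commute)

text \<open>Only the first order at \<open>0\<close> matters, so a direct estimate suffices: for
  \<open>\<bar>t\<bar> \<le> 1\<close> the terms of degree at least 2 are bounded by
  \<open>t\<^sup>2\<close> times an exponential series in the norm bound \<open>K\<close>.\<close>

lemma lin_exp_derivative:
  fixes T :: "'e::euclidean_space \<Rightarrow> 'e"
  assumes T: "linear T"
  shows "((\<lambda>t. lin_exp (\<lambda>x. t *\<^sub>R T x) x) has_vector_derivative T x) (at 0)"
    and "lin_exp (\<lambda>x. 0 *\<^sub>R T x) x = x"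
proof -
  obtain K where K: "K > 0" "\<And>y. norm (T y) \<le> K * norm y"
    using linear_bounded_pos[OF T] by blast
  have pw: "norm ((T ^^ k) x) \<le> K ^ k * norm x" for k
  proof (induction k)
    case (Suc k)
    have "norm ((T ^^ Suc k) x) \<le> K * norm ((T ^^ k) x)" using K(2) by simp
    also have "\<dots> \<le> K * (K ^ k * norm x)" using Suc K(1) by (intro mult_left_mono) auto
    finally show ?case by (simp add: mult.assoc)
  qed simp
  define a where "a k = (K ^ k * norm x) / fact k" for k
  have sa: "summable a"
  proof -
    have "summable (\<lambda>k. inverse (fact k) * K ^ k)" by (rule summable_exp)
    then have "summable (\<lambda>k. norm x * (inverse (fact k) * K ^ k))" by (rule summable_mult)
    then show ?thesis by (simp add: a_def[abs_def] field_simps)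
  qed
  define g where "g t = lin_exp (\<lambda>x. t *\<^sub>R T x) x" for t
  define h where "h t k = (t ^ k / fact k) *\<^sub>R (T ^^ k) x" for t k
  have g: "g t = suminf (h t)" for t
    by (simp add: g_def lin_exp_def h_def[abs_def] funpow_scaleR[OF T] divide_inverse mult.commute)
  have hb: "norm (h t k) \<le> \<bar>t\<bar> ^ k * a k" for t k
  proof -
    have "norm (h t k) = \<bar>t\<bar> ^ k / fact k * norm ((T ^^ k) x)" by (simp add: h_def power_abs)
    also have "\<dots> \<le> \<bar>t\<bar> ^ k / fact k * (K ^ k * norm x)" by (intro mult_left_mono pw) auto
    finally show ?thesis by (simp add: a_def)
  qed
  have a0: "a k \<ge> 0" for k using K(1) by (simp add: a_def)
  have sh: "summable (h t)" if t: "\<bar>t\<bar> \<le> 1" for t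
  proof (rule summable_comparison_test'[OF sa])
    fix k :: nat assume "0 \<le> k"
    have "\<bar>t\<bar> ^ k * a k \<le> 1 * a k" using t a0 by (intro mult_right_mono power_le_one) auto
    then show "norm (h t k) \<le> a k" using hb[of t k] by simp
  qed
  have split: "g t = x + t *\<^sub>R T x + suminf (\<lambda>k. h t (k + 2))" if "\<bar>t\<bar> \<le> 1" for t
    using suminf_split_initial_segment[OF sh[OF that], of 2] by (simp add: g h_def numeral_2_eq_2)
  have g0: "g 0 = x" using split[of 0] by (simp add: h_def)
  then show "lin_exp (\<lambda>x. 0 *\<^sub>R T x) x = x" by (simp add: g_def)
  have "norm (g t - g 0 - t *\<^sub>R T x) \<le> suminf a * t\<^sup>2" if t: "\<bar>t\<bar> \<le> 1" for t
  proof -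
    have bound: "norm (h t (k + 2)) \<le> t\<^sup>2 * a (k + 2)" for k
    proof -
      have "\<bar>t\<bar> ^ (k + 2) * a (k + 2) = (\<bar>t\<bar> ^ k * t\<^sup>2) * a (k + 2)" by (simp add: power_add power2_eq_square)
      also have "\<dots> \<le> (1 * t\<^sup>2) * a (k + 2)"
        using t a0 by (intro mult_right_mono power_le_one) auto
      finally show ?thesis using hb[of t "k + 2"] by simp
    qed
    have sa2: "summable (\<lambda>k. a (k + 2))" using sa summable_iff_shift[of a 2] by blast
    have "norm (suminf (\<lambda>k. h t (k + 2))) \<le> suminf (\<lambda>k. t\<^sup>2 * a (k + 2))"
      by (rule norm_suminf_le[OF bound summable_mult[OF sa2]])
    also have "\<dots> = t\<^sup>2 * suminf (\<lambda>k. a (k + 2))" by (rule suminf_mult[OF sa2])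
    also have "\<dots> \<le> t\<^sup>2 * suminf a"
    proof (rule mult_left_mono)
      have "suminf a = suminf (\<lambda>k. a (k + 2)) + (\<Sum>k<2. a k)" by (rule suminf_split_initial_segment[OF sa])
      moreover have "(\<Sum>k<2. a k) \<ge> 0" using a0 by (intro sum_nonneg) auto
      ultimately show "suminf (\<lambda>k. a (k + 2)) \<le> suminf a" by linarith
    qed auto
    finally show ?thesis using split[OF t] g0 by (simp add: mult.commute)
  qed
  from has_vector_derivative_quadratic_remainder[OF this]
  show "((\<lambda>t. lin_exp (\<lambda>x. t *\<^sub>R T x) x) has_vector_derivative T x) (at 0)" by (simp add: g_def)
qed

text \<open>The element of \<open>\<real>\<^sup>n \<subset> so(n) \<ltimes> \<real>\<^sup>n\<close> with translation part \<open>w\<close>.\<close>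

definition nil_op :: "nat \<Rightarrow> ('e::euclidean_space \<Rightarrow> 'e \<Rightarrow> real) \<Rightarrow> 'e \<Rightarrow> (nat \<Rightarrow> 'e) \<Rightarrow> (nat \<Rightarrow> real) \<Rightarrow> 'e \<Rightarrow> 'e" where
  "nil_op n B v e w x = (\<Sum>i<n. w i * B x (e i)) *\<^sub>R v - B x v *\<^sub>R (\<Sum>i<n. w i *\<^sub>R e i)"

section \<open>Nilpotent translations in an adapted basis\<close>

locale adapted =
  fixes n :: nat and B :: "'e::euclidean_space \<Rightarrow> 'e \<Rightarrow> real" and v e w0
  assumes bil: "bilinear B" and B_sym: "B x y = B y x" and basis: "adapted_basis n B v e w0"
begin

lemma products:
  "B v v = 0" "B w0 w0 = 0" "B v w0 = 1" "B w0 v = 1"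
  "i < n \<Longrightarrow> B v (e i) = 0" "i < n \<Longrightarrow> B (e i) v = 0" "i < n \<Longrightarrow> B w0 (e i) = 0" "i < n \<Longrightarrow> B (e i) w0 = 0"
  "i < n \<Longrightarrow> j < n \<Longrightarrow> B (e i) (e j) = (if i = j then 1 else 0)"
proof -
  from basis have b: "B v v = 0" "B w0 w0 = 0" "B v w0 = 1" "\<forall>i<n. B v (e i) = 0 \<and> B w0 (e i) = 0"
     "\<forall>i<n. \<forall>j<n. B (e i) (e j) = (if i = j then 1 else 0)"
    unfolding adapted_basis_def by blast+
  then show "B v v = 0" "B w0 w0 = 0" "B v w0 = 1" "i < n \<Longrightarrow> B v (e i) = 0" "i < n \<Longrightarrow> B w0 (e i) = 0"
    "i < n \<Longrightarrow> j < n \<Longrightarrow> B (e i) (e j) = (if i = j then 1 else 0)"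
    by simp_all
  show "B w0 v = 1" using b B_sym[of w0 v] by simp
  show "i < n \<Longrightarrow> B (e i) v = 0" "i < n \<Longrightarrow> B (e i) w0 = 0"
    using b B_sym[of "e i" v] B_sym[of "e i" w0] by simp_all
qed

lemmas B_lin = bilinear_ladd[OF bil] bilinear_radd[OF bil] bilinear_lmul[OF bil] bilinear_rmul[OF bil]
  bilinear_lneg[OF bil] bilinear_rneg[OF bil] bilinear_lsub[OF bil] bilinear_rsub[OF bil]
  bilinear_lzero[OF bil] bilinear_rzero[OF bil]

lemma linear_B_left: "linear (\<lambda>x. B x y)" and linear_B_right: "linear (B x)"
  using bil by (simp_all add: bilinear_def)

lemma B_sum_left: "B (\<Sum>i\<in>I. g i) y = (\<Sum>i\<in>I. B (g i) y)"
  using linear_sum[OF linear_B_left] .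

lemma B_sum_right: "B x (\<Sum>i\<in>I. g i) = (\<Sum>i\<in>I. B x (g i))"
  using linear_sum[OF linear_B_right] .

lemma linear_eq_on_basis:
  assumes "linear S" "linear T" "S v = T v" "S w0 = T w0" "\<And>i. i < n \<Longrightarrow> S (e i) = T (e i)"
  shows "S = T"
proof
  fix x
  have sp: "x \<in> span ({v, w0} \<union> e ` {..<n})" 
    using basis unfolding adapted_basis_def by (elim conjE) (simp only: UNIV_I)
  show "S x = T x"
    by (rule linear_eq_on[OF assms(1,2) sp]) (use assms(3-5) in auto)
qed

text \<open>The basis is its own dual up to exchanging the two null vectors; this is why the
  coefficient of \<open>v\<close> is read off with \<open>w0\<close> and conversely.\<close>

lemma expansion: "x = B x w0 *\<^sub>R v + (\<Sum>i<n. B x (e i) *\<^sub>R e i) + B x v *\<^sub>R w0"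
proof -
  have delta: "(\<Sum>i<n. B (e j) (e i) *\<^sub>R e i) = e j" if "j < n" for j
  proof -
    have "(\<Sum>i<n. B (e j) (e i) *\<^sub>R e i) = (\<Sum>i<n. if i = j then e j else 0)"
      using that by (intro sum.cong) (auto simp: products)
    then show ?thesis using that by simp
  qed
  have "(\<lambda>x. x) = (\<lambda>x. B x w0 *\<^sub>R v + (\<Sum>i<n. B x (e i) *\<^sub>R e i) + B x v *\<^sub>R w0)"
  proof (rule linear_eq_on_basis)
    show "linear (\<lambda>x. B x w0 *\<^sub>R v + (\<Sum>i<n. B x (e i) *\<^sub>R e i) + B x v *\<^sub>R w0)"
      by (rule linearI) (simp_all add: B_lin scaleR_add_left sum.distrib scaleR_right.sum algebra_simps)
  qed (simp_all add: products(1-8) delta linear_ident)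
  then show ?thesis by metis
qed

lemma combination_eq_iff:
  "(\<Sum>i<n. w i *\<^sub>R e i) = (\<Sum>i<n. w' i *\<^sub>R e i) \<longleftrightarrow> (\<forall>i<n. w i = w' i)"
proof
  assume eq: "(\<Sum>i<n. w i *\<^sub>R e i) = (\<Sum>i<n. w' i *\<^sub>R e i)"
  have c: "B (\<Sum>i<n. w i *\<^sub>R e i) (e j) = w j" if "j < n" for w j
    using that by (simp add: B_sum_left B_lin products if_distrib sum.delta cong: if_cong)
  show "\<forall>i<n. w i = w' i" using c[of _ w] c[of _ w'] eq by metis
qed simp

lemma B_combination: "(\<Sum>i<n. w i * B x (e i)) = B x (\<Sum>i<n. w i *\<^sub>R e i)"
  by (simp add: B_sum_right B_lin)

lemma linear_nil_op: "linear (nil_op n B v e w)"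
proof (rule linearI)
  have alt: "nil_op n B v e w x = B x (\<Sum>i<n. w i *\<^sub>R e i) *\<^sub>R v - B x v *\<^sub>R (\<Sum>i<n. w i *\<^sub>R e i)" for x
    by (simp only: nil_op_def B_combination)
  show "nil_op n B v e w (x + y) = nil_op n B v e w x + nil_op n B v e w y"
    and "nil_op n B v e w (c *\<^sub>R x) = c *\<^sub>R nil_op n B v e w x" for x y c
    unfolding alt by (simp_all add: B_lin algebra_simps)
qed

lemma nil_op_basis:
  "nil_op n B v e w v = 0" "i < n \<Longrightarrow> nil_op n B v e w (e i) = w i *\<^sub>R v"
  "nil_op n B v e w w0 = - (\<Sum>i<n. w i *\<^sub>R e i)"
  by (simp_all add: nil_op_def products if_distrib sum.delta cong: if_cong)

lemma has_matrix_nil_iff: "has_matrix n v e w0 T 0 (\<lambda>_ _. 0) w \<longleftrightarrow> T = nil_op n B v e w"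
proof
  assume T: "has_matrix n v e w0 T 0 (\<lambda>_ _. 0) w"
  show "T = nil_op n B v e w"
    by (rule linear_eq_on_basis[OF _ linear_nil_op])
      (use T in \<open>auto simp: nil_op_basis has_matrix_def\<close>)
next
  assume "T = nil_op n B v e w"
  then show "has_matrix n v e w0 T 0 (\<lambda>_ _. 0) w"
    using linear_nil_op by (simp add: has_matrix_def nil_op_basis)
qed

text \<open>The product maps into the line of \<open>v\<close> and is symmetric in \<open>w\<close>
  and \<open>w'\<close>: such operators commute, and a third factor annihilates the result.\<close>

lemma nil_op_nil_op: "nil_op n B v e w' (nil_op n B v e w x) = - (B x v * (\<Sum>i<n. w' i * w i)) *\<^sub>R v"
proof -
  have "B (nil_op n B v e w x) (e i) = - B x v * w i" if "i < n" for i
    using that by (simp add: nil_op_def B_lin products B_sum_left if_distrib sum.delta cong: if_cong)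
  then have "(\<Sum>i<n. w' i * B (nil_op n B v e w x) (e i)) = - (B x v * (\<Sum>i<n. w' i * w i))"
    by (simp add: sum_distrib_left sum_negf mult.left_commute mult.commute)
  moreover have "B (nil_op n B v e w x) v = 0"
    by (simp add: nil_op_def B_lin products B_sum_left)
  ultimately show ?thesis by (simp add: nil_op_def[of n B v e w'])
qed

lemma nil_op_scale: "t *\<^sub>R nil_op n B v e w x = nil_op n B v e (\<lambda>i. t * w i) x"
  by (simp add: nil_op_def algebra_simps scaleR_right.sum sum_distrib_left)

lemma nil_op_add: "nil_op n B v e (\<lambda>i. w i + w' i) x = nil_op n B v e w x + nil_op n B v e w' x"
  by (simp add: nil_op_def algebra_simps sum.distrib)

text \<open>The cube of the operator vanishes, so the exponential series stops after the quadratic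
  term.\<close>

lemma lin_exp_nil_op:
  "lin_exp (nil_op n B v e w) x = x + nil_op n B v e w x - (B x v * (\<Sum>i<n. w i * w i) / 2) *\<^sub>R v"
proof -
  let ?T = "nil_op n B v e w"
  have T2: "?T (?T x) = - (B x v * (\<Sum>i<n. w i * w i)) *\<^sub>R v" by (rule nil_op_nil_op)
  have T3: "?T (?T (?T x)) = 0"
    unfolding T2 by (simp add: linear_scale[OF linear_nil_op] linear_neg[OF linear_nil_op] nil_op_basis)
  have z: "(?T ^^ (k + 3)) x = 0" for k
  proof (induction k)
    case 0 then show ?case by (simp add: numeral_3_eq_3 T3)
  next
    case (Suc k)
    have "(?T ^^ (Suc k + 3)) x = ?T ((?T ^^ (k + 3)) x)" by (simp only: add_Suc funpow.simps comp_apply)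
    then show ?case by (simp only: Suc linear_0[OF linear_nil_op])
  qed
  have "lin_exp ?T x = (\<Sum>k<3. (?T ^^ k) x /\<^sub>R fact k)"
    unfolding lin_exp_def
  proof (rule suminf_finite)
    fix k assume "k \<notin> {..<3::nat}"
    then have "k = (k - 3) + 3" by simp
    then have "(?T ^^ k) x = 0" using z by metis
    then show "(?T ^^ k) x /\<^sub>R fact k = 0" by simp
  qed simp
  also have "\<dots> = x + ?T x + ?T (?T x) /\<^sub>R 2"
    by (simp add: numeral_3_eq_3 numeral_2_eq_2)
  finally show ?thesis by (simp add: T2)
qed

text \<open>Exponentials of commuting operators multiply. This is the bridge from a group closed
  under composition to a Lie algebra closed under addition.\<close>

lemma lin_exp_nil_op_add:
  "lin_exp (nil_op n B v e (\<lambda>i. w i + w' i)) = lin_exp (nil_op n B v e w) \<circ> lin_exp (nil_op n B v e w')"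
proof
  fix x
  let ?T = "nil_op n B v e w" and ?T' = "nil_op n B v e w'"
  have "B (lin_exp ?T' x) v = B x v"
    by (simp add: lin_exp_nil_op B_lin products nil_op_def B_sum_left)
  moreover have "?T (lin_exp ?T' x) = ?T x - (B x v * (\<Sum>i<n. w i * w' i)) *\<^sub>R v"
    by (simp add: lin_exp_nil_op[of w'] linear_add[OF linear_nil_op] linear_diff[OF linear_nil_op]
      linear_scale[OF linear_nil_op] nil_op_nil_op nil_op_basis)
  ultimately have "lin_exp ?T (lin_exp ?T' x) = x + ?T' x - (B x v * (\<Sum>i<n. w' i * w' i) / 2) *\<^sub>R v
      + (?T x - (B x v * (\<Sum>i<n. w i * w' i)) *\<^sub>R v) - (B x v * (\<Sum>i<n. w i * w i) / 2) *\<^sub>R v"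
    unfolding lin_exp_nil_op[of w "lin_exp ?T' x"] by (simp add: lin_exp_nil_op[of w'])
  moreover have "(\<Sum>i<n. (w i + w' i) * (w i + w' i)) = (\<Sum>i<n. w i * w i) + 2 * (\<Sum>i<n. w i * w' i) + (\<Sum>i<n. w' i * w' i)"
    by (simp add: algebra_simps sum.distrib sum_distrib_left)
  ultimately show "lin_exp (nil_op n B v e (\<lambda>i. w i + w' i)) x = (lin_exp ?T \<circ> lin_exp ?T') x"
    by (simp add: lin_exp_nil_op[of "\<lambda>i. w i + w' i"] nil_op_add algebra_simps add_divide_distrib)
qed

text \<open>The holonomy transformations turn out to be of this kind.\<close>

definition screen_trivial :: "('e \<Rightarrow> 'e) \<Rightarrow> bool" where
  "screen_trivial L \<longleftrightarrow> (\<forall>x y. B (L x) (L y) = B x y) \<and> (\<forall>x. B (L x) v = B x v) \<and>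
     (\<forall>x i. B x v = 0 \<longrightarrow> i < n \<longrightarrow> B (L x) (e i) = B x (e i))"

text \<open>The three invariances, differentiated along the one-parameter group at time
  \<open>0\<close>, say that \<open>T\<close> is skew, has image orthogonal to \<open>v\<close>, and
  acts by zero on the screen space. Only the entries \<open>B (T (e i)) w0\<close> remain
  free.\<close>

lemma lie_algebra_of_screen_trivial:
  assumes H: "\<And>L. L \<in> H \<Longrightarrow> screen_trivial L" and T: "T \<in> lie_algebra_of H"
  shows "\<exists>w. T = nil_op n B v e w"
proof -
  have lin: "linear T" and st: "screen_trivial (lin_exp (\<lambda>x. t *\<^sub>R T x))" for t
    using T H by (auto simp: lie_algebra_of_def)
  have bb: "bounded_bilinear B" using bil by (simp add: bilinear_conv_bounded_bilinear)
  let ?L = "\<lambda>t. lin_exp (\<lambda>x. t *\<^sub>R T x)"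
  note d = lin_exp_derivative[OF lin]
  have zero: "D = 0" if "(g has_vector_derivative D) (at 0)" "\<And>t. g t = g 0" for g :: "real \<Rightarrow> real" and D
  proof -
    have "g = (\<lambda>_. g 0)" using that(2) by blast
    then have "(g has_vector_derivative 0) (at 0)" using has_vector_derivative_const by metis
    then show ?thesis using that(1) vector_derivative_unique_at by blast
  qed
  have Bd: "((\<lambda>t. B (?L t x) y) has_vector_derivative B (T x) y) (at 0)" for x y
    using bounded_linear.has_vector_derivative[OF bounded_bilinear.bounded_linear_left[OF bb] d(1)] .
  have skew: "B (T x) y + B x (T y) = 0" for x y
  proof -
    have "((\<lambda>t. B (?L t x) (?L t y)) has_vector_derivative (B (?L 0 x) (T y) + B (T x) (?L 0 y))) (at 0)"
      by (rule bounded_bilinear.has_vector_derivative[OF bb d(1) d(1)])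
    from zero[OF this] st d(2) show ?thesis unfolding screen_trivial_def by (metis add.commute)
  qed
  have v: "B (T x) v = 0" for x
    using zero[OF Bd, of x v] st unfolding screen_trivial_def by metis
  have s: "B (T x) (e i) = 0" if "B x v = 0" "i < n" for x i
    using zero[OF Bd, of x "e i"] st that unfolding screen_trivial_def by metis
  define w where "w i = B (T (e i)) w0" for i
  have "T = nil_op n B v e w"
  proof (rule linear_eq_on_basis[OF lin linear_nil_op])
    \<comment> \<open>Skewness exchanges this entry with \<open>B (T w0) v\<close>, which vanishes
      because the image of \<open>T\<close> is orthogonal to \<open>v\<close>.\<close>
    have "B (T v) w0 = 0" using skew[of v w0] v[of w0] B_sym[of v "T w0"] by simp
    then show "T v = nil_op n B v e w v"
      using expansion[of "T v"] v[of v] s[of v] by (simp add: products nil_op_basis)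
    show "T (e i) = nil_op n B v e w (e i)" if "i < n" for i
      using expansion[of "T (e i)"] v[of "e i"] s[of "e i"] that by (simp add: products nil_op_basis w_def)
    have "B (T w0) w0 = 0" using skew[of w0 w0] B_sym[of "T w0" w0] by simp
    moreover have "B (T w0) (e i) = - w i" if "i < n" for i
      using skew[of w0 "e i"] B_sym[of w0 "T (e i)"] by (simp add: w_def)
    ultimately show "T w0 = nil_op n B v e w w0"
      using expansion[of "T w0"] v[of w0] by (simp add: nil_op_basis sum_negf)
  qed
  then show ?thesis by blast
qed

text \<open>Composition in \<open>H\<close> provides sums and a change of parameter provides
  multiples, so the translation parts form a linear subspace; a complement of it would violate
  indecomposability.\<close>

lemma lie_algebra_of_indecomposable:
  assumes n: "0 < n" and H: "\<And>L. L \<in> H \<Longrightarrow> screen_trivial L" and comp: "\<And>L L'. L \<in> H \<Longrightarrow> L' \<in> H \<Longrightarrow> L \<circ> L' \<in> H"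
    and ind: "indecomposable B (lie_algebra_of H)"
  shows "lie_algebra_of H = {T. \<exists>w. has_matrix n v e w0 T 0 (\<lambda>_ _. 0) w}"
proof -
  let ?h = "lie_algebra_of H" and ?N = "nil_op n B v e"
  define z where "z w = (\<Sum>i<n. w i *\<^sub>R e i)" for w
  \<comment> \<open>\<open>0\<close> is inserted so that \<open>S\<close> is a subspace before the
    algebra is known to have an element; that follows at the end from
    \<open>e 0 \<in> S\<close>.\<close>
  define S where "S = insert 0 {z w | w. ?N w \<in> ?h}"
  have scale: "?N (\<lambda>i. c * w i) \<in> ?h" if "?N w \<in> ?h" for c w
  proof -
    have "lin_exp (\<lambda>x. t *\<^sub>R ?N (\<lambda>i. c * w i) x) \<in> H" for t
    proof -
      have "(\<lambda>x. t *\<^sub>R ?N (\<lambda>i. c * w i) x) = (\<lambda>x. (t * c) *\<^sub>R ?N w x)"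
        by (simp add: nil_op_scale[symmetric])
      then show ?thesis using that by (simp add: lie_algebra_of_def)
    qed
    then show ?thesis using linear_nil_op by (simp add: lie_algebra_of_def)
  qed
  have add: "?N (\<lambda>i. w i + w' i) \<in> ?h" if "?N w \<in> ?h" "?N w' \<in> ?h" for w w'
  proof -
    have "lin_exp (\<lambda>x. t *\<^sub>R ?N (\<lambda>i. w i + w' i) x) \<in> H" for t
    proof -
      have "(\<lambda>x. t *\<^sub>R ?N (\<lambda>i. w i + w' i) x) = ?N (\<lambda>i. t * w i + t * w' i)"
        by (simp add: nil_op_scale distrib_left fun_eq_iff)
      moreover have "lin_exp (?N (\<lambda>i. t * w i)) \<in> H" "lin_exp (?N (\<lambda>i. t * w' i)) \<in> H"
        using that by (simp_all add: lie_algebra_of_def nil_op_scale)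
      ultimately show ?thesis using comp lin_exp_nil_op_add by metis
    qed
    then show ?thesis using linear_nil_op by (simp add: lie_algebra_of_def)
  qed
  have zl: "z (\<lambda>i. c * w i) = c *\<^sub>R z w" "z (\<lambda>i. w i + w' i) = z w + z w'" for c w w'
    by (simp_all add: z_def scaleR_right.sum scaleR_add_left sum.distrib)
  have "subspace S"
    unfolding subspace_def
  proof (intro conjI ballI allI)
    show "0 \<in> S" by (simp add: S_def)
    show "x + y \<in> S" if "x \<in> S" "y \<in> S" for x y
      using that add zl(2) unfolding S_def by (elim insertE CollectE exE conjE) (auto, metis)
    show "c *\<^sub>R x \<in> S" if "x \<in> S" for c x
      using that scale zl(1) unfolding S_def by (elim insertE CollectE exE conjE) (auto, metis)
  qed
  then have spS: "span S = S" by (simp add: span_eq_iff)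
  let ?E = "span (e ` {..<n})"
  have zE: "z w \<in> ?E" for w
    unfolding z_def by (intro span_sum span_scale span_base) auto
  have SE: "S \<subseteq> ?E" using zE by (auto simp: S_def span_zero)
  have "S = ?E"
  proof (rule ccontr)
    assume "S \<noteq> ?E"
    then have "span S \<subset> span (e ` {..<n})" unfolding spS using SE by blast
    then obtain y where y: "y \<noteq> 0" "y \<in> ?E" "\<And>x. x \<in> span S \<Longrightarrow> orthogonal y x"
      using orthogonal_to_subspace_exists_gen by metis
    \<comment> \<open>Orthogonality of \<open>y\<close> refers to the inner product of the model
      space, in which the \<open>e i\<close> need not be orthonormal. The numbers \<open>u i\<close>
      represent the functional \<open>w \<mapsto> y \<bullet> z w\<close>, and
      \<open>x = z u\<close> is its representative for \<open>B\<close>, where the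
      \<open>e i\<close> are orthonormal.\<close>
    define u where "u i = y \<bullet> e i" for i
    have yz: "y \<bullet> z w = (\<Sum>i<n. w i * u i)" for w by (simp add: z_def inner_sum_right u_def)
    define x where "x = z u"
    have "\<exists>i<n. u i \<noteq> 0"
    proof (rule ccontr)
      assume "\<not> (\<exists>i<n. u i \<noteq> 0)"
      then have "orthogonal y a" if "a \<in> e ` {..<n}" for a using that by (auto simp: u_def orthogonal_def)
      then have "orthogonal y y" using y(2) orthogonal_to_span by blast
      then show False using y(1) by (simp add: orthogonal_def)
    qed
    moreover have Bxx: "B x x = (\<Sum>i<n. u i * u i)"
      unfolding x_def z_def by (simp add: B_sum_left B_sum_right B_lin products if_distrib sum.delta cong: if_cong)
    ultimately have xx: "B x x \<noteq> 0"
      by (auto simp: sum_nonneg_eq_0_iff)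
    have T: "T x = 0" if Th: "T \<in> ?h" for T
    proof -
      obtain w where w: "T = ?N w" using lie_algebra_of_screen_trivial[OF H Th] by blast
      have "z w \<in> S" using Th w by (auto simp: S_def)
      then have "y \<bullet> z w = 0" using y(3) span_base by (metis orthogonal_def)
      then have "(\<Sum>i<n. w i * u i) = 0" using yz by simp
      moreover have "B x (e i) = u i" if "i < n" for i
        using that by (simp add: x_def z_def B_sum_left B_lin products if_distrib sum.delta cong: if_cong)
      moreover have "B x v = 0" by (simp add: x_def z_def B_sum_left B_lin products)
      ultimately show ?thesis by (simp add: w nil_op_def)
    qed
    have lin: "linear T" if "T \<in> ?h" for T using that by (simp add: lie_algebra_of_def)
    have "invariant_subspace ?h (span {x})"
      unfolding invariant_subspace_def
    proof (intro conjI ballI subspace_span)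
      show "T ` span {x} \<subseteq> span {x}" if "T \<in> ?h" for T
        using T[OF that] linear_scale[OF lin[OF that]] by (auto simp: span_singleton)
    qed
    moreover have "span {x} \<noteq> {0}"
    proof
      assume "span {x} = {0}"
      then have "x = 0" using span_base[of x "{x}"] by blast
      then show False using xx bilinear_lzero[OF bil] by metis
    qed
    moreover have "span {x} \<noteq> UNIV"
    proof
      assume "span {x} = UNIV"
      then obtain c where "v = c *\<^sub>R x" using UNIV_I[of v] unfolding span_singleton by blast
      moreover have "B x w0 = 0" by (simp add: x_def z_def B_sum_left B_lin products)
      ultimately show False using products(3) by (simp add: B_lin)
    qed
    moreover have "\<forall>a\<in>span {x}. (\<forall>b\<in>span {x}. B a b = 0) \<longrightarrow> a = 0"
    proof (intro ballI impI)
      fix a assume a: "a \<in> span {x}" "\<forall>b\<in>span {x}. B a b = 0"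
      from a(1) obtain c where c: "a = c *\<^sub>R x" unfolding span_singleton by blast
      have "B a x = 0" using a(2) span_base by blast
      then show "a = 0" using xx c by (simp add: B_lin)
    qed
    ultimately show False using ind unfolding indecomposable_def by blast
  qed
  have mem: "?N w \<in> ?h" for w
  proof -
    \<comment> \<open>A non-zero element of \<open>S\<close> must come from the algebra, and its
      multiple by \<open>0\<close> puts the zero operator there too.\<close>
    have ne: "e 0 \<noteq> 0" using products(9)[OF n n] by (auto simp: B_lin)
    have "e 0 \<in> S" unfolding \<open>S = ?E\<close> using n by (intro span_base) auto
    with ne obtain w1 where w1: "?N w1 \<in> ?h" by (auto simp: S_def)
    have z0: "?N (\<lambda>_. 0) \<in> ?h" using scale[OF w1, of 0] by simp
    have "z w \<in> S" using zE \<open>S = ?E\<close> by simp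
    then obtain w' where w': "z w = z w'" "?N w' \<in> ?h"
    proof -
      assume *: "\<And>w'. z w = z w' \<Longrightarrow> ?N w' \<in> ?h \<Longrightarrow> thesis"
      have "z (\<lambda>_. 0) = 0" by (simp add: z_def)
      then show thesis using \<open>z w \<in> S\<close> *[OF _ z0] * by (auto simp: S_def)
    qed
    have "\<forall>i<n. w i = w' i" using w'(1) unfolding z_def combination_eq_iff .
    then have "?N w = ?N w'" by (simp add: nil_op_def fun_eq_iff)
    with w'(2) show ?thesis by simp
  qed
  show ?thesis
    using mem lie_algebra_of_screen_trivial[OF H] by (auto simp: has_matrix_nil_iff)
qed

lemma reducible_nil:
  assumes "0 < n"
  shows "reducible {T. \<exists>w. has_matrix n v e w0 T 0 (\<lambda>_ _. 0) w}"
  unfolding reducible_def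
proof (intro exI[of _ "span {v}"] conjI)
  have "nil_op n B v e w (c *\<^sub>R v) = 0" for w c
    by (simp add: linear_scale[OF linear_nil_op] nil_op_basis)
  then show "invariant_subspace {T. \<exists>w. has_matrix n v e w0 T 0 (\<lambda>_ _. 0) w} (span {v})"
    unfolding invariant_subspace_def has_matrix_nil_iff
    by (intro conjI ballI subspace_span) (auto simp: span_singleton)
  show "span {v} \<noteq> {0}"
  proof
    assume "span {v} = {0}"
    then have "v = 0" using span_base[of v "{v}"] by blast
    then show False using products(3) bilinear_lzero[OF bil, of w0] by simp
  qed
  show "span {v} \<noteq> UNIV"
  proof
    assume "span {v} = UNIV"
    then obtain c where "w0 = c *\<^sub>R v" using UNIV_I[of w0] unfolding span_singleton by blast
    then have "B v w0 = 0" using products(1) by (simp add: B_lin)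
    with products(3) show False by simp
  qed
qed

end

section \<open>Concatenation of paths\<close>

lemma C1_curve_on_cong:
  assumes "\<And>t. t \<in> T \<Longrightarrow> \<gamma> t = \<gamma>' t" "C1_curve_on A T \<gamma>"
  shows "C1_curve_on A T \<gamma>'"
  unfolding C1_curve_on_def
proof
  fix i assume "i \<in> charts A"
  then obtain u' where u': "continuous_on {t \<in> T. \<gamma> t \<in> patch A i} u'"
    "\<And>t. t \<in> T \<Longrightarrow> \<gamma> t \<in> patch A i \<Longrightarrow> ((coord A i \<circ> \<gamma>) has_vector_derivative u' t) (at t within T)"
    using assms(2) unfolding C1_curve_on_def by blast
  have "{t \<in> T. \<gamma> t \<in> patch A i} = {t \<in> T. \<gamma>' t \<in> patch A i}" using assms(1) by auto
  moreover have "((coord A i \<circ> \<gamma>') has_vector_derivative u' t) (at t within T)"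
    if "t \<in> T" "\<gamma>' t \<in> patch A i" for t
    by (rule has_vector_derivative_transform[OF that(1) _ u'(2)]) (use assms(1) that in auto)
  ultimately show "\<exists>u'. continuous_on {t \<in> T. \<gamma>' t \<in> patch A i} u' \<and>
        (\<forall>t\<in>T. \<gamma>' t \<in> patch A i \<longrightarrow> ((coord A i \<circ> \<gamma>') has_vector_derivative u' t) (at t within T))"
    using u'(1) by auto
qed

lemma C1_curve_on_subset:
  assumes "C1_curve_on A T \<gamma>" "T' \<subseteq> T"
  shows "C1_curve_on A T' \<gamma>"
  unfolding C1_curve_on_def
proof
  fix i assume "i \<in> charts A"
  then obtain u' where u': "continuous_on {t \<in> T. \<gamma> t \<in> patch A i} u'"
    "\<And>t. t \<in> T \<Longrightarrow> \<gamma> t \<in> patch A i \<Longrightarrow> ((coord A i \<circ> \<gamma>) has_vector_derivative u' t) (at t within T)"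
    using assms(1) unfolding C1_curve_on_def by blast
  have "continuous_on {t \<in> T'. \<gamma> t \<in> patch A i} u'"
    by (rule continuous_on_subset[OF u'(1)]) (use assms(2) in auto)
  moreover have "((coord A i \<circ> \<gamma>) has_vector_derivative u' t) (at t within T')"
    if "t \<in> T'" "\<gamma> t \<in> patch A i" for t
    by (rule has_vector_derivative_within_subset[OF u'(2)]) (use assms(2) that in auto)
  ultimately show "\<exists>u'. continuous_on {t \<in> T'. \<gamma> t \<in> patch A i} u' \<and>
        (\<forall>t\<in>T'. \<gamma> t \<in> patch A i \<longrightarrow> ((coord A i \<circ> \<gamma>) has_vector_derivative u' t) (at t within T'))"
    by blast
qed

lemma affine_image_Icc: "c > 0 \<Longrightarrow> (\<lambda>t. c * t + d) ` {a..b} = {c * a + d..c * b + d}" for c d a b :: real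
  using image_affinity_atLeastAtMost[of c d a b]
  by (cases "a \<le> b") auto

lemma has_vector_derivative_affine:
  fixes g :: "real \<Rightarrow> 'a::real_normed_vector"
  assumes "(g has_vector_derivative g') (at (c * t + d) within {c * a + d..c * b + d})" "c > 0"
  shows "((\<lambda>t. g (c * t + d)) has_vector_derivative c *\<^sub>R g') (at t within {a..b})"
proof -
  have "((\<lambda>t. c * t + d) has_vector_derivative c) (at t within {a..b})"
    unfolding has_real_derivative_iff_has_vector_derivative[symmetric] by (auto intro!: derivative_eq_intros)
  from vector_diff_chain_within[OF this, of g g'] assms show ?thesis
    by (simp add: affine_image_Icc o_def)
qed

lemma C1_curve_on_affine:
  assumes C1: "C1_curve_on A {c * a + d..c * b + d} \<gamma>" and c: "c > 0"
  shows "C1_curve_on A {a..b} (\<lambda>t. \<gamma> (c * t + d))"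
  unfolding C1_curve_on_def
proof
  fix i assume "i \<in> charts A"
  let ?T = "{c * a + d..c * b + d}"
  obtain u' where u': "continuous_on {t \<in> ?T. \<gamma> t \<in> patch A i} u'"
    "\<And>t. t \<in> ?T \<Longrightarrow> \<gamma> t \<in> patch A i \<Longrightarrow> ((coord A i \<circ> \<gamma>) has_vector_derivative u' t) (at t within ?T)"
    using C1 \<open>i \<in> charts A\<close> unfolding C1_curve_on_def by blast
  have T: "c * t + d \<in> ?T" if "t \<in> {a..b}" for t using that c by auto
  have "continuous_on {t \<in> {a..b}. \<gamma> (c * t + d) \<in> patch A i} (\<lambda>t. c *\<^sub>R u' (c * t + d))"
    by (intro continuous_on_scaleR continuous_on_const continuous_on_compose2[OF u'(1)] continuous_intros)
      (use T in auto)
  moreover have "((coord A i \<circ> (\<lambda>t. \<gamma> (c * t + d))) has_vector_derivative c *\<^sub>R u' (c * t + d)) (at t within {a..b})"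
    if "t \<in> {a..b}" "\<gamma> (c * t + d) \<in> patch A i" for t
    using has_vector_derivative_affine[OF u'(2)[OF T[OF that(1)] that(2)] c] by (simp add: o_def)
  ultimately show "\<exists>u'. continuous_on {t \<in> {a..b}. \<gamma> (c * t + d) \<in> patch A i} u' \<and>
        (\<forall>t\<in>{a..b}. \<gamma> (c * t + d) \<in> patch A i \<longrightarrow>
          ((coord A i \<circ> (\<lambda>t. \<gamma> (c * t + d))) has_vector_derivative u' t) (at t within {a..b}))"
    by blast
qed

text \<open>Used for paths and for fields along them. At \<open>1/2\<close> the first curve decides,
  which matters for fields in charts that do not contain the junction, where the two need not
  agree.\<close>

definition join :: "(real \<Rightarrow> 'x) \<Rightarrow> (real \<Rightarrow> 'x) \<Rightarrow> real \<Rightarrow> 'x" where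
  "join g1 g2 t = (if t \<le> 1/2 then g1 (2 * t) else g2 (2 * t - 1))"

lemma join_left: "t \<le> 1/2 \<Longrightarrow> join g1 g2 t = g1 (2 * t + 0)"
  by (simp add: join_def)

lemma join_right: "g1 1 = g2 0 \<Longrightarrow> t \<ge> 1/2 \<Longrightarrow> join g1 g2 t = g2 (2 * t + - 1)"
proof -
  assume *: "g1 1 = g2 0" "t \<ge> 1/2"
  show ?thesis
  proof (cases "t = 1/2")
    case True
    show ?thesis unfolding True using *(1) by (simp add: join_def)
  next
    case False
    then show ?thesis using *(2) by (simp add: join_def)
  qed
qed

text \<open>The parameter space \<open>X\<close> lets one statement serve twice: a one-point space
  gives continuity of a joined path, an interval gives the joined homotopy.\<close>

lemma continuous_map_join:
  assumes c1: "continuous_map (prod_topology X (top_of_set {0..1})) Y (\<lambda>(s, t). h1 s t)"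
    and c2: "continuous_map (prod_topology X (top_of_set {0..1})) Y (\<lambda>(s, t). h2 s t)"
    and eq: "\<And>s. s \<in> topspace X \<Longrightarrow> h1 s 1 = h2 s 0"
  shows "continuous_map (prod_topology X (top_of_set {0..1})) Y (\<lambda>(s, t). join (h1 s) (h2 s) t)"
proof -
  let ?I = "top_of_set {0..1::real}" and ?Z = "prod_topology X (top_of_set {0..1::real})"
  have tm: "continuous_map (subtopology ?Z {x \<in> topspace ?Z. P x}) ?Z (\<lambda>x. (fst x, c * snd x + d))"
    if r: "\<And>x. x \<in> topspace ?Z \<Longrightarrow> P x \<Longrightarrow> c * snd x + d \<in> {0..1}" for P c d
  proof (subst continuous_map_pairwise, intro conjI)
    have fs: "continuous_map ?Z X fst" "continuous_map ?Z ?I snd"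
      by (rule continuous_map_fst continuous_map_snd)+
    show "continuous_map (subtopology ?Z {x \<in> topspace ?Z. P x}) X (fst \<circ> (\<lambda>x. (fst x, c * snd x + d)))"
      using continuous_map_from_subtopology[OF fs(1)] by (simp add: o_def)
    have "continuous_map ?Z euclideanreal snd"
      using fs(2) continuous_map_in_subtopology by blast
    then have "continuous_map ?Z euclideanreal (\<lambda>x. c * snd x + d)"
      by (intro continuous_map_add continuous_map_real_mult continuous_map_const[THEN iffD2]) auto
    then show "continuous_map (subtopology ?Z {x \<in> topspace ?Z. P x}) ?I (snd \<circ> (\<lambda>x. (fst x, c * snd x + d)))"
      using r by (auto simp: continuous_map_in_subtopology o_def intro: continuous_map_from_subtopology)
  qed
  have "continuous_map ?Z Y (\<lambda>x. if snd x \<le> 1/2 then (case (fst x, 2 * snd x + 0) of (s, t) \<Rightarrow> h1 s t)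
      else (case (fst x, 2 * snd x + - 1) of (s, t) \<Rightarrow> h2 s t))"
  proof (rule continuous_map_cases_le)
    show "continuous_map ?Z euclideanreal snd"
      using continuous_map_snd continuous_map_in_subtopology by blast
    show "continuous_map ?Z euclideanreal (\<lambda>x. 1/2)" by simp
    show "continuous_map (subtopology ?Z {x \<in> topspace ?Z. snd x \<le> 1/2}) Y (\<lambda>x. case (fst x, 2 * snd x + 0) of (s, t) \<Rightarrow> h1 s t)"
      by (rule continuous_map_compose[OF tm c1, unfolded o_def]) auto
    show "continuous_map (subtopology ?Z {x \<in> topspace ?Z. 1/2 \<le> snd x}) Y (\<lambda>x. case (fst x, 2 * snd x + - 1) of (s, t) \<Rightarrow> h2 s t)"
      by (rule continuous_map_compose[OF tm c2, unfolded o_def]) auto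
    show "(case (fst x, 2 * snd x + 0) of (s, t) \<Rightarrow> h1 s t) = (case (fst x, 2 * snd x + - 1) of (s, t) \<Rightarrow> h2 s t)"
      if x: "x \<in> topspace ?Z" "snd x = 1/2" for x
    proof -
      have c: "2 * snd x + 0 = 1" "2 * snd x + - 1 = 0" using x(2) by simp_all
      have "fst x \<in> topspace X" using x(1) by auto
      then show ?thesis unfolding c using eq by simp
    qed
  qed
  then show ?thesis by (simp add: join_def case_prod_unfold cong: if_cong)
qed

lemma pathin_join:
  assumes g1: "pathin X g1" and g2: "pathin X g2" and eq: "g1 1 = g2 0"
  shows "pathin X (join g1 g2)"
proof -
  let ?U = "discrete_topology {()}" and ?I = "top_of_set {0..1::real}"
  have "continuous_map (prod_topology ?U ?I) X (\<lambda>(s, t). g t)" if "pathin X g" for g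
    using continuous_map_compose[OF continuous_map_snd that[unfolded pathin_def], of ?U]
    by (simp add: o_def case_prod_unfold)
  from continuous_map_join[OF this[OF g1] this[OF g2]] eq
  have j: "continuous_map (prod_topology ?U ?I) X (\<lambda>(s, t). join g1 g2 t)" by simp
  have "continuous_map ?I (prod_topology ?U ?I) (\<lambda>t. ((), t))"
    by (auto simp: continuous_map_pairwise o_def)
  from continuous_map_compose[OF this j] show ?thesis by (simp add: pathin_def o_def)
qed

lemma homotopic_join:
  assumes h1: "homotopic_with (\<lambda>h. h 0 = p \<and> h 1 = p) (top_of_set {0..1}) X g1 (\<lambda>_. p)"
    and h2: "homotopic_with (\<lambda>h. h 0 = p \<and> h 1 = p) (top_of_set {0..1}) X g2 (\<lambda>_. p)"
  shows "homotopic_with (\<lambda>h. h 0 = p \<and> h 1 = p) (top_of_set {0..1}) X (join g1 g2) (\<lambda>_. p)"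
proof -
  let ?I = "top_of_set {0..1::real}"
  obtain k1 where k1: "continuous_map (prod_topology ?I ?I) X k1" "\<And>x. k1 (0, x) = g1 x" "\<And>x. k1 (1, x) = p"
    "\<And>t. t \<in> {0..1} \<Longrightarrow> k1 (t, 0) = p \<and> k1 (t, 1) = p"
    using h1 unfolding homotopic_with_def by auto
  obtain k2 where k2: "continuous_map (prod_topology ?I ?I) X k2" "\<And>x. k2 (0, x) = g2 x" "\<And>x. k2 (1, x) = p"
    "\<And>t. t \<in> {0..1} \<Longrightarrow> k2 (t, 0) = p \<and> k2 (t, 1) = p"
    using h2 unfolding homotopic_with_def by auto
  have "continuous_map (prod_topology ?I ?I) X (\<lambda>(s, t). join (\<lambda>t. k1 (s, t)) (\<lambda>t. k2 (s, t)) t)"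
    by (rule continuous_map_join) (use k1 k2 in auto)
  then show ?thesis
    unfolding homotopic_with_def
    by (intro exI[of _ "\<lambda>(s, t). join (\<lambda>t. k1 (s, t)) (\<lambda>t. k2 (s, t)) t"])
      (use k1 k2 in \<open>auto simp: join_def\<close>)
qed

lemma C1_curve_on_join_left:
  assumes "b \<le> 1/2" 
  shows "C1_curve_on A {a..b} (join g1 g2) \<longleftrightarrow> C1_curve_on A {2 * a + 0..2 * b + 0} g1"
proof
  assume "C1_curve_on A {2 * a + 0..2 * b + 0} g1"
  from C1_curve_on_affine[OF this] have "C1_curve_on A {a..b} (\<lambda>t. g1 (2 * t + 0))" by simp
  then show "C1_curve_on A {a..b} (join g1 g2)"
    by (rule C1_curve_on_cong[rotated]) (use assms in \<open>simp add: join_left\<close>)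
next
  assume "C1_curve_on A {a..b} (join g1 g2)"
  then have "C1_curve_on A {1/2 * (2 * a + 0) + 0..1/2 * (2 * b + 0) + 0} (join g1 g2)" by simp
  from C1_curve_on_affine[OF this]
  have "C1_curve_on A {2 * a + 0..2 * b + 0} (\<lambda>t. join g1 g2 (1/2 * t + 0))" by simp
  then show "C1_curve_on A {2 * a + 0..2 * b + 0} g1"
    by (rule C1_curve_on_cong[rotated]) (use assms in \<open>simp add: join_def\<close>)
qed

lemma C1_curve_on_join_right:
  assumes "1/2 \<le> a" "g1 1 = g2 0"
  shows "C1_curve_on A {a..b} (join g1 g2) \<longleftrightarrow> C1_curve_on A {2 * a + - 1..2 * b + - 1} g2"
proof
  assume "C1_curve_on A {2 * a + - 1..2 * b + - 1} g2"
  from C1_curve_on_affine[OF this] have "C1_curve_on A {a..b} (\<lambda>t. g2 (2 * t + - 1))" by simp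
  then show "C1_curve_on A {a..b} (join g1 g2)"
    by (rule C1_curve_on_cong[rotated]) (use assms join_right[of g1 g2, OF assms(2)] in simp)
next
  assume "C1_curve_on A {a..b} (join g1 g2)"
  then have "C1_curve_on A {1/2 * (2 * a + - 1) + 1/2..1/2 * (2 * b + - 1) + 1/2} (join g1 g2)"
    by (simp add: algebra_simps)
  from C1_curve_on_affine[OF this]
  have "C1_curve_on A {2 * a + - 1..2 * b + - 1} (\<lambda>t. join g1 g2 (1/2 * t + 1/2))" by simp
  then show "C1_curve_on A {2 * a + - 1..2 * b + - 1} g2"
    by (rule C1_curve_on_cong[rotated]) (use assms join_right[of g1 g2, OF assms(2)] in \<open>simp add: algebra_simps\<close>)
qed

lemma piecewise_C1_path_join:
  assumes g1: "piecewise_C1_path A g1" and g2: "piecewise_C1_path A g2" and eq: "g1 1 = g2 0"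
  shows "piecewise_C1_path A (join g1 g2)"
proof -
  obtain S1 where S1: "finite S1" "\<And>a b. 0 \<le> a \<and> a < b \<and> b \<le> 1 \<and> {a<..<b} \<inter> S1 = {} \<Longrightarrow> C1_curve_on A {a..b} g1"
    using g1 unfolding piecewise_C1_path_def by blast
  obtain S2 where S2: "finite S2" "\<And>a b. 0 \<le> a \<and> a < b \<and> b \<le> 1 \<and> {a<..<b} \<inter> S2 = {} \<Longrightarrow> C1_curve_on A {a..b} g2"
    using g2 unfolding piecewise_C1_path_def by blast
  let ?S = "insert (1/2) ((\<lambda>s. s / 2) ` S1 \<union> (\<lambda>s. (s + 1) / 2) ` S2)"
  have "C1_curve_on A {a..b} (join g1 g2)" if ab: "0 \<le> a" "a < b" "b \<le> 1" "{a<..<b} \<inter> ?S = {}" for a b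
  proof -
    have "1/2 \<notin> {a<..<b}" using ab(4) by blast
    then consider "b \<le> 1/2" | "1/2 \<le> a" by fastforce
    then show ?thesis
    proof cases
      case 1
      have "{2 * a + 0<..<2 * b + 0} \<inter> S1 = {}"
      proof (rule ccontr)
        assume "{2 * a + 0<..<2 * b + 0} \<inter> S1 \<noteq> {}"
        then obtain s where "s \<in> S1" "2 * a < s" "s < 2 * b" by auto
        then have "s / 2 \<in> {a<..<b} \<inter> ?S" by auto
        with ab(4) show False by blast
      qed
      then have "C1_curve_on A {2 * a + 0..2 * b + 0} g1" using ab 1 by (intro S1(2)) auto
      then show ?thesis using C1_curve_on_join_left[OF 1] by blast
    next
      case 2
      have "{2 * a + - 1<..<2 * b + - 1} \<inter> S2 = {}"
      proof (rule ccontr)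
        assume "{2 * a + - 1<..<2 * b + - 1} \<inter> S2 \<noteq> {}"
        then obtain s where "s \<in> S2" "2 * a - 1 < s" "s < 2 * b - 1" by auto
        then have "(s + 1) / 2 \<in> {a<..<b} \<inter> ?S" by auto
        with ab(4) show False by blast
      qed
      then have "C1_curve_on A {2 * a + - 1..2 * b + - 1} g2" using ab 2 by (intro S2(2)) auto
      then show ?thesis using C1_curve_on_join_right[of a g1 g2, OF 2 eq] by blast
    qed
  qed
  moreover have "finite ?S" using S1(1) S2(1) by simp
  ultimately show ?thesis
    unfolding piecewise_C1_path_def using pathin_join[of _ g1 g2, OF _ _ eq] g1 g2
    unfolding piecewise_C1_path_def by blast
qed

text \<open>A small neighbourhood of a time contains no other break point, so \<open>h\<close> is
  constant on the piece to either side; local constancy then spreads over the connected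
  interval.\<close>

lemma locally_constant_piecewise:
  fixes h :: "real \<Rightarrow> 'a::real_normed_vector"
  assumes S: "finite S"
    and der: "\<And>a b t. 0 \<le> a \<Longrightarrow> a < b \<Longrightarrow> b \<le> 1 \<Longrightarrow> {a<..<b} \<inter> S = {} \<Longrightarrow> t \<in> {a..b} \<Longrightarrow>
      (h has_vector_derivative 0) (at t within {a..b})"
    and xy: "x \<in> {0..1}" "y \<in> {0..1}"
  shows "h x = h y"
proof -
  have const: "h a = h b" if ab: "0 \<le> a" "a < b" "b \<le> 1" "{a<..<b} \<inter> S = {}" for a b
  proof -
    obtain c where "\<And>t. t \<in> {a..b} \<Longrightarrow> h t = c"
      using has_vector_derivative_zero_constant[of "{a..b}" h] der[OF ab] by auto
    then show ?thesis using ab by auto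
  qed
  show ?thesis
  proof (rule connected_local_const[of "{0..1}"])
    show "\<forall>x\<in>{0..1}. eventually (\<lambda>y. h x = h y) (at x within {0..1})"
    proof
      fix x :: real assume x: "x \<in> {0..1}"
      have "finite (S - {x})" using S by simp
      then obtain d where d: "d > 0" "\<forall>y\<in>S - {x}. d \<le> dist x y"
        using finite_set_avoid[of "S - {x}" x] by auto
      have "h x = h y" if y: "y \<in> {0..1}" "y \<noteq> x" "dist y x < d" for y
      proof (cases "x < y")
        case True
        have "{x<..<y} \<inter> S = {}" using d(2) y(3) by (force simp: dist_real_def)
        then show ?thesis using const True x y by auto
      next
        case False
        have "{y<..<x} \<inter> S = {}" using d(2) y(3) by (force simp: dist_real_def)
        then have "h y = h x" using const False x y by auto
        then show ?thesis by simp
      qed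
      then show "eventually (\<lambda>y. h x = h y) (at x within {0..1})"
        unfolding eventually_at using d(1) by blast
    qed
  qed (use xy in auto)
qed

text \<open>The quantity is given chart by chart. Independence of the chart allows one to be chosen
  at each time, and near a fixed time that chart can be kept, so the derivative may be computed in
  it.\<close>

lemma conserved_quantity:
  fixes X :: "'i \<Rightarrow> real \<Rightarrow> 'a::real_normed_vector"
  assumes atl: "continuous_atlas A" and path: "piecewise_C1_path A \<gamma>"
    and indep: "\<And>t i j. t \<in> {0..1} \<Longrightarrow> i \<in> charts A \<Longrightarrow> j \<in> charts A \<Longrightarrow> \<gamma> t \<in> patch A i \<Longrightarrow> \<gamma> t \<in> patch A j \<Longrightarrow> X i t = X j t"
    and der: "\<And>a b i t. 0 \<le> a \<Longrightarrow> a < b \<Longrightarrow> b \<le> 1 \<Longrightarrow> C1_curve_on A {a..b} \<gamma> \<Longrightarrow> i \<in> charts A \<Longrightarrow> t \<in> {a..b} \<Longrightarrow>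
      \<gamma> t \<in> patch A i \<Longrightarrow> (X i has_vector_derivative 0) (at t within {a..b})"
    and ij: "i \<in> charts A" "j \<in> charts A" "\<gamma> t0 \<in> patch A i" "\<gamma> t1 \<in> patch A j"
    and t01: "t0 \<in> {0..1}" "t1 \<in> {0..1}"
  shows "X i t0 = X j t1"
proof -
  obtain S where S: "finite S" "\<And>a b. 0 \<le> a \<and> a < b \<and> b \<le> 1 \<and> {a<..<b} \<inter> S = {} \<Longrightarrow> C1_curve_on A {a..b} \<gamma>"
    and cont: "continuous_map (top_of_set {0..1}) (mtop A) \<gamma>"
    using path unfolding piecewise_C1_path_def pathin_def by blast
  define \<kappa> where "\<kappa> t = (SOME i. i \<in> charts A \<and> \<gamma> t \<in> patch A i)" for t
  have \<kappa>: "\<kappa> t \<in> charts A \<and> \<gamma> t \<in> patch A (\<kappa> t)" if "t \<in> {0..1}" for t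
  proof -
    have "\<gamma> t \<in> points A"
      using cont that unfolding continuous_map_def topspace_mtop[OF atl] by auto
    then obtain i where "i \<in> charts A \<and> \<gamma> t \<in> patch A i" unfolding points_def by blast
    then show ?thesis unfolding \<kappa>_def by (rule someI)
  qed
  define h where "h t = X (\<kappa> t) t" for t
  have h: "h t = X i t" if "t \<in> {0..1}" "i \<in> charts A" "\<gamma> t \<in> patch A i" for t i
    unfolding h_def using indep \<kappa> that by blast
  have "h t0 = h t1"
  proof (rule locally_constant_piecewise[OF S(1) _ t01])
    fix a b t :: real assume ab: "0 \<le> a" "a < b" "b \<le> 1" "{a<..<b} \<inter> S = {}" "t \<in> {a..b}"
    have t: "t \<in> {0..1}" using ab by auto
    let ?i = "\<kappa> t"
    note i = \<kappa>[OF t]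
    have "openin (top_of_set {0..1}) {s \<in> {0..1}. \<gamma> s \<in> patch A ?i}"
      using openin_continuous_map_preimage[OF cont openin_patch[OF atl, of ?i]] i by simp
    then obtain N where N: "open N" "{s \<in> {0..1}. \<gamma> s \<in> patch A ?i} = {0..1} \<inter> N"
      unfolding openin_open by blast
    then have "t \<in> N" using t i by blast
    then obtain d where d: "d > 0" "ball t d \<subseteq> N" using N(1) open_contains_ball by blast
    have "(X ?i has_vector_derivative 0) (at t within {a..b})"
      using der[OF ab(1-3) S(2)] ab i by blast
    then show "(h has_vector_derivative 0) (at t within {a..b})"
    proof (rule has_vector_derivative_transform_within[OF _ d(1) ab(5)])
      fix s assume s: "s \<in> {a..b}" "dist s t < d"
      then have "s \<in> {0..1} \<inter> N" using d(2) ab by (auto simp: dist_commute subset_eq)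
      then have "s \<in> {0..1}" "\<gamma> s \<in> patch A ?i" using N(2) by blast+
      then show "X ?i s = h s" using h i by metis
    qed
  qed
  then show ?thesis using h ij t01 by simp
qed

text \<open>The pointwise form of \<^const>\<open>parallel_along\<close>, with the velocity existentially quantified so that
  one-sided derivatives can be glued.\<close>

definition parallel_at ::
    "('i, 'e::euclidean_space, 'x) atlas \<Rightarrow> ('i, 'e) tensor02 \<Rightarrow> (real \<Rightarrow> 'x) \<Rightarrow> (real \<Rightarrow> 'i \<Rightarrow> 'e) \<Rightarrow>
      'i \<Rightarrow> real \<Rightarrow> real set \<Rightarrow> bool" where
  "parallel_at A G \<gamma> w i t T \<longleftrightarrow> (\<exists>D. ((coord A i \<circ> \<gamma>) has_vector_derivative D) (at t within T) \<and>
     ((\<lambda>s. w s i) has_vector_derivative - christoffel G i (coord A i (\<gamma> t)) D (w t i)) (at t within T))"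

lemma parallel_along_iff:
  "parallel_along A G \<gamma> w \<longleftrightarrow> (\<forall>t\<in>{0..1}. w t \<in> tangent A (\<gamma> t)) \<and>
     (\<forall>a b. 0 \<le> a \<and> a < b \<and> b \<le> 1 \<and> C1_curve_on A {a..b} \<gamma> \<longrightarrow>
        (\<forall>i\<in>charts A. \<forall>t\<in>{a..b}. \<gamma> t \<in> patch A i \<longrightarrow> parallel_at A G \<gamma> w i t {a..b}))"
proof -
  have *: "parallel_at A G \<gamma> w i t {a..b} \<longleftrightarrow>
      ((\<lambda>s. w s i) has_vector_derivative - christoffel G i (coord A i (\<gamma> t))
         (vector_derivative (coord A i \<circ> \<gamma>) (at t within {a..b})) (w t i)) (at t within {a..b})"
    if h: "a < b" "C1_curve_on A {a..b} \<gamma>" "i \<in> charts A" "t \<in> {a..b}" "\<gamma> t \<in> patch A i" for a b i t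
  proof -
    obtain D where D: "((coord A i \<circ> \<gamma>) has_vector_derivative D) (at t within {a..b})"
      using h unfolding C1_curve_on_def by blast
    have vd: "vector_derivative (coord A i \<circ> \<gamma>) (at t within {a..b}) = D'"
      if "((coord A i \<circ> \<gamma>) has_vector_derivative D') (at t within {a..b})" for D'
      using vector_derivative_within_cbox[of a b t "coord A i \<circ> \<gamma>" D'] that h(1,4)
      by simp
    show ?thesis unfolding parallel_at_def using D vd by metis
  qed
  show ?thesis unfolding parallel_along_def
    by (intro conj_cong refl iff_allI imp_cong ball_cong) (use * in blast)
qed

lemma parallel_at_cong:
  assumes "parallel_at A G \<gamma> w i t T" "t \<in> T" "0 < d"
    "\<And>s. s \<in> T \<Longrightarrow> dist s t < d \<Longrightarrow> \<gamma> s = \<gamma>' s" "\<And>s. s \<in> T \<Longrightarrow> dist s t < d \<Longrightarrow> w s i = w' s i"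
  shows "parallel_at A G \<gamma>' w' i t T"
proof -
  obtain D where D: "((coord A i \<circ> \<gamma>) has_vector_derivative D) (at t within T)"
     "((\<lambda>s. w s i) has_vector_derivative - christoffel G i (coord A i (\<gamma> t)) D (w t i)) (at t within T)"
    using assms(1) unfolding parallel_at_def by blast
  have "((coord A i \<circ> \<gamma>') has_vector_derivative D) (at t within T)"
    by (rule has_vector_derivative_transform_within[OF D(1) assms(3,2)]) (use assms(4) in simp)
  moreover have "((\<lambda>s. w' s i) has_vector_derivative - christoffel G i (coord A i (\<gamma> t)) D (w t i)) (at t within T)"
    by (rule has_vector_derivative_transform_within[OF D(2) assms(3,2)]) (use assms(5) in simp)
  moreover have "\<gamma> t = \<gamma>' t" "w t i = w' t i" using assms(2-5) by auto
  ultimately show ?thesis unfolding parallel_at_def by auto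
qed

lemma parallel_at_filter_cong:
  "at t within T = at t within T' \<Longrightarrow> parallel_at A G \<gamma> w i t T \<longleftrightarrow> parallel_at A G \<gamma> w i t T'"
  by (simp add: parallel_at_def)

text \<open>Reparametrisation multiplies the velocity and the derivative of the field by the same
  factor; homogeneity of the Christoffel vector in the velocity keeps the equation intact.\<close>

lemma parallel_at_affine:
  assumes par: "parallel_at A G \<gamma> w i (c * t + d) {c * a + d..c * b + d}" and c: "c > 0"
    and hom: "\<And>r v v'. christoffel G i (coord A i (\<gamma> (c * t + d))) (r *\<^sub>R v) v'
      = r *\<^sub>R christoffel G i (coord A i (\<gamma> (c * t + d))) v v'"
  shows "parallel_at A G (\<lambda>t. \<gamma> (c * t + d)) (\<lambda>t. w (c * t + d)) i t {a..b}"
proof -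
  obtain D where D: "((coord A i \<circ> \<gamma>) has_vector_derivative D) (at (c * t + d) within {c * a + d..c * b + d})"
     "((\<lambda>s. w s i) has_vector_derivative - christoffel G i (coord A i (\<gamma> (c * t + d))) D (w (c * t + d) i))
        (at (c * t + d) within {c * a + d..c * b + d})"
    using par unfolding parallel_at_def by blast
  from has_vector_derivative_affine[OF D(1) c] has_vector_derivative_affine[OF D(2) c]
  show ?thesis unfolding parallel_at_def by (intro exI[of _ "c *\<^sub>R D"]) (simp add: hom o_def)
qed

text \<open>A joined path may happen to be C1 across the junction, and then
  \<open>parallel_along\<close> demands a two-sided derivative there. Both one-sided velocities
  equal \<open>D\<close>, so the one-sided equations have the same right-hand side.\<close>

lemma parallel_at_glue:
  assumes l: "parallel_at A G \<gamma> w i m {a..m}" and r: "parallel_at A G \<gamma> w i m {m..b}"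
    and ab: "a < m" "m < b" and D: "((coord A i \<circ> \<gamma>) has_vector_derivative D) (at m within {a..b})"
  shows "parallel_at A G \<gamma> w i m {a..b}"
proof -
  have un: "D' = D" if D': "((coord A i \<circ> \<gamma>) has_vector_derivative D') (at m within {a'..b'})" and
    s: "{a'..b'} \<subseteq> {a..b}" "a' < b'" "m \<in> {a'..b'}" for a' b' D'
    using vector_derivative_within_cbox[of a' b' m "coord A i \<circ> \<gamma>"] s
      has_vector_derivative_within_subset[OF D s(1)] D' by (metis box_real(2))
  let ?C = "- christoffel G i (coord A i (\<gamma> m)) D (w m i)"
  have "((\<lambda>s. w s i) has_vector_derivative ?C) (at m within {a..m})"
    using l un[of _ a m] ab unfolding parallel_at_def by fastforce
  moreover have "((\<lambda>s. w s i) has_vector_derivative ?C) (at m within {m..b})"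
    using r un[of _ m b] ab unfolding parallel_at_def by fastforce
  ultimately have "((\<lambda>s. w s i) has_vector_derivative ?C) (at m within {a..m} \<union> {m..b})"
    unfolding has_vector_derivative_def has_derivative_within by (auto intro: Lim_Un)
  moreover have "{a..m} \<union> {m..b} = {a..b}" using ab by auto
  ultimately show ?thesis unfolding parallel_at_def using D by auto
qed

section \<open>Concatenated loops and composition of holonomy transformations\<close>

context
  fixes A :: "('i, 'e::euclidean_space, 'x) atlas" and G :: "('i, 'e) tensor02"
  assumes hom: "\<And>i u r v v'. i \<in> charts A \<Longrightarrow> u \<in> cdom A i \<Longrightarrow>
    christoffel G i u (r *\<^sub>R v) v' = r *\<^sub>R christoffel G i u v v'"
begin

lemma parallel_along_join:
  assumes w1: "parallel_along A G g1 w1" and w2: "parallel_along A G g2 w2" and p: "g1 1 = g2 0"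
    and eq: "\<And>j. j \<in> charts A \<Longrightarrow> g1 1 \<in> patch A j \<Longrightarrow> w1 1 j = w2 0 j"
  shows "parallel_along A G (join g1 g2) (join w1 w2)"
  unfolding parallel_along_iff
proof (intro conjI ballI allI impI, goal_cases)
  case (1 t)
  then show ?case
    using w1 w2 by (cases "t \<le> 1/2") (auto simp: parallel_along_iff join_def)
next
  case (2 a b i t)
  let ?g = "join g1 g2" and ?w = "join w1 w2"
  have ab: "0 \<le> a" "a < b" "b \<le> 1" and C1: "C1_curve_on A {a..b} ?g" and i: "i \<in> charts A"
    and t: "t \<in> {a..b}" and ti: "?g t \<in> patch A i"
    using 2 by auto
  have left: "parallel_at A G ?g ?w i t {a'..b'}"
    if h: "0 \<le> a'" "a' < b'" "b' \<le> 1/2" "C1_curve_on A {a'..b'} ?g" "t \<in> {a'..b'}" for a' b'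
  proof -
    have th: "t \<le> 1/2" using h by auto
    have C: "C1_curve_on A {2 * a' + 0..2 * b' + 0} g1" using C1_curve_on_join_left[OF h(3)] h(4) by blast
    have g: "g1 (2 * t + 0) \<in> patch A i" using ti join_left[OF th, of g1 g2] by simp
    have "parallel_at A G g1 w1 i (2 * t + 0) {2 * a' + 0..2 * b' + 0}"
      using w1 C g i h unfolding parallel_along_iff by (elim conjE allE[of _ "2 * a' + 0"] allE[of _ "2 * b' + 0"]) auto
    from parallel_at_affine[OF this _ hom[OF i coord_in_cdom[OF g]]]
    have "parallel_at A G (\<lambda>t. g1 (2 * t + 0)) (\<lambda>t. w1 (2 * t + 0)) i t {a'..b'}" by simp
    then show ?thesis
      by (rule parallel_at_cong[OF _ h(5) zero_less_one]) (use h(3) in \<open>auto simp: join_def\<close>)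
  qed
  have right: "parallel_at A G ?g ?w i t {a'..b'}"
    if h: "1/2 \<le> a'" "a' < b'" "b' \<le> 1" "C1_curve_on A {a'..b'} ?g" "t \<in> {a'..b'}" for a' b'
  proof -
    have th: "1/2 \<le> t" using h by auto
    have C: "C1_curve_on A {2 * a' + - 1..2 * b' + - 1} g2"
      using C1_curve_on_join_right[of a' g1 g2, OF h(1) p] h(4) by blast
    have g: "g2 (2 * t + - 1) \<in> patch A i" using ti join_right[of g1 g2, OF p th] by simp
    have "parallel_at A G g2 w2 i (2 * t + - 1) {2 * a' + - 1..2 * b' + - 1}"
      using w2 C g i h unfolding parallel_along_iff by (elim conjE allE[of _ "2 * a' + - 1"] allE[of _ "2 * b' + - 1"]) auto
    from parallel_at_affine[OF this _ hom[OF i coord_in_cdom[OF g]]]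
    have "parallel_at A G (\<lambda>t. g2 (2 * t + - 1)) (\<lambda>t. w2 (2 * t + - 1)) i t {a'..b'}" by simp
    then show ?thesis
    proof (rule parallel_at_cong[OF _ h(5)])
      \<comment> \<open>For \<open>t\<close> beyond the junction this radius keeps \<open>s\<close>
        strictly above \<open>1/2\<close>. At \<open>1/2\<close> the joined field follows
        \<open>w1\<close>, known to agree with \<open>w2\<close> only in charts around the
        junction.\<close>
      show "0 < (if t = 1/2 then 1 else t - 1/2)" using th by simp
      fix s assume s: "s \<in> {a'..b'}" "dist s t < (if t = 1/2 then 1 else t - 1/2)"
      then have s2: "1/2 \<le> s" using h(1) by auto
      show "g2 (2 * s + - 1) = ?g s" using join_right[of g1 g2, OF p s2] by simp
      show "w2 (2 * s + - 1) i = ?w s i"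
      proof (cases "s = 1/2")
        case True
        have tt: "t = 1/2"
        proof (rule ccontr)
          assume "t \<noteq> 1/2"
          then have "dist s t < t - 1/2" using s(2) by simp
          then show False using True by (simp add: dist_real_def)
        qed
        have "g1 1 \<in> patch A i" using ti unfolding tt by (simp add: join_def)
        from eq[OF i this] show ?thesis unfolding True by (simp add: join_def)
      next
        case False
        then show ?thesis using s2 by (simp add: join_def)
      qed
    qed
  qed
  \<comment> \<open>An interval across the junction is cut there: the side on which \<open>t\<close>
    lies settles it, and \<open>t = 1/2\<close> needs gluing.\<close>
  consider "b \<le> 1/2" | "1/2 \<le> a" | "a < 1/2" "1/2 < b" by linarith
  then show "parallel_at A G ?g ?w i t {a..b}"
  proof cases
    case 1
    then show ?thesis using left[of a b] ab C1 t by simp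
  next
    case 2
    then show ?thesis using right[of a b] ab C1 t by simp
  next
    case 3
    have C1l: "C1_curve_on A {a..1/2} ?g" and C1r: "C1_curve_on A {1/2..b} ?g"
      using C1_curve_on_subset[OF C1] 3 by auto
    consider "t < 1/2" | "1/2 < t" | "t = 1/2" by linarith
    then show ?thesis
    proof cases
      case l: 1
      have e: "at t within {a..1/2} = at t within {a..b}"
        by (rule at_within_nhd[of t "{..<1/2}"]) (use l 3 in auto)
      have "parallel_at A G ?g ?w i t {a..1/2}" using left[of a "1/2"] ab C1l t l 3 by auto
      then show ?thesis unfolding parallel_at_filter_cong[OF e] .
    next
      case r: 2
      have e: "at t within {1/2..b} = at t within {a..b}"
        by (rule at_within_nhd[of t "{1/2<..}"]) (use r 3 in auto)
      have "parallel_at A G ?g ?w i t {1/2..b}" using right[of "1/2" b] ab C1r t r 3 by auto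
      then show ?thesis unfolding parallel_at_filter_cong[OF e] .
    next
      case m: 3
      obtain D where D: "((coord A i \<circ> ?g) has_vector_derivative D) (at t within {a..b})"
        using C1 i t ti unfolding C1_curve_on_def by blast
      have at: "a < t" "t < b" using 3 m by simp_all
      have "parallel_at A G ?g ?w i t {a..t}"
        by (rule left) (use ab at m C1_curve_on_subset[OF C1, of "{a..t}"] in simp_all)
      moreover have "parallel_at A G ?g ?w i t {t..b}"
        by (rule right) (use ab at m C1_curve_on_subset[OF C1, of "{t..b}"] in simp_all)
      ultimately show ?thesis using parallel_at_glue[of A G ?g ?w i t a b D] at D by blast
    qed
  qed
qed

text \<open>Loops and null-homotopies are concatenated. A tangent vector at \<open>p\<close> is
  determined by its component in chart \<open>i\<close>, so agreement of the two fields there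
  extends to all charts around the junction.\<close>

lemma restricted_holonomy_comp:
  assumes i: "i \<in> charts A" "u \<in> cdom A i"
    and L1: "L1 \<in> restricted_holonomy A G i u" and L2: "L2 \<in> restricted_holonomy A G i u"
  shows "L2 \<circ> L1 \<in> restricted_holonomy A G i u"
proof -
  define p where "p = param A i u"
  have pi: "p \<in> patch A i" using i(2) by (simp add: p_def param_in_patch)
  obtain g1 where g1: "linear L1" "piecewise_C1_path A g1" "g1 0 = p" "g1 1 = p"
    "homotopic_with (\<lambda>h. h 0 = p \<and> h 1 = p) (top_of_set {0..1}) (mtop A) g1 (\<lambda>_. p)"
    "\<And>v. \<exists>w. parallel_along A G g1 w \<and> w 0 i = v \<and> w 1 i = L1 v"
    using L1 unfolding restricted_holonomy_def Let_def p_def by blast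
  obtain g2 where g2: "linear L2" "piecewise_C1_path A g2" "g2 0 = p" "g2 1 = p"
    "homotopic_with (\<lambda>h. h 0 = p \<and> h 1 = p) (top_of_set {0..1}) (mtop A) g2 (\<lambda>_. p)"
    "\<And>v. \<exists>w. parallel_along A G g2 w \<and> w 0 i = v \<and> w 1 i = L2 v"
    using L2 unfolding restricted_holonomy_def Let_def p_def by blast
  have eq: "g1 1 = g2 0" using g1(4) g2(3) by simp
  have "\<exists>w. parallel_along A G (join g1 g2) w \<and> w 0 i = v \<and> w 1 i = (L2 \<circ> L1) v" for v
  proof -
    obtain w1 where w1: "parallel_along A G g1 w1" "w1 0 i = v" "w1 1 i = L1 v" using g1(6) by blast
    obtain w2 where w2: "parallel_along A G g2 w2" "w2 0 i = L1 v" "w2 1 i = L2 (L1 v)" using g2(6) by blast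
    have tan: "w1 1 \<in> tangent A p" "w2 0 \<in> tangent A p"
      using w1(1) w2(1) g1(4) g2(3) unfolding parallel_along_def by (auto dest: bspec[of _ _ 1] bspec[of _ _ 0])
    have "w1 1 j = w2 0 j" if "j \<in> charts A" "g1 1 \<in> patch A j" for j
    proof -
      have pj: "p \<in> patch A j" using that g1(4) by simp
      have "w j = frechet_derivative (coord A j \<circ> param A i) (at (coord A i p)) (w i)" if "w \<in> tangent A p" for w
        using that i(1) \<open>j \<in> charts A\<close> pi pj unfolding tangent_def by blast
      with tan show ?thesis using w1(3) w2(2) by metis
    qed
    then have "parallel_along A G (join g1 g2) (join w1 w2)"
      by (rule parallel_along_join[OF w1(1) w2(1) eq])
    then show ?thesis using w1(2) w2(3) by (intro exI[of _ "join w1 w2"]) (simp add: join_def)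
  qed
  moreover have "linear (L2 \<circ> L1)" by (rule linear_compose[OF g1(1) g2(1)])
  moreover have "piecewise_C1_path A (join g1 g2)" by (rule piecewise_C1_path_join[OF g1(2) g2(2) eq])
  moreover have "join g1 g2 0 = p" "join g1 g2 1 = p" using g1(3) g2(4) by (simp_all add: join_def)
  ultimately show ?thesis
    using homotopic_join[OF g1(5) g2(5)] unfolding restricted_holonomy_def Let_def p_def[symmetric] by blast
qed

end

section \<open>The holonomy of the circle bundle\<close>

context wave_bundle
begin

lemma chr_scale: "tpt P b \<in> U \<Longrightarrow> unit_section P E U s \<Longrightarrow> chr s b (r *\<^sub>R v) w = r *\<^sub>R chr s b v w"
proof -
  assume b: "tpt P b \<in> U" and s: "unit_section P E U s"
  have "linear (d\<Phi> s b)" using has_derivative_conn_form[OF s b] has_derivative_linear by blast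
  then show ?thesis
    by (simp add: chr_def fibre_chr_def linear_scale[OF linear_dF] linear_scale[of "d\<Phi> s b"] field_simps)
qed

lemma christoffel_scale:
  assumes "i \<in> charts CB" "u \<in> cdom CB i"
  shows "christoffel G i u (r *\<^sub>R v) w = r *\<^sub>R christoffel G i u v w"
proof -
  obtain D U s where i: "i = (D, U, s)" by (cases i)
  have c: "(D, U, s) \<in> charts CB" and u: "u \<in> D" using assms i by auto
  have "unit_section P E U s" "tpt P (snd u) \<in> U" using c u by (auto simp: charts_circle_bundle)
  then show ?thesis unfolding i christoffel_eq[OF c u] using chr_scale by blast
qed

text \<open>A change of chart alters a tangent vector only in its angle component, and it preserves
  the metric.\<close>

lemma tangent_transition:
  assumes w: "w \<in> tangent CB p" "w' \<in> tangent CB p"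
    and i: "(D, U, s) \<in> charts CB" "p \<in> patch CB (D, U, s)" and j: "(D', U', s') \<in> charts CB" "p \<in> patch CB (D', U', s')"
  shows "snd (w (D', U', s')) = snd (w (D, U, s))"
    and "met s' (snd (coord CB (D', U', s') p)) (w (D', U', s')) (w' (D', U', s'))
      = met s (snd (coord CB (D, U, s) p)) (w (D, U, s)) (w' (D, U, s))"
proof -
  let ?u = "coord CB (D, U, s) p" and ?v = "coord CB (D', U', s') p"
  have u: "?u \<in> D" "\<Psi> s ?u = p" using coord_in_cdom[OF i(2)] param_coord[OF i(2)] by auto
  have v: "?v \<in> D'" using coord_in_cdom[OF j(2)] by auto
  have d: "y (D', U', s') = frechet_derivative (coord CB (D', U', s') \<circ> \<Psi> s) (at ?u) (y (D, U, s))"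
    if "y \<in> tangent CB p" for y
    using that i j unfolding tangent_def by (metis (mono_tags, lifting) circle_bundle_simps(2) mem_Collect_eq)
  have up: "\<Psi> s ?u \<in> patch CB (D', U', s')" using u(2) j(2) by simp
  show "snd (w (D', U', s')) = snd (w (D, U, s))"
    unfolding d[OF w(1)] coord_transition_derivative[OF i(1) j(1) u(1) up] by simp
  have "G (D, U, s) ?u (w (D, U, s)) (w' (D, U, s)) = G (D', U', s') ?v (w (D', U', s')) (w' (D', U', s'))"
    using metric_compatible[OF i(1) j(1) u(1) up, of "w (D, U, s)" "w' (D, U, s)"] u(2) d[OF w(1)] d[OF w(2)] by simp
  then show "met s' (snd ?v) (w (D', U', s')) (w' (D', U', s')) = met s (snd ?u) (w (D, U, s)) (w' (D, U, s))"
    unfolding metric_eq[OF i(1) u(1)] metric_eq[OF j(1) v] by simp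
qed

lemma met_along:
  assumes s: "unit_section P E U s" and b: "tpt P (b t) \<in> U"
    and d: "(b has_vector_derivative b') (at t within T)" "(A has_vector_derivative A') (at t within T)"
      "(B has_vector_derivative B') (at t within T)"
  shows "((\<lambda>t. met s (b t) (A t) (B t)) has_vector_derivative
    dmet s (b t) b' (A t) (B t) + met s (b t) A' (B t) + met s (b t) (A t) B') (at t within T)"
proof -
  have P: "((\<lambda>t. \<Phi> s (b t)) has_vector_derivative d\<Phi> s (b t) b') (at t within T)"
    using vector_derivative_diff_chain_within[OF d(1) has_derivative_at_withinI[OF has_derivative_conn_form[OF s b]]]
    by (simp add: o_def)
  have F: "((\<lambda>t. F (b t)) has_vector_derivative dF (b t) b') (at t within T)"
    using vector_derivative_diff_chain_within[OF d(1) has_derivative_at_withinI[OF has_derivative_F]]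
    by (simp add: o_def)
  note fs = bounded_linear.has_vector_derivative[OF bounded_linear_fst] bounded_linear.has_vector_derivative[OF bounded_linear_snd]
  note mul = bounded_bilinear.has_vector_derivative[OF bounded_bilinear_mult]
  note inn = bounded_bilinear.has_vector_derivative[OF bounded_bilinear_inner]
  have "((\<lambda>t. met s (b t) (A t) (B t)) has_vector_derivative
     ((fst (A t) + \<Phi> s (b t) \<bullet> snd (A t)) * snd (snd B') + (fst A' + (\<Phi> s (b t) \<bullet> snd A' + d\<Phi> s (b t) b' \<bullet> snd (A t))) * snd (snd (B t)))
   + ((fst (B t) + \<Phi> s (b t) \<bullet> snd (B t)) * snd (snd A') + (fst B' + (\<Phi> s (b t) \<bullet> snd B' + d\<Phi> s (b t) b' \<bullet> snd (B t))) * snd (snd (A t)))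
   + ((F (b t) * snd (snd (A t))) * snd (snd B') + (F (b t) * snd (snd A') + dF (b t) b' * snd (snd (A t))) * snd (snd (B t)))
   + (snd (A t) \<bullet> snd B' + snd A' \<bullet> snd (B t))) (at t within T)"
    unfolding met_def by (intro has_vector_derivative_add mul inn fs P F d)
  then show ?thesis by (simp add: met_def dmet_def algebra_simps)
qed

lemma parallel_derivative:
  assumes par: "parallel_along CB G \<gamma> w" and ab: "0 \<le> a" "a < b" "b \<le> 1" "C1_curve_on CB {a..b} \<gamma>"
    and i: "(D, U, s) \<in> charts CB" and t: "t \<in> {a..b}" "\<gamma> t \<in> patch CB (D, U, s)"
  defines "d \<equiv> vector_derivative (coord CB (D, U, s) \<circ> \<gamma>) (at t within {a..b})"
  shows "((\<lambda>t. coord CB (D, U, s) (\<gamma> t)) has_vector_derivative d) (at t within {a..b})"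
    and "((\<lambda>t. w t (D, U, s)) has_vector_derivative - chr s (snd (coord CB (D, U, s) (\<gamma> t))) d (w t (D, U, s)))
      (at t within {a..b})"
proof -
  obtain d' where d': "((coord CB (D, U, s) \<circ> \<gamma>) has_vector_derivative d') (at t within {a..b})"
    using ab(4) i t unfolding C1_curve_on_def by blast
  then have "d = d'" unfolding d_def
    using vector_derivative_within_cbox[of a b t "coord CB (D, U, s) \<circ> \<gamma>" d'] ab(2) t(1) by simp
  with d' show "((\<lambda>t. coord CB (D, U, s) (\<gamma> t)) has_vector_derivative d) (at t within {a..b})"
    by (simp add: o_def)
  have "coord CB (D, U, s) (\<gamma> t) \<in> D" using coord_in_cdom[OF t(2)] by simp
  note ch = christoffel_eq[OF i this]
  show "((\<lambda>t. w t (D, U, s)) has_vector_derivative - chr s (snd (coord CB (D, U, s) (\<gamma> t))) d (w t (D, U, s)))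
      (at t within {a..b})"
    using par ab i t unfolding parallel_along_def ch[symmetric] d_def by blast
qed

lemma coord_patch:
  assumes "(D, U, s) \<in> charts CB" "p \<in> patch CB (D, U, s)"
  shows "unit_section P E U s" "tpt P (snd (coord CB (D, U, s) p)) \<in> U"
proof -
  have "coord CB (D, U, s) p \<in> D" using coord_in_cdom[OF assms(2)] by simp
  then show "unit_section P E U s" "tpt P (snd (coord CB (D, U, s) p)) \<in> U"
    using assms(1) by (auto simp: charts_circle_bundle)
qed

section \<open>Invariants of parallel transport on the circle bundle\<close>

context
  fixes \<gamma> assumes path: "piecewise_C1_path CB \<gamma>"
begin

text \<open>The z-component is the scalar product with the vertical field, and it is constant
  because \<open>chr\<close> has no z-component. The times are arbitrary because the screen part
  needs the value at intermediate times.\<close>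

lemma parallel_z:
  assumes i: "i \<in> charts CB" and j: "j \<in> charts CB"
    and ends: "\<gamma> t0 \<in> patch CB i" "\<gamma> t1 \<in> patch CB j"  "t0 \<in> {0..1}" "t1 \<in> {0..1}"
    and par: "parallel_along CB G \<gamma> w"
  shows "snd (snd (w t0 i)) = snd (snd (w t1 j))"
proof (rule conserved_quantity[OF continuous_atlas_CB path _ _ i j ends, of "\<lambda>i t. snd (snd (w t i))"])
  fix t and k l :: "('v, (real^'n) \<times> real) cb_index" assume t: "t \<in> {0..1}" "k \<in> charts CB" "l \<in> charts CB" "\<gamma> t \<in> patch CB k" "\<gamma> t \<in> patch CB l"
  moreover have "w t \<in> tangent CB (\<gamma> t)" using par t(1) unfolding parallel_along_def by blast
  ultimately show "snd (snd (w t k)) = snd (snd (w t l))"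
    using tangent_transition(1) by (cases k, cases l) metis
next
  fix a b t and k :: "('v, (real^'n) \<times> real) cb_index"
  assume ab: "0 \<le> a" "a < b" "b \<le> 1" "C1_curve_on CB {a..b} \<gamma>" and k: "k \<in> charts CB" and t: "t \<in> {a..b}" "\<gamma> t \<in> patch CB k"
  obtain D U s where ks: "k = (D, U, s)" by (cases k)
  note d = parallel_derivative(2)[OF par ab k[unfolded ks] t(1) t(2)[unfolded ks]]
  from bounded_linear.has_vector_derivative[OF bounded_linear_snd bounded_linear.has_vector_derivative[OF bounded_linear_snd d]]
  show "((\<lambda>t. snd (snd (w t k))) has_vector_derivative 0) (at t within {a..b})"
    by (simp add: ks chr_def force_def)
qed

text \<open>The base part of \<open>chr\<close> carries the product of both z-components, so it
  vanishes once the field has none.\<close>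

lemma parallel_screen:
  assumes i: "i \<in> charts CB" and j: "j \<in> charts CB"
    and ends: "\<gamma> 0 \<in> patch CB i" "\<gamma> 1 \<in> patch CB j"
    and par: "parallel_along CB G \<gamma> w" and z: "snd (snd (w 0 i)) = 0"
  shows "snd (w 0 i) = snd (w 1 j)"
proof (rule conserved_quantity[OF continuous_atlas_CB path _ _ i j ends, of "\<lambda>i t. snd (w t i)"])
  fix t and k l :: "('v, (real^'n) \<times> real) cb_index" assume t: "t \<in> {0..1}" "k \<in> charts CB" "l \<in> charts CB" "\<gamma> t \<in> patch CB k" "\<gamma> t \<in> patch CB l"
  moreover have "w t \<in> tangent CB (\<gamma> t)" using par t(1) unfolding parallel_along_def by blast
  ultimately show "snd (w t k) = snd (w t l)"
    using tangent_transition(1) by (cases k, cases l) metis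
next
  fix a b t and k :: "('v, (real^'n) \<times> real) cb_index"
  assume ab: "0 \<le> a" "a < b" "b \<le> 1" "C1_curve_on CB {a..b} \<gamma>" and k: "k \<in> charts CB" and t: "t \<in> {a..b}" "\<gamma> t \<in> patch CB k"
  obtain D U s where ks: "k = (D, U, s)" by (cases k)
  note d = parallel_derivative(2)[OF par ab k[unfolded ks] t(1) t(2)[unfolded ks]]
  have "snd (snd (w t k)) = 0"
    using parallel_z[OF i k ends(1) t(2) _ _ par] z ab t(1) by simp
  with bounded_linear.has_vector_derivative[OF bounded_linear_snd d]
  show "((\<lambda>t. snd (w t k)) has_vector_derivative 0) (at t within {a..b})"
    by (simp add: ks chr_def)
qed auto

lemma parallel_metric:
  assumes i: "i \<in> charts CB" and j: "j \<in> charts CB"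
    and ends: "\<gamma> 0 \<in> patch CB i" "\<gamma> 1 \<in> patch CB j"
    and par: "parallel_along CB G \<gamma> w" "parallel_along CB G \<gamma> w'"
  shows "G i (coord CB i (\<gamma> 0)) (w 0 i) (w' 0 i) = G j (coord CB j (\<gamma> 1)) (w 1 j) (w' 1 j)"
proof -
  \<comment> \<open>\<open>snd (snd k)\<close> is the section in the chart index. With
    \<open>met\<close> in place of the metric, \<open>X\<close> has the shape to which
    \<open>met_along\<close> applies.\<close>
  define X where "X k t = met (snd (snd k)) (snd (coord CB k (\<gamma> t))) (w t k) (w' t k)" for k t
  have X: "G k (coord CB k (\<gamma> t)) (w t k) (w' t k) = X k t" if "k \<in> charts CB" "\<gamma> t \<in> patch CB k" for k t
  proof -
    obtain D U s where ks: "k = (D, U, s)" by (cases k)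
    have "coord CB (D, U, s) (\<gamma> t) \<in> D" using coord_in_cdom[of "\<gamma> t" CB "(D, U, s)"] that ks by simp
    from metric_eq[OF _ this] show ?thesis using that(1) by (simp add: ks X_def)
  qed
  have "X i 0 = X j 1"
  proof (rule conserved_quantity[OF continuous_atlas_CB path _ _ i j ends])
    fix t and k l :: "('v, (real^'n) \<times> real) cb_index" assume t: "t \<in> {0..1}" "k \<in> charts CB" "l \<in> charts CB" "\<gamma> t \<in> patch CB k" "\<gamma> t \<in> patch CB l"
    moreover have "w t \<in> tangent CB (\<gamma> t)" "w' t \<in> tangent CB (\<gamma> t)" using par t(1) unfolding parallel_along_def by blast+
    ultimately show "X k t = X l t"
      using tangent_transition(2) unfolding X_def by (cases k, cases l) (metis snd_conv)
  next
    fix a b t and k :: "('v, (real^'n) \<times> real) cb_index"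
    assume ab: "0 \<le> a" "a < b" "b \<le> 1" "C1_curve_on CB {a..b} \<gamma>" and k: "k \<in> charts CB" and t: "t \<in> {a..b}" "\<gamma> t \<in> patch CB k"
    obtain D U s where ks: "k = (D, U, s)" by (cases k)
    note k' = k[unfolded ks] t(2)[unfolded ks]
    note s = coord_patch[OF k']
    let ?b = "snd (coord CB (D, U, s) (\<gamma> t))"
    let ?d = "vector_derivative (coord CB (D, U, s) \<circ> \<gamma>) (at t within {a..b})"
    note d = parallel_derivative[OF par(1) ab k'(1) t(1) k'(2)] parallel_derivative(2)[OF par(2) ab k'(1) t(1) k'(2)]
    have db: "((\<lambda>t. snd (coord CB (D, U, s) (\<gamma> t))) has_vector_derivative snd ?d) (at t within {a..b})"
      by (rule bounded_linear.has_vector_derivative[OF bounded_linear_snd d(1)])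
    let ?A = "w t (D, U, s)" and ?B = "w' t (D, U, s)"
    have "met s ?b (- chr s ?b ?d ?A) ?B = - met s ?b (chr s ?b ?d ?A) ?B"
      "met s ?b ?A (- chr s ?b ?d ?B) = - met s ?b (chr s ?b ?d ?B) ?A"
      using bilinear_lneg[OF bilinear_met] bilinear_rneg[OF bilinear_met] metric_symmetric by metis+
    \<comment> \<open>Metric compatibility: adding the Koszul identities for the pairs
      \<open>?A\<close>, \<open>?B\<close> and \<open>?B\<close>, \<open>?A\<close> cancels all
      derivatives except the one along the curve.\<close>
    then have "dmet s ?b (snd ?d) ?A ?B + met s ?b (- chr s ?b ?d ?A) ?B + met s ?b ?A (- chr s ?b ?d ?B) = 0"
      using Koszul[OF s, of ?d ?A ?B] Koszul[OF s, of ?d ?B ?A] dmet_symmetric[of s ?b "snd ?d" ?A ?B]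
      by simp
    with met_along[OF s db d(2,3)]
    show "(X k has_vector_derivative 0) (at t within {a..b})"
      by (simp add: ks X_def[abs_def])
  qed auto
  then show ?thesis using X i j ends by simp
qed

end

lemma met_vertical: "met s b x (1, 0) = snd (snd x)"
  by (simp add: met_def)

lemma met_horizontal: "met s b x (horizontal s b j) = fst (snd x) $ j"
proof -
  have "snd x \<bullet> (axis j 1, 0) = fst (snd x) $ j" by (simp add: inner_prod_def inner_axis)
  then show ?thesis by (simp add: met_def horizontal_def)
qed

text \<open>\<sigma> enumerates the unordered index type of y, since adapted bases are indexed by
  natural numbers.\<close>

lemma adapted_frame:
  assumes \<sigma>: "bij_betw \<sigma> {..<CARD('n)} (UNIV :: 'n set)"
  shows "adapted CARD('n) (met s b) (1, 0) (\<lambda>k. horizontal s b (\<sigma> k)) (null_frame s b)"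
proof
  show "bilinear (met s b)" by (rule bilinear_met)
  show "met s b x y = met s b y x" for x y by (rule metric_symmetric)
  let ?S = "{(1, 0), null_frame s b} \<union> (\<lambda>k. horizontal s b (\<sigma> k)) ` {..<CARD('n)}"
  have "horizontal s b j \<in> ?S" for j
  proof -
    have "j \<in> \<sigma> ` {..<CARD('n)}" using \<sigma> by (simp add: bij_betw_def)
    then show ?thesis by blast
  qed
  then have h: "horizontal s b j \<in> span ?S" for j using span_base by blast
  have "x \<in> span ?S" for x
    by (subst frame_span[of x s b]) (intro span_add span_scale span_sum h span_base; simp)
  then have sp: "span ?S = UNIV" by blast
  have inj: "\<sigma> i = \<sigma> j \<longleftrightarrow> i = j" if "i < CARD('n)" "j < CARD('n)" for i j
    using \<sigma> that by (auto simp: bij_betw_def inj_on_def)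
  show "adapted_basis CARD('n) (met s b) (1, 0) (\<lambda>k. horizontal s b (\<sigma> k)) (null_frame s b)"
    unfolding adapted_basis_def using sp by (simp add: frame_products inj)
qed

lemma holonomy_screen_trivial:
  assumes i: "(D, U, s) \<in> charts CB" and u: "u \<in> D"
    and L: "L \<in> restricted_holonomy CB G (D, U, s) u"
    and \<sigma>: "bij_betw \<sigma> {..<CARD('n)} (UNIV :: 'n set)"
  shows "adapted.screen_trivial CARD('n) (met s (snd u)) (1, 0) (\<lambda>k. horizontal s (snd u) (\<sigma> k)) L"
proof -
  let ?i = "(D, U, s)"
  define p where "p = \<Psi> s u"
  interpret adapted "CARD('n)" "met s (snd u)" "(1, 0)" "\<lambda>k. horizontal s (snd u) (\<sigma> k)" "null_frame s (snd u)"
    by (rule adapted_frame[OF \<sigma>])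
  obtain \<gamma> where \<gamma>: "piecewise_C1_path CB \<gamma>" "\<gamma> 0 = p" "\<gamma> 1 = p"
    "\<And>v. \<exists>w. parallel_along CB G \<gamma> w \<and> w 0 ?i = v \<and> w 1 ?i = L v"
    using L unfolding restricted_holonomy_def Let_def p_def by auto
  have pi: "p \<in> patch CB ?i" using param_in_patch[of u CB ?i] u by (simp add: p_def)
  have cp: "coord CB ?i p = u" by (rule coord_eqI[OF i u]) (simp add: p_def)
  have ends: "\<gamma> 0 \<in> patch CB ?i" "\<gamma> 1 \<in> patch CB ?i" using \<gamma>(2,3) pi by auto
  show ?thesis
    unfolding screen_trivial_def
  proof (intro conjI allI impI)
    fix x y
    obtain w where w: "parallel_along CB G \<gamma> w" "w 0 ?i = x" "w 1 ?i = L x" using \<gamma>(4) by blast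
    obtain w' where w': "parallel_along CB G \<gamma> w'" "w' 0 ?i = y" "w' 1 ?i = L y" using \<gamma>(4) by blast
    show "met s (snd u) (L x) (L y) = met s (snd u) x y"
      using parallel_metric[OF \<gamma>(1) i i ends w(1) w'(1)] w w' \<gamma>(2,3) cp metric_eq[OF i u] by simp
    show "met s (snd u) (L x) (1, 0) = met s (snd u) x (1, 0)"
      using parallel_z[OF \<gamma>(1) i i ends _ _ w(1)] w by (simp add: met_vertical)
  next
    fix x k assume x: "met s (snd u) x (1, 0) = 0"
    obtain w where w: "parallel_along CB G \<gamma> w" "w 0 ?i = x" "w 1 ?i = L x" using \<gamma>(4) by blast
    have "snd (L x) = snd x"
      using parallel_screen[OF \<gamma>(1) i i ends w(1)] w x by (simp add: met_vertical)
    then show "met s (snd u) (L x) (horizontal s (snd u) (\<sigma> k)) = met s (snd u) x (horizontal s (snd u) (\<sigma> k))"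
      by (simp add: met_horizontal)
  qed
qed

theorem pp_wave_CB:
  assumes ind: "\<And>i u. i \<in> charts CB \<Longrightarrow> u \<in> cdom CB i \<Longrightarrow> indecomposable (G i u) (hol CB G i u)"
  shows "pp_wave CARD('n) CB G"
  unfolding pp_wave_def
proof (intro conjI ballI)
  show "lorentzian_manifold CB G" by (rule lorentzian_manifold_CB)
  show "DIM(real \<times> (real^'n) \<times> real) = CARD('n) + 2" by simp
next
  fix i u assume i: "i \<in> charts CB" and u: "u \<in> cdom CB i"
  obtain D U s where is': "i = (D, U, s)" by (cases i)
  have c: "(D, U, s) \<in> charts CB" and uD: "u \<in> D" using i u is' by auto
  have G: "G i u = met s (snd u)" using metric_eq[OF c uD] is' by (simp add: fun_eq_iff)
  obtain \<sigma> :: "nat \<Rightarrow> 'n" where \<sigma>: "bij_betw \<sigma> {..<CARD('n)} UNIV"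
    using ex_bij_betw_nat_finite[of "UNIV :: 'n set"] by (auto simp: atLeast0LessThan)
  interpret adapted "CARD('n)" "met s (snd u)" "(1, 0)" "\<lambda>k. horizontal s (snd u) (\<sigma> k)" "null_frame s (snd u)"
    by (rule adapted_frame[OF \<sigma>])
  have hol: "hol CB G i u = {T. \<exists>w. has_matrix CARD('n) (1, 0) (\<lambda>k. horizontal s (snd u) (\<sigma> k)) (null_frame s (snd u)) T 0 (\<lambda>_ _. 0) w}"
    unfolding hol_def
  proof (rule lie_algebra_of_indecomposable)
    show "0 < CARD('n)" by simp
    show "screen_trivial L" if "L \<in> restricted_holonomy CB G i u" for L
      using holonomy_screen_trivial[OF c uD _ \<sigma>] that is' by simp
    show "L \<circ> L' \<in> restricted_holonomy CB G i u"
      if "L \<in> restricted_holonomy CB G i u" "L' \<in> restricted_holonomy CB G i u" for L L'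
      by (rule restricted_holonomy_comp[OF christoffel_scale i u that(2,1)])
    show "indecomposable (met s (snd u)) (lie_algebra_of (restricted_holonomy CB G i u))"
      using ind[OF i u] unfolding hol_def G .
  qed
  show "reducible (hol CB G i u)" unfolding hol by (rule reducible_nil) simp
  show "indecomposable (G i u) (hol CB G i u)" by (rule ind[OF i u])
  show "\<exists>v e w0. adapted_basis CARD('n) (G i u) v e w0 \<and>
           hol CB G i u = {T. \<exists>w. has_matrix CARD('n) v e w0 T 0 (\<lambda>_ _. 0) w}"
    using basis hol G by metis
qed

end

section \<open>Global solutions of ordinary differential equations\<close>

text \<open>The signed integral from \<open>0\<close> to \<open>t\<close>: for
  \<open>t \<noteq> 0\<close> one of the two intervals is empty and contributes
  \<open>0\<close>.\<close>

definition antideriv :: "(real \<Rightarrow> 'a::banach) \<Rightarrow> real \<Rightarrow> 'a" where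
  "antideriv g t = integral {0..t} g - integral {t..0} g"

lemma antideriv_0 [simp]: "antideriv g 0 = 0"
  by (simp add: antideriv_def)

lemma antideriv_diff:
  assumes "continuous_on UNIV g" "continuous_on UNIV h"
  shows "antideriv g t - antideriv h t = antideriv (\<lambda>s. g s - h s) t"
proof -
  have "g integrable_on {a..b}" "h integrable_on {a..b}" for a b
    using assms by (auto intro!: integrable_continuous_real intro: continuous_on_subset)
  then show ?thesis by (simp add: antideriv_def integral_diff)
qed

lemma has_vector_derivative_antideriv:
  assumes g: "continuous_on UNIV g"
  shows "(antideriv g has_vector_derivative g t) (at t)"
proof -
  define a where "a = - \<bar>t\<bar> - 1"
  define b where "b = \<bar>t\<bar> + 1"
  have int: "g integrable_on {r..s}" for r s
    using g by (auto intro!: integrable_continuous_real intro: continuous_on_subset)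
  have eq: "antideriv g s = integral {a..s} g - integral {a..0} g" if s: "s \<in> {a..b}" for s
  proof (cases "0 \<le> s")
    case True
    have "integral {a..0} g + integral {0..s} g = integral {a..s} g"
      by (rule Henstock_Kurzweil_Integration.integral_combine) (use True int in \<open>auto simp: a_def\<close>)
    moreover have "integral {s..0} g = 0" using True by (cases "s = 0") auto
    ultimately show ?thesis by (simp add: antideriv_def algebra_simps)
  next
    case False
    have "integral {a..s} g + integral {s..0} g = integral {a..0} g"
      by (rule Henstock_Kurzweil_Integration.integral_combine) (use False s int in auto)
    then show ?thesis using False by (simp add: antideriv_def algebra_simps)
  qed
  have "((\<lambda>s. integral {a..s} g) has_vector_derivative g t) (at t within {a..b})"
    by (rule integral_has_vector_derivative) (use g in \<open>auto simp: a_def b_def intro: continuous_on_subset\<close>)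
  then have "((\<lambda>s. integral {a..s} g - integral {a..0} g) has_vector_derivative g t) (at t within {a..b})"
    by (auto intro!: derivative_eq_intros)
  then have "(antideriv g has_vector_derivative g t) (at t within {a..b})"
    by (rule has_vector_derivative_transform[rotated 2]) (use eq in \<open>auto simp: a_def b_def\<close>)
  moreover have "at t within {a..b} = at t"
    by (rule at_within_interior) (auto simp: a_def b_def)
  ultimately show ?thesis by simp
qed

text \<open>Integrating the exponential gains the factor \<open>1 / k\<close>, which turns into a
  contraction factor when \<open>k\<close> exceeds the Lipschitz constant.\<close>

lemma norm_antideriv_le:
  assumes g: "continuous_on UNIV g" and k: "k > 0" and C: "C \<ge> 0" and bd: "\<And>s. norm (g s) \<le> C * exp (k * \<bar>s\<bar>)"
  shows "norm (antideriv g t) \<le> C / k * exp (k * \<bar>t\<bar>)"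
proof -
  have int: "g integrable_on {r..s}" for r s
    using g by (auto intro!: integrable_continuous_real intro: continuous_on_subset)
  show ?thesis
  proof (cases "0 \<le> t")
    case True
    have "((\<lambda>s. C * exp (k * s)) has_integral (C / k * exp (k * t) - C / k * exp (k * 0))) {0..t}"
      by (rule fundamental_theorem_of_calculus[OF True])
        (use k in \<open>auto intro!: derivative_eq_intros simp flip: has_real_derivative_iff_has_vector_derivative\<close>)
    note hi = this
    have "norm (integral {0..t} g) \<le> integral {0..t} (\<lambda>s. C * exp (k * s))"
    proof (rule integral_norm_bound_integral[OF int has_integral_integrable[OF hi]])
      show "norm (g s) \<le> C * exp (k * s)" if "s \<in> {0..t}" for s using bd[of s] that by simp
    qed
    also have "\<dots> = C / k * exp (k * t) - C / k" using integral_unique[OF hi] by simp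
    finally have "norm (integral {0..t} g) \<le> C / k * exp (k * t)" using C k by (smt (verit) divide_nonneg_pos)
    moreover have "integral {t..0} g = 0" using True by (cases "t = 0") auto
    ultimately show ?thesis using True by (simp add: antideriv_def)
  next
    case False
    have "((\<lambda>s. C * exp (- k * s)) has_integral (- C / k * exp (- k * 0) - (- C / k * exp (- k * t)))) {t..0}"
      by (rule fundamental_theorem_of_calculus)
        (use k False in \<open>auto intro!: derivative_eq_intros simp flip: has_real_derivative_iff_has_vector_derivative\<close>)
    note hi = this
    have "norm (integral {t..0} g) \<le> integral {t..0} (\<lambda>s. C * exp (- k * s))"
    proof (rule integral_norm_bound_integral[OF int has_integral_integrable[OF hi]])
      show "norm (g s) \<le> C * exp (- k * s)" if "s \<in> {t..0}" for s using bd[of s] that by simp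
    qed
    also have "\<dots> = C / k * exp (- k * t) - C / k" using integral_unique[OF hi] by simp
    finally have "norm (integral {t..0} g) \<le> C / k * exp (- k * t)" using C k by (smt (verit) divide_nonneg_pos)
    then show ?thesis using False by (simp add: antideriv_def)
  qed
qed

text \<open>The Picard operator on all of \<open>\<real>\<close> is a contraction for the norm weighted by \<open>exp (- 2 K \<bar>t\<bar>)\<close>.\<close>

theorem global_lipschitz_ode:
  fixes H :: "'a::banach \<Rightarrow> 'a"
  assumes lip: "\<And>x y. norm (H x - H y) \<le> L * norm (x - y)"
  obtains w where "w t0 = w0" "\<And>t. (w has_vector_derivative H (w t)) (at t)"
proof -
  \<comment> \<open>\<open>L\<close> is not assumed positive, while the weight requires a positive
    rate.\<close>
  define K where "K = \<bar>L\<bar> + 1"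
  have K: "K > 0" by (simp add: K_def)
  have lipK: "norm (H x - H y) \<le> K * norm (x - y)" for x y
  proof -
    have "L \<le> K" unfolding K_def by linarith
    from mult_right_mono[OF this norm_ge_zero[of "x - y"]] lip[of x y] show ?thesis by linarith
  qed
  have cH: "continuous_on UNIV H"
    by (rule lipschitz_on_continuous_on[of K]) (use lipK K in \<open>auto intro!: lipschitz_onI simp: dist_norm\<close>)
  \<comment> \<open>The rate is twice the Lipschitz constant, so the contraction factor is
    \<open>K / (2 * K) = 1/2\<close>.\<close>
  define e where "e t = exp (2 * K * \<bar>t\<bar>)" for t :: real
  have e: "e t > 0" "e t \<ge> 1" "continuous_on UNIV e" for t
    unfolding e_def[abs_def] using K by (auto intro!: continuous_intros)
  \<comment> \<open>Solutions may grow exponentially, so the bounded quotient by \<open>e\<close> is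
    the unknown: \<open>W h\<close> removes the weight, and \<open>R\<close> below is the Picard
    operator conjugated by it.\<close>
  define W where "W h t = e t *\<^sub>R apply_bcontfun h t" for h :: "real \<Rightarrow>\<^sub>C 'a" and t
  have cW: "continuous_on UNIV (\<lambda>t. H (W h t))" for h
    unfolding W_def by (intro continuous_on_compose2[OF cH] continuous_intros e(3)) auto
  define R where "R h t = (1 / e t) *\<^sub>R (w0 + antideriv (\<lambda>t. H (W h t)) t)" for h t
  have cR: "continuous_on UNIV (R h)" for h
  proof -
    have "continuous_on UNIV (antideriv (\<lambda>t. H (W h t)))"
      using has_vector_derivative_antideriv[OF cW] has_vector_derivative_continuous
      by (intro continuous_at_imp_continuous_on) blast
    then show ?thesis unfolding R_def[abs_def]
      using e by (intro continuous_intros) (auto simp: less_imp_neq[THEN not_sym])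
  qed
  have bR: "R h \<in> bcontfun" for h
    unfolding bcontfun_def
  proof (intro CollectI conjI cR)
    have "norm (R h t) \<le> norm w0 + (norm (H 0) + K * norm h) / (2 * K)" for t
    proof -
      have "norm (H (W h s)) \<le> (norm (H 0) + K * norm h) * exp (2 * K * \<bar>s\<bar>)" for s
      proof -
        have "norm (H (W h s)) \<le> norm (H 0) + norm (H (W h s) - H 0)" by (rule norm_triangle_sub)
        also have "\<dots> \<le> norm (H 0) + K * norm (W h s)" using lipK[of "W h s" 0] by simp
        also have "norm (W h s) \<le> e s * norm h"
          using e(1)[of s] norm_bounded[of h s] by (simp add: W_def)
        also have "norm (H 0) \<le> norm (H 0) * e s" using e(2)[of s] by (simp add: mult_le_cancel_left1)
        finally show ?thesis using K by (simp add: e_def algebra_simps)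
      qed
      from norm_antideriv_le[OF cW _ _ this, of t] K
      have "norm (antideriv (\<lambda>t. H (W h t)) t) \<le> (norm (H 0) + K * norm h) / (2 * K) * e t"
        by (simp add: e_def)
      then have "norm (w0 + antideriv (\<lambda>t. H (W h t)) t) \<le> norm w0 * e t + (norm (H 0) + K * norm h) / (2 * K) * e t"
        using norm_triangle_ineq[of w0 "antideriv (\<lambda>t. H (W h t)) t"] mult_left_mono[OF e(2)[of t] norm_ge_zero[of w0]]
        by simp
      then have "norm (w0 + antideriv (\<lambda>t. H (W h t)) t) / e t \<le> norm w0 + (norm (H 0) + K * norm h) / (2 * K)"
        using e(1)[of t] by (simp add: pos_divide_le_eq distrib_right)
      then show ?thesis using e(1)[of t] by (simp add: R_def)
    qed
    then show "bounded (range (R h))" unfolding bounded_iff by blast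
  qed
  have ap: "apply_bcontfun (Bcontfun (R h)) = R h" for h using bR by (rule Bcontfun_inverse)
  have contr: "dist (Bcontfun (R h)) (Bcontfun (R h')) \<le> 1/2 * dist h h'" for h h'
  proof (rule dist_bound)
    fix t
    have "norm (H (W h s) - H (W h' s)) \<le> (K * dist h h') * exp (2 * K * \<bar>s\<bar>)" for s
    proof -
      have "norm (H (W h s) - H (W h' s)) \<le> K * norm (W h s - W h' s)" by (rule lipK)
      also have "norm (W h s - W h' s) = e s * dist (apply_bcontfun h s) (apply_bcontfun h' s)"
        using e(1)[of s] by (simp add: W_def dist_norm flip: scaleR_diff_right)
      also have "\<dots> \<le> e s * dist h h'" using e(1)[of s] dist_bounded[of h s h'] by simp
      finally show ?thesis using K by (simp add: e_def algebra_simps)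
    qed
    from norm_antideriv_le[OF continuous_on_diff[OF cW cW] _ _ this, of t] K
    have "norm (antideriv (\<lambda>t. H (W h t)) t - antideriv (\<lambda>t. H (W h' t)) t) \<le> dist h h' / 2 * e t"
      unfolding antideriv_diff[OF cW cW] by (simp add: e_def)
    moreover have "R h t - R h' t = (1 / e t) *\<^sub>R (antideriv (\<lambda>t. H (W h t)) t - antideriv (\<lambda>t. H (W h' t)) t)"
      by (simp add: R_def algebra_simps)
    ultimately show "dist (apply_bcontfun (Bcontfun (R h)) t) (apply_bcontfun (Bcontfun (R h')) t) \<le> 1/2 * dist h h'"
      using e(1)[of t] by (simp add: ap dist_norm pos_divide_le_eq)
  qed
  then obtain h where h: "Bcontfun (R h) = h"
    using banach_fix_type[of "1/2" "\<lambda>h. Bcontfun (R h)"] by auto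
  have fix': "apply_bcontfun h t = R h t" for t using ap[of h] h by simp
  have W: "W h t = w0 + antideriv (\<lambda>t. H (W h t)) t" for t
    using e(1)[of t] by (simp add: W_def[of h t] fix' R_def)
  have dW: "(W h has_vector_derivative H (W h t)) (at t)" for t
  proof -
    have "((\<lambda>t. w0 + antideriv (\<lambda>t. H (W h t)) t) has_vector_derivative 0 + H (W h t)) (at t)"
      by (intro has_vector_derivative_add has_vector_derivative_const has_vector_derivative_antideriv cW)
    moreover have "(\<lambda>t. w0 + antideriv (\<lambda>t. H (W h t)) t) = W h" by (rule ext) (rule W[symmetric])
    ultimately show ?thesis by (simp only: add_0_left)
  qed
  show thesis
  \<comment> \<open>The fixed point starts at time \<open>0\<close>; the equation is autonomous, so
    a shift moves the start to \<open>t0\<close>.\<close>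
  proof (rule that[of "\<lambda>t. W h (t - t0)"])
    show "W h (t0 - t0) = w0" unfolding W[of "t0 - t0"] by simp
    show "((\<lambda>t. W h (t - t0)) has_vector_derivative H (W h (t - t0))) (at t)" for t
    proof -
      have "((\<lambda>t. t - t0) has_vector_derivative 1) (at t)"
        unfolding has_real_derivative_iff_has_vector_derivative[symmetric] by (auto intro!: derivative_eq_intros)
      from vector_diff_chain_at[OF this dW] show ?thesis by (simp add: o_def)
    qed
  qed
qed

text \<open>A Gronwall argument for the squared distance \<open>q\<close>: from
  \<open>\<bar>q' t\<bar> \<le> 2 * L * q t\<close>, the factor \<open>exp (- 2 * L * s)\<close>
  makes the product nonincreasing to the right of \<open>t0\<close>, and the inverse factor handles
  the left.\<close>

theorem lipschitz_ode_unique: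
  fixes H :: "'a::real_inner \<Rightarrow> 'a"
  assumes lip: "\<And>x y. norm (H x - H y) \<le> L * norm (x - y)"
    and K: "convex K" "t0 \<in> K" "t \<in> K"
    and w1: "\<And>t. t \<in> K \<Longrightarrow> (w1 has_vector_derivative H (w1 t)) (at t)"
    and w2: "\<And>t. t \<in> K \<Longrightarrow> (w2 has_vector_derivative H (w2 t)) (at t)"
    and eq: "w1 t0 = w2 t0"
  shows "w1 t = w2 t"
proof -
  define q where "q t = (w1 t - w2 t) \<bullet> (w1 t - w2 t)" for t
  define q' where "q' t = 2 * ((w1 t - w2 t) \<bullet> (H (w1 t) - H (w2 t)))" for t
  have dq: "(q has_real_derivative q' t) (at t)" if "t \<in> K" for t
    unfolding has_real_derivative_iff_has_vector_derivative q_def[abs_def] q'_def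
    using bounded_bilinear.has_vector_derivative[OF bounded_bilinear_inner
        has_vector_derivative_diff[OF w1[OF that] w2[OF that]] has_vector_derivative_diff[OF w1[OF that] w2[OF that]]]
    by (simp add: inner_commute)
  have bq: "\<bar>q' t\<bar> \<le> 2 * L * q t" for t
  proof -
    have "\<bar>(w1 t - w2 t) \<bullet> (H (w1 t) - H (w2 t))\<bar> \<le> norm (w1 t - w2 t) * norm (H (w1 t) - H (w2 t))"
      by (rule Cauchy_Schwarz_ineq2)
    also have "\<dots> \<le> norm (w1 t - w2 t) * (L * norm (w1 t - w2 t))" by (intro mult_left_mono lip) auto
    also have "\<dots> = L * q t" by (simp add: q_def dot_square_norm power2_eq_square)
    finally show ?thesis by (simp add: q'_def abs_mult)
  qed
  have q0: "q t0 = 0" using eq by (simp add: q_def)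
  have seg: "s \<in> K" if "min t0 t \<le> s" "s \<le> max t0 t" for s
  proof -
    have "s \<in> closed_segment t0 t" using that by (auto simp: closed_segment_eq_real_ivl min_def max_def split: if_splits)
    then show ?thesis using K convex_contains_segment by blast
  qed
  have "q t \<le> 0"
  proof (cases "t0 \<le> t")
    case True
    have "exp (- 2 * L * t0) * q t0 \<ge> exp (- 2 * L * t) * q t"
    proof (rule DERIV_nonpos_imp_nonincreasing[OF True])
      fix s assume s: "t0 \<le> s" "s \<le> t"
      have "((\<lambda>s. exp (- 2 * L * s) * q s) has_real_derivative exp (- 2 * L * s) * (q' s - 2 * L * q s)) (at s)"
        using seg[of s] s True by (auto intro!: derivative_eq_intros dq simp: algebra_simps)
      moreover have "exp (- 2 * L * s) * (q' s - 2 * L * q s) \<le> 0"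
        using bq[of s] by (intro mult_nonneg_nonpos) auto
      ultimately show "\<exists>y. ((\<lambda>s. exp (- 2 * L * s) * q s) has_real_derivative y) (at s) \<and> y \<le> 0" by blast
    qed
    then show ?thesis using q0 by (simp add: mult_le_0_iff)
  next
    case False
    then have le: "t \<le> t0" by simp
    have "exp (2 * L * t) * q t \<le> exp (2 * L * t0) * q t0"
    proof (rule DERIV_nonneg_imp_nondecreasing[OF le])
      fix s assume s: "t \<le> s" "s \<le> t0"
      have "((\<lambda>s. exp (2 * L * s) * q s) has_real_derivative exp (2 * L * s) * (q' s + 2 * L * q s)) (at s)"
        using seg[of s] s le by (auto intro!: derivative_eq_intros dq simp: algebra_simps)
      moreover have "exp (2 * L * s) * (q' s + 2 * L * q s) \<ge> 0"
        using bq[of s] by (intro mult_nonneg_nonneg) auto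
      ultimately show "\<exists>y. ((\<lambda>s. exp (2 * L * s) * q s) has_real_derivative y) (at s) \<and> y \<ge> 0" by blast
    qed
    then show ?thesis using q0 by (simp add: mult_le_0_iff)
  qed
  then have "q t = 0" using inner_ge_zero[of "w1 t - w2 t"] unfolding q_def by linarith
  then show ?thesis by (simp add: q_def)
qed

text \<open>The partial derivatives are continuous and periodic, hence bounded; on the convex
  universal cover the mean value inequality turns this into a Lipschitz bound.\<close>

lemma periodic_smooth_lipschitz:
  fixes P :: "'b::euclidean_space" and g :: "'b \<Rightarrow> 'c::real_normed_vector"
  assumes per: "\<And>k. k \<in> Basis \<Longrightarrow> 0 < P \<bullet> k" and g: "smooth_on UNIV g"
    and pg: "\<And>b b'. tpt P b = tpt P b' \<Longrightarrow> g b = g b'"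
  obtains C where "\<And>x y. norm (g x - g y) \<le> C * norm (x - y)"
proof -
  have d: "(g has_derivative frechet_derivative g (at b)) (at b)" for b
    by (rule smooth_on_has_derivative[OF g UNIV_I])
  have "\<exists>C. \<forall>b. norm (frechet_derivative g (at b) k) \<le> C" for k
  proof -
    have c: "continuous_on UNIV (\<lambda>b. frechet_derivative g (at b) k)"
      by (rule smooth_on_imp_continuous_on[OF smooth_on_frechet_derivative[OF g]])
    have p: "frechet_derivative g (at b) k = frechet_derivative g (at b') k" if t: "tpt P b = tpt P b'" for b b'
    proof -
      have "g differentiable (at b)" using d unfolding differentiable_def by blast
      from periodic_frechet_derivative[OF pg t this] show ?thesis by simp
    qed
    obtain C where "\<And>b. norm (frechet_derivative g (at b) k) \<le> C"
      by (rule periodic_bounded[OF per c p]) auto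
    then show ?thesis by blast
  qed
  then obtain C where C: "\<And>b k. norm (frechet_derivative g (at b) k) \<le> C k" by metis
  have on: "onorm (frechet_derivative g (at b)) \<le> (\<Sum>k\<in>Basis. C k)" for b
  proof (rule onorm_le)
    fix v
    have lin: "linear (frechet_derivative g (at b))" using d has_derivative_linear by blast
    have "frechet_derivative g (at b) v = (\<Sum>k\<in>Basis. (v \<bullet> k) *\<^sub>R frechet_derivative g (at b) k)"
      using linear_sum[OF lin, of "\<lambda>k. (v \<bullet> k) *\<^sub>R k" Basis] linear_scale[OF lin]
      by (simp add: euclidean_representation)
    then have "norm (frechet_derivative g (at b) v) \<le> (\<Sum>k\<in>Basis. norm ((v \<bullet> k) *\<^sub>R frechet_derivative g (at b) k))"
      using norm_sum by metis
    also have "\<dots> \<le> (\<Sum>k\<in>Basis. norm v * C k)"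
    proof (rule sum_mono)
      fix k :: 'b assume "k \<in> Basis"
      then have "\<bar>v \<bullet> k\<bar> * norm (frechet_derivative g (at b) k) \<le> norm v * C k"
        by (intro mult_mono C Basis_le_norm) auto
      then show "norm ((v \<bullet> k) *\<^sub>R frechet_derivative g (at b) k) \<le> norm v * C k" by simp
    qed
    also have "\<dots> = (\<Sum>k\<in>Basis. C k) * norm v" by (simp add: sum_distrib_left mult.commute)
    finally show "norm (frechet_derivative g (at b) v) \<le> (\<Sum>k\<in>Basis. C k) * norm v" .
  qed
  show thesis
    by (rule that, rule differentiable_bound[OF convex_UNIV _ on]) (use d in auto)
qed

section \<open>Lifts of base curves\<close>

context hermitian_bundle_with_connection
begin

text \<open>The ratio of two points of one fibre is a phase difference times a transition function.
  By the gauge law its logarithmic derivative is i times the difference of the two values of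
  theta.\<close>

lemma ratio_derivative:
  assumes s1: "unit_section P E U1 s1" and s2: "unit_section P E U2 s2" and m: "tpt P (b t) \<in> U1 \<inter> U2"
    and b: "(b has_vector_derivative b') (at t)"
    and x: "(x1 has_real_derivative x1') (at t)" "(x2 has_real_derivative x2') (at t)"
  defines "\<rho> \<equiv> \<lambda>\<tau>. lherm E (\<Psi> s1 (x1 \<tau>, b \<tau>)) (\<Psi> s2 (x2 \<tau>, b \<tau>))"
  shows "(\<rho> has_vector_derivative
    \<i> * of_real ((x1' + \<Phi> s1 (b t) \<bullet> b') - (x2' + \<Phi> s2 (b t) \<bullet> b')) * \<rho> t) (at t)"
proof -
  let ?W = "tpt P -` (U1 \<inter> U2)"
  define c where "c m = lherm E (s1 m) (s2 m)" for m
  have W: "open ?W" "b t \<in> ?W" using unit_sectionD(2)[OF s1] unit_sectionD(2)[OF s2] m by auto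
  have \<rho>: "\<rho> \<tau> = cis (x1 \<tau> - x2 \<tau>) * (c \<circ> tpt P) (b \<tau>)" if "b \<tau> \<in> ?W" for \<tau>
    using lherm_lscale[OF unit_sectionD(3)[OF s1] unit_sectionD(3)[OF s2]] that
    by (simp add: \<rho>_def bundle_param_def c_def cis_cnj cis_mult)
  have "smooth_on ?W (c \<circ> tpt P)"
    using section_coefficient(1)[OF s2 unit_sectionD(5)[OF s1]] unfolding torus_smooth_on_def c_def
    by (simp add: Int_commute)
  note dc = smooth_on_has_derivative[OF this W(2)]
  have fc: "frechet_derivative (c \<circ> tpt P) (at (b t)) b'
      = \<i> * of_real ((\<Phi> s1 (b t) - \<Phi> s2 (b t)) \<bullet> b') * (c \<circ> tpt P) (b t)"
    using frechet_derivative_transition[OF s2 s1, of "b t" b'] m by (simp add: c_def[abs_def])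
  have d1: "((\<lambda>\<tau>. (c \<circ> tpt P) (b \<tau>)) has_vector_derivative frechet_derivative (c \<circ> tpt P) (at (b t)) b') (at t)"
    using vector_derivative_diff_chain_within[OF b has_derivative_at_withinI[OF dc]] by (simp add: o_def)
  have dx: "((\<lambda>\<tau>. x1 \<tau> - x2 \<tau>) has_vector_derivative (x1' - x2')) (at t)"
    using DERIV_diff[OF x] by (simp add: has_real_derivative_iff_has_vector_derivative)
  have d2: "((\<lambda>\<tau>. cis (x1 \<tau> - x2 \<tau>)) has_vector_derivative (x1' - x2') *\<^sub>R (\<i> * cis (x1 t - x2 t))) (at t)"
  proof -
    have "(cis has_vector_derivative \<i> * cis y) (at y)" for y
    proof -
      have "((\<lambda>z. exp (\<i> * z)) has_field_derivative \<i> * exp (\<i> * of_real y)) (at (of_real y))"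
        by (auto intro!: derivative_eq_intros)
      then have "((\<lambda>y. exp (\<i> * of_real y)) has_vector_derivative \<i> * exp (\<i> * of_real y)) (at y)"
        by (rule has_vector_derivative_real_field)
      then show ?thesis by (simp add: cis_conv_exp[abs_def])
    qed
    from vector_diff_chain_at[OF dx this] show ?thesis by (simp add: o_def)
  qed
  have "((\<lambda>\<tau>. cis (x1 \<tau> - x2 \<tau>) * (c \<circ> tpt P) (b \<tau>)) has_vector_derivative
     (cis (x1 t - x2 t) * frechet_derivative (c \<circ> tpt P) (at (b t)) b'
       + (x1' - x2') *\<^sub>R (\<i> * cis (x1 t - x2 t)) * (c \<circ> tpt P) (b t))) (at t)"
    by (rule bounded_bilinear.has_vector_derivative[OF bounded_bilinear_mult d2 d1])
  moreover have "cis (x1 t - x2 t) * frechet_derivative (c \<circ> tpt P) (at (b t)) b'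
       + (x1' - x2') *\<^sub>R (\<i> * cis (x1 t - x2 t)) * (c \<circ> tpt P) (b t)
     = \<i> * of_real ((x1' + \<Phi> s1 (b t) \<bullet> b') - (x2' + \<Phi> s2 (b t) \<bullet> b')) * \<rho> t"
    using \<rho>[OF W(2)] unfolding fc by (simp add: scaleR_conv_of_real inner_diff_left algebra_simps)
  ultimately have D: "((\<lambda>\<tau>. cis (x1 \<tau> - x2 \<tau>) * (c \<circ> tpt P) (b \<tau>)) has_vector_derivative
     \<i> * of_real ((x1' + \<Phi> s1 (b t) \<bullet> b') - (x2' + \<Phi> s2 (b t) \<bullet> b')) * \<rho> t) (at t)"
    by (simp only:)
  have "isCont b t" using b has_vector_derivative_continuous by blast
  then have "eventually (\<lambda>\<tau>. b \<tau> \<in> ?W) (at t)"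
    unfolding isCont_def by (rule topological_tendstoD[OF _ W])
  then obtain d where d: "d > 0" "\<forall>\<tau>. \<tau> \<noteq> t \<and> dist \<tau> t < d \<longrightarrow> b \<tau> \<in> ?W"
    unfolding eventually_at by auto
  have "b \<tau> \<in> ?W" if "dist \<tau> t < d" for \<tau> using d(2) W(2) that by metis
  then show ?thesis
    by (intro has_vector_derivative_transform_within[OF D d(1) UNIV_I]) (simp only: \<rho>)
qed

abbreviation (input) lift_data :: "(real \<Rightarrow> 'b) \<Rightarrow> (real \<Rightarrow> 'b) \<Rightarrow> (real \<Rightarrow> real) \<Rightarrow> (real \<Rightarrow> 'v) \<Rightarrow>
    real set \<Rightarrow> 'b set set \<Rightarrow> ('b set \<Rightarrow> 'v) \<Rightarrow> (real \<Rightarrow> real) \<Rightarrow> bool" where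
  "lift_data b b' \<Theta> g K U s x \<equiv> \<forall>\<tau>\<in>K. tpt P (b \<tau>) \<in> U \<and> g \<tau> = \<Psi> s (x \<tau>, b \<tau>) \<and>
     (x has_real_derivative \<Theta> \<tau> - \<Phi> s (b \<tau>) \<bullet> b' \<tau>) (at \<tau>)"

text \<open>\<open>g\<close> lifts the curve \<open>b\<close> to the circle bundle, with \<open>\<theta>(g') = \<Theta>\<close>.\<close>

definition fibre_lift :: "(real \<Rightarrow> 'b) \<Rightarrow> (real \<Rightarrow> 'b) \<Rightarrow> (real \<Rightarrow> real) \<Rightarrow> real set \<Rightarrow> (real \<Rightarrow> 'v) \<Rightarrow> bool" where
  "fibre_lift b b' \<Theta> I g \<longleftrightarrow> (\<forall>t\<in>I. \<exists>K U s x. open K \<and> t \<in> K \<and> K \<subseteq> I \<and> unit_section P E U s \<and>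
     lift_data b b' \<Theta> g K U s x)"

lemma fibre_liftE:
  assumes "fibre_lift b b' \<Theta> I g" "t \<in> I"
  obtains K U s x where "open K" "t \<in> K" "K \<subseteq> I" "unit_section P E U s"
     "lift_data b b' \<Theta> g K U s x"
  using bspec[OF assms(1)[unfolded fibre_lift_def] assms(2)] by (elim exE conjE) (rule that)

section \<open>Existence and uniqueness of lifts with prescribed theta\<close>

context
  fixes b b' :: "real \<Rightarrow> 'b" and \<Theta> :: "real \<Rightarrow> real"
  assumes b: "\<And>t. (b has_vector_derivative b' t) (at t)"
    and cont: "continuous_on UNIV b'" "continuous_on UNIV \<Theta>"
begin

lemma continuous_b: "continuous_on UNIV b"
  by (intro continuous_at_imp_continuous_on ballI has_vector_derivative_continuous[OF b])

lemma fibre_lift_subset: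
  assumes g: "fibre_lift b b' \<Theta> I g" and I': "open I'" "I' \<subseteq> I" "\<And>t. t \<in> I' \<Longrightarrow> h t = g t"
  shows "fibre_lift b b' \<Theta> I' h"
  unfolding fibre_lift_def
proof
  fix t assume t: "t \<in> I'"
  then have "t \<in> I" using I'(2) by blast
  from fibre_liftE[OF g this] obtain K U s x where K: "open K" "t \<in> K" "K \<subseteq> I" "unit_section P E U s"
     "lift_data b b' \<Theta> g K U s x" .
  show "\<exists>K U s x. open K \<and> t \<in> K \<and> K \<subseteq> I' \<and> unit_section P E U s \<and>
     lift_data b b' \<Theta> h K U s x"
    by (rule exI[of _ "K \<inter> I'"], rule exI[of _ U], rule exI[of _ s], rule exI[of _ x])
      (use K I' t in auto)
qed

lemma fibre_lift_union:
  assumes "\<And>t. t \<in> I \<Longrightarrow> \<exists>J. t \<in> J \<and> J \<subseteq> I \<and> fibre_lift b b' \<Theta> J g"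
  shows "fibre_lift b b' \<Theta> I g"
  unfolding fibre_lift_def
proof
  fix t assume "t \<in> I"
  then obtain J where J: "t \<in> J" "J \<subseteq> I" "fibre_lift b b' \<Theta> J g" using assms by blast
  then show "\<exists>K U s x. open K \<and> t \<in> K \<and> K \<subseteq> I \<and> unit_section P E U s \<and>
     lift_data b b' \<Theta> g K U s x"
  proof -
    obtain K U s x where K: "open K" "t \<in> K" "K \<subseteq> J" "unit_section P E U s"
       "lift_data b b' \<Theta> g K U s x"
      using fibre_liftE[OF J(3,1)] .
    show ?thesis
      by (rule exI[of _ K], rule exI[of _ U], rule exI[of _ s], rule exI[of _ x]) (use K J(2) in blast)
  qed
qed

lemma fibre_lift_in_fibre:
  assumes "fibre_lift b b' \<Theta> I g" "t \<in> I"
  shows "g t \<in> fibre E (tpt P (b t))" "lherm E (g t) (g t) = 1"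
proof -
  obtain K U s x where K: "open K" "t \<in> K" "K \<subseteq> I" "unit_section P E U s"
     "lift_data b b' \<Theta> g K U s x"
    using fibre_liftE[OF assms] .
  then have m: "tpt P (b t) \<in> U" and g: "g t = \<Psi> s (x t, b t)" by auto
  show "g t \<in> fibre E (tpt P (b t))" "lherm E (g t) (g t) = 1"
    unfolding g using bundle_param_in_fibre[OF K(4) m] by auto
qed

lemma fibre_lift_rotate:
  assumes "fibre_lift b b' \<Theta> I g"
  shows "fibre_lift b b' \<Theta> I (\<lambda>t. lscale E (cis \<alpha>) (g t))"
  unfolding fibre_lift_def
proof
  fix t assume "t \<in> I"
  from fibre_liftE[OF assms this] obtain K U s x where K: "open K" "t \<in> K" "K \<subseteq> I" "unit_section P E U s"
     "lift_data b b' \<Theta> g K U s x" .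
  have "lscale E (cis \<alpha>) (g \<tau>) = \<Psi> s (\<alpha> + x \<tau>, b \<tau>) \<and>
      ((\<lambda>\<tau>. \<alpha> + x \<tau>) has_real_derivative \<Theta> \<tau> - \<Phi> s (b \<tau>) \<bullet> b' \<tau>) (at \<tau>)" if "\<tau> \<in> K" for \<tau>
  proof -
    have "s (tpt P (b \<tau>)) \<in> fibre E (tpt P (b \<tau>))" using unit_sectionD(3)[OF K(4)] bspec[OF K(5) that] by blast
    then show ?thesis
      using bspec[OF K(5) that] lscale_lscale by (auto simp: bundle_param_def cis_mult intro!: derivative_eq_intros)
  qed
  then show "\<exists>K U s x. open K \<and> t \<in> K \<and> K \<subseteq> I \<and> unit_section P E U s \<and>
     lift_data b b' \<Theta> (\<lambda>\<tau>. lscale E (cis \<alpha>) (g \<tau>)) K U s x"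
    by (intro exI[of _ K] exI[of _ U] exI[of _ s] exI[of _ "\<lambda>\<tau>. \<alpha> + x \<tau>"]) (use K in auto)
qed

text \<open>Both curves have the same value of theta, so the logarithmic derivative of their ratio
  vanishes.\<close>

lemma fibre_lift_ratio:
  assumes g: "fibre_lift b b' \<Theta> I g" and h: "fibre_lift b b' \<Theta> I' h" and t: "t \<in> I" "t \<in> I'"
  shows "((\<lambda>\<tau>. lherm E (g \<tau>) (h \<tau>)) has_vector_derivative 0) (at t)"
proof -
  obtain K U s x where K: "open K" "t \<in> K" "K \<subseteq> I" "unit_section P E U s"
     "lift_data b b' \<Theta> g K U s x"
    using fibre_liftE[OF g t(1)] .
  obtain K' U' s' x' where K': "open K'" "t \<in> K'" "K' \<subseteq> I'" "unit_section P E U' s'"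
     "lift_data b b' \<Theta> h K' U' s' x'"
    using fibre_liftE[OF h t(2)] .
  have "((\<lambda>\<tau>. lherm E (\<Psi> s (x \<tau>, b \<tau>)) (\<Psi> s' (x' \<tau>, b \<tau>))) has_vector_derivative 0) (at t)"
    using ratio_derivative[OF K(4) K'(4), of b t "b' t" x "\<Theta> t - \<Phi> s (b t) \<bullet> b' t" x' "\<Theta> t - \<Phi> s' (b t) \<bullet> b' t"]
      bspec[OF K(5) K(2)] bspec[OF K'(5) K'(2)] b[of t] by simp
  then show ?thesis
    by (rule has_vector_derivative_transform_within_open[of _ _ _ "K \<inter> K'"])
      (use K K' in auto)
qed

text \<open>The ratio is constant and equals 1 at \<open>t0\<close>; for unit vectors of one fibre
  ratio 1 means equality.\<close>

lemma fibre_lift_unique: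
  assumes g: "fibre_lift b b' \<Theta> I g" and h: "fibre_lift b b' \<Theta> I' h"
    and J: "convex J" "J \<subseteq> I" "J \<subseteq> I'" "t0 \<in> J" "t \<in> J" and eq: "g t0 = h t0"
  shows "g t = h t"
proof -
  have "((\<lambda>t. lherm E (g t) (h t)) has_vector_derivative 0) (at t within J)" if "t \<in> J" for t
    using that J(2,3) by (intro has_vector_derivative_at_within[OF fibre_lift_ratio[OF g h]]) auto
  note d = this
  obtain c where "\<forall>t\<in>J. lherm E (g t) (h t) = c"
    by (rule has_vector_derivative_zero_constant[OF J(1) d]) blast+
  then have "lherm E (g t) (h t) = lherm E (g t0) (h t0)" using J(4,5) by simp
  also have "\<dots> = 1" using fibre_lift_in_fibre(2)[OF h] J eq by auto
  finally have one: "lherm E (g t) (h t) = 1" .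
  have ht: "h t \<in> fibre E (tpt P (b t))" "lherm E (h t) (h t) = 1" "g t \<in> fibre E (tpt P (b t))"
    using fibre_lift_in_fibre[OF h] fibre_lift_in_fibre[OF g] J by auto
  show ?thesis
    using lscale_unit_coefficient[OF ht(1,3,2)] lscale_one[OF ht(1)] one by simp
qed

text \<open>Inside one trivialisation the condition on theta is solved for the derivative of the
  angle and integrated.\<close>

lemma fibre_lift_local:
  obtains e g where "e > 0" "fibre_lift b b' \<Theta> (ball t e) g"
proof -
  obtain U s where s: "tpt P (b t) \<in> U" "unit_section P E U s" using ex_unit_section[OF tpt_in_torus] by blast
  have "open (b -` (tpt P -` U))"
    by (rule open_vimage[OF unit_sectionD(2)[OF s(2)] continuous_b])
  moreover have "t \<in> b -` (tpt P -` U)" using s(1) by simp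
  ultimately obtain e where e: "e > 0" "cball t e \<subseteq> b -` (tpt P -` U)"
    unfolding open_contains_cball by blast
  have "continuous_on {t - e..t + e} (\<lambda>\<tau>. \<Theta> \<tau> - \<Phi> s (b \<tau>) \<bullet> b' \<tau>)"
  proof (intro continuous_on_diff continuous_on_inner)
    show "continuous_on {t - e..t + e} \<Theta>" "continuous_on {t - e..t + e} b'"
      using cont continuous_on_subset by blast+
    show "continuous_on {t - e..t + e} (\<lambda>\<tau>. \<Phi> s (b \<tau>))"
      by (rule continuous_on_compose2[OF smooth_on_imp_continuous_on[OF smooth_on_conn_form[OF s(2)]]])
        (use continuous_b continuous_on_subset e(2) in \<open>auto simp: cball_eq_atLeastAtMost\<close>)
  qed
  then obtain x where x: "\<And>\<tau>. \<tau> \<in> {t - e..t + e} \<Longrightarrow>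
      (x has_vector_derivative \<Theta> \<tau> - \<Phi> s (b \<tau>) \<bullet> b' \<tau>) (at \<tau> within {t - e..t + e})"
    using antiderivative_continuous by blast
  have "(x has_real_derivative \<Theta> \<tau> - \<Phi> s (b \<tau>) \<bullet> b' \<tau>) (at \<tau>)" if "\<tau> \<in> ball t e" for \<tau>
  proof -
    have "\<tau> \<in> interior {t - e..t + e}" using that by (auto simp: dist_real_def)
    then show ?thesis
      using x[of \<tau>] interior_subset at_within_interior[of \<tau> "{t - e..t + e}"]
      unfolding has_real_derivative_iff_has_vector_derivative by (metis subsetD)
  qed
  moreover have "tpt P (b \<tau>) \<in> U" if "\<tau> \<in> ball t e" for \<tau>
    using e(2) that by (auto simp: subset_eq)
  ultimately have "fibre_lift b b' \<Theta> (ball t e) (\<lambda>\<tau>. \<Psi> s (x \<tau>, b \<tau>))"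
    unfolding fibre_lift_def using s(2)
    by (intro ballI exI[of _ "ball t e"] exI[of _ U] exI[of _ s] exI[of _ x]) auto
  with e(1) that show thesis by blast
qed

lemma fibre_lift_adjust:
  assumes h: "fibre_lift b b' \<Theta> I h" "r \<in> I" and v: "v \<in> fibre E (tpt P (b r))" "lherm E v v = 1"
  obtains h' where "fibre_lift b b' \<Theta> I h'" "h' r = v"
proof -
  note hr = fibre_lift_in_fibre[OF h]
  have e: "v = lscale E (lherm E v (h r)) (h r)" by (rule lscale_unit_coefficient[OF hr(1) v(1) hr(2)])
  let ?c = "lherm E v (h r)"
  have "1 = lherm E (lscale E ?c (h r)) (lscale E ?c (h r))" using v(2) e by simp
  also have "\<dots> = ?c * cnj ?c" using lherm_lscale[OF hr(1) hr(1)] hr(2) by simp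
  also have "\<dots> = of_real ((cmod ?c)\<^sup>2)" by (simp only: complex_norm_square)
  finally have "(cmod ?c)\<^sup>2 = 1" by (metis of_real_1 of_real_eq_iff)
  then have "cmod ?c = 1" by (smt (verit) norm_ge_zero power2_eq_1_iff)
  then obtain \<alpha> where "?c = cis \<alpha>" using complex_unimodular_polar[of ?c] by (metis cis.ctr)
  with e fibre_lift_rotate[OF h(1), of \<alpha>] that show thesis by metis
qed

text \<open>The second lift is rotated so as to agree with the first at \<open>r\<close>; uniqueness
  on the intersection, which is again an interval, makes the union consistent.\<close>

lemma fibre_lift_glue:
  assumes g: "fibre_lift b b' \<Theta> I g" "open I" "convex I" and h: "fibre_lift b b' \<Theta> I' h" "open I'" "convex I'"
    and r: "r \<in> I" "r \<in> I'"
  obtains k where "fibre_lift b b' \<Theta> (I \<union> I') k" "convex (I \<union> I')"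
proof -
  obtain h' where h': "fibre_lift b b' \<Theta> I' h'" "h' r = g r"
    using fibre_lift_adjust[OF h(1) r(2) fibre_lift_in_fibre[OF g(1) r(1)]] by blast
  have agree: "h' t = g t" if "t \<in> I \<inter> I'" for t
    by (rule fibre_lift_unique[OF h'(1) g(1), of "I \<inter> I'" r])
      (use g(3) h(3) r that h'(2) in \<open>auto intro: convex_Int\<close>)
  let ?k = "\<lambda>t. if t \<in> I then g t else h' t"
  have "fibre_lift b b' \<Theta> (I \<union> I') ?k"
  proof (rule fibre_lift_union)
    fix t assume "t \<in> I \<union> I'"
    moreover have "fibre_lift b b' \<Theta> I ?k" by (rule fibre_lift_subset[OF g(1,2)]) auto
    moreover have "fibre_lift b b' \<Theta> I' ?k" by (rule fibre_lift_subset[OF h'(1) h(2)]) (use agree in auto)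
    ultimately show "\<exists>J. t \<in> J \<and> J \<subseteq> I \<union> I' \<and> fibre_lift b b' \<Theta> J ?k" by blast
  qed
  moreover have "convex (I \<union> I')"
  proof -
    have "connected (I \<union> I')"
      using connected_Un[of I I'] g(3) h(3) r convex_connected by blast
    then show ?thesis by (simp add: is_interval_connected_1[symmetric] is_interval_convex_1[symmetric])
  qed
  ultimately show thesis using that by blast
qed

text \<open>The times reached by lifts on open intervals around \<open>t0\<close> form a clopen set:
  near any time there is a local lift, and it can be glued on as soon as its interval meets the
  set.\<close>

lemma fibre_lift_global:
  assumes v: "v \<in> fibre E (tpt P (b t0))" "lherm E v v = 1"
  obtains g where "fibre_lift b b' \<Theta> UNIV g" "g t0 = v"
proof -
  define Q where "Q I g \<longleftrightarrow> open I \<and> convex I \<and> t0 \<in> I \<and> fibre_lift b b' \<Theta> I g" for I g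
  define R where "R = {t. \<exists>I g. Q I g \<and> t \<in> I}"
  have ext: "t \<in> R" if e: "fibre_lift b b' \<Theta> (ball r e) h" "t \<in> ball r e" "t' \<in> ball r e" "t' \<in> R" for t t' r e h
  proof -
    obtain I g where I: "Q I g" "t' \<in> I" using e(4) unfolding R_def by blast
    obtain k where "fibre_lift b b' \<Theta> (I \<union> ball r e) k" "convex (I \<union> ball r e)"
      using fibre_lift_glue[OF _ _ _ e(1) open_ball convex_ball I(2) e(3)] I(1) unfolding Q_def by blast
    then have "Q (I \<union> ball r e) k" using I(1) unfolding Q_def by auto
    then show ?thesis unfolding R_def using e(2) by blast
  qed
  have "t0 \<in> R"
  proof -
    obtain e g where "e > 0" "fibre_lift b b' \<Theta> (ball t0 e) g" by (rule fibre_lift_local)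
    then have "Q (ball t0 e) g" by (simp add: Q_def)
    then show ?thesis unfolding R_def using \<open>e > 0\<close> by (auto intro!: exI[of _ "ball t0 e"])
  qed
  moreover have "open R"
  proof (subst open_subopen, intro ballI)
    fix t assume "t \<in> R"
    then obtain I g where I: "Q I g" "t \<in> I" unfolding R_def by blast
    then have "I \<subseteq> R" unfolding R_def by blast
    then show "\<exists>T. open T \<and> t \<in> T \<and> T \<subseteq> R" using I unfolding Q_def by blast
  qed
  moreover have "closed R"
    unfolding closed_def
  proof (subst open_subopen, intro ballI)
    fix t assume t: "t \<in> - R"
    obtain e h where e: "e > 0" "fibre_lift b b' \<Theta> (ball t e) h" by (rule fibre_lift_local)
    have "ball t e \<subseteq> - R" using ext[OF e(2)] e(1) t by (meson ComplI ComplD centre_in_ball subsetI)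
    then show "\<exists>T. open T \<and> t \<in> T \<and> T \<subseteq> - R" using e(1) by (intro exI[of _ "ball t e"]) auto
  qed
  ultimately have "R = UNIV" by (metis clopen empty_iff)
  have "\<exists>I g. Q I g \<and> t \<in> I \<and> g t0 = v" for t
  proof -
    obtain I g where I: "Q I g" "t \<in> I" using \<open>R = UNIV\<close> unfolding R_def by blast
    obtain g' where "fibre_lift b b' \<Theta> I g'" "g' t0 = v"
      using fibre_lift_adjust[of I g t0 v] I(1) v unfolding Q_def by blast
    then show ?thesis using I unfolding Q_def by blast
  qed
  then obtain I g where Ig: "\<And>t. Q (I t) (g t)" "\<And>t. t \<in> I t" "\<And>t. g t t0 = v" by metis
  have agree: "g t t = g r t" if "t \<in> I r" for t r
    by (rule fibre_lift_unique[of "I t" "g t" "I r" "g r" "I t \<inter> I r" t0])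
      (use Ig that in \<open>auto simp: Q_def intro: convex_Int\<close>)
  \<comment> \<open>Lifts chosen for different times have the same value at \<open>t0\<close> and
    agree wherever both are defined, so the diagonal is again a lift.\<close>
  have "fibre_lift b b' \<Theta> UNIV (\<lambda>t. g t t)"
  proof (rule fibre_lift_union)
    fix r
    have "fibre_lift b b' \<Theta> (I r) (\<lambda>t. g t t)"
      by (rule fibre_lift_subset[of "I r" "g r"]) (use Ig agree in \<open>auto simp: Q_def\<close>)
    then show "\<exists>J. r \<in> J \<and> J \<subseteq> UNIV \<and> fibre_lift b b' \<Theta> J (\<lambda>t. g t t)" using Ig(2) by blast
  qed
  then show thesis using that Ig(3) by blast
qed

end

end

section \<open>Geodesics\<close>

context wave_bundle
begin

lemma smooth_force: "smooth_on UNIV force"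
proof -
  have "smooth_on UNIV (\<lambda>b. \<Sum>j\<in>UNIV. ((if j = j1 then 1 else 0) + dF b (axis j 1, 0) / 2) *\<^sub>R (axis j (1::real), 0::real))"
    by (intro smooth_on_sum smooth_on_scaleR smooth_on_add smooth_on_const open_UNIV
        smooth_on_bounded_linear[OF _ bounded_linear_divide] smooth_on_frechet_derivative smooth_F)
  moreover have "(\<Sum>j\<in>UNIV. ((if j = j1 then 1 else 0) + dF b (axis j 1, 0) / 2) *\<^sub>R (axis j (1::real), 0::real)) = force b" for b
    by (simp add: force_def prod_eq_iff fst_sum snd_sum vec_eq_iff axis_def if_distrib sum.delta cong: if_cong)
  ultimately show ?thesis by (rule smooth_on_cong[OF open_UNIV, rotated])
qed

text \<open>The base equation as a first-order system. The factor \<open>r\<close> stands for the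
  square of the z-velocity; treating it as a parameter keeps the system Lipschitz.\<close>

definition flow :: "real \<Rightarrow> ((real^'n) \<times> real) \<times> ((real^'n) \<times> real) \<Rightarrow> ((real^'n) \<times> real) \<times> ((real^'n) \<times> real)" where
  "flow r w = (snd w, r *\<^sub>R force (fst w))"

lemma flow_lipschitz:
  obtains L where "\<And>w w'. norm (flow r w - flow r w') \<le> L * norm (w - w')"
proof -
  obtain C where C: "\<And>x y. norm (force x - force y) \<le> C * norm (x - y)"
    using periodic_smooth_lipschitz[OF periods smooth_force force_cong] by blast
  have "norm ((snd w, r *\<^sub>R force (fst w)) - (snd w', r *\<^sub>R force (fst w'))) \<le> (1 + \<bar>r\<bar> * \<bar>C\<bar>) * norm (w - w')" for w w'
  proof -
    have "norm ((snd w, r *\<^sub>R force (fst w)) - (snd w', r *\<^sub>R force (fst w')))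
        \<le> norm (snd w - snd w') + norm (r *\<^sub>R force (fst w) - r *\<^sub>R force (fst w'))"
      by (simp add: norm_Pair_le)
    also have "norm (snd w - snd w') \<le> norm (w - w')" by (metis norm_snd_le prod.collapse snd_diff)
    also have "norm (r *\<^sub>R force (fst w) - r *\<^sub>R force (fst w')) \<le> \<bar>r\<bar> * (\<bar>C\<bar> * norm (w - w'))"
    proof -
      have "norm (force (fst w) - force (fst w')) \<le> C * norm (fst w - fst w')" by (rule C)
      also have "\<dots> \<le> \<bar>C\<bar> * norm (fst w - fst w')" by (intro mult_right_mono) auto
      also have "\<dots> \<le> \<bar>C\<bar> * norm (w - w')" 
        by (intro mult_left_mono) (metis norm_fst_le prod.collapse fst_diff, simp)
      finally have "\<bar>r\<bar> * norm (force (fst w) - force (fst w')) \<le> \<bar>r\<bar> * (\<bar>C\<bar> * norm (w - w'))"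
        by (intro mult_left_mono) auto
      then show ?thesis by (simp flip: scaleR_diff_right)
    qed
    finally show ?thesis by (simp add: algebra_simps)
  qed
  then show thesis by (intro that[of "1 + \<bar>r\<bar> * \<bar>C\<bar>"]) (simp add: flow_def)
qed

text \<open>\<open>force\<close> has no z-component, so the z-velocity of the solution is constant
  and its square is indeed the parameter with which the system was solved.\<close>

lemma ex_base_curve:
  obtains b b' where "b t0 = b0" "b' t0 = v0" "\<And>t. (b has_vector_derivative b' t) (at t)"
    "\<And>t. (b' has_vector_derivative (snd v0)\<^sup>2 *\<^sub>R force (b t)) (at t)" "\<And>t. snd (b' t) = snd v0"
proof -
  obtain L where L: "\<And>w w'. norm (flow ((snd v0)\<^sup>2) w - flow ((snd v0)\<^sup>2) w') \<le> L * norm (w - w')"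
    using flow_lipschitz[of "(snd v0)\<^sup>2"] by blast
  obtain w where w: "w t0 = (b0, v0)"
    "\<And>t. (w has_vector_derivative flow ((snd v0)\<^sup>2) (w t)) (at t)"
    using global_lipschitz_ode[OF L] by blast
  have d1: "((\<lambda>t. fst (w t)) has_vector_derivative snd (w t)) (at t)" for t
    using bounded_linear.has_vector_derivative[OF bounded_linear_fst w(2)] by (simp add: flow_def)
  have d2: "((\<lambda>t. snd (w t)) has_vector_derivative (snd v0)\<^sup>2 *\<^sub>R force (fst (w t))) (at t)" for t
    using bounded_linear.has_vector_derivative[OF bounded_linear_snd w(2)] by (simp add: flow_def)
  have "((\<lambda>t. snd (snd (w t))) has_vector_derivative 0) (at t)" for t
    using bounded_linear.has_vector_derivative[OF bounded_linear_snd d2[of t]] by (simp add: force_def)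
  then have "((\<lambda>t. snd (snd (w t))) has_vector_derivative 0) (at t within UNIV)" for t by simp
  note d3 = this
  obtain c where "\<forall>t\<in>UNIV. snd (snd (w t)) = c"
    by (rule has_vector_derivative_zero_constant[OF convex_UNIV d3]) blast+
  then have "snd (snd (w t)) = snd v0" for t using w(1) by (metis UNIV_I snd_conv)
  then show thesis using that[of "\<lambda>t. fst (w t)" "\<lambda>t. snd (w t)"] d1 d2 w(1) by simp
qed

text \<open>The derivative of \<open>\<theta>(\<gamma>')\<close> along a geodesic, in terms of the base curve.\<close>

definition theta_force :: "(real^'n) \<times> real \<Rightarrow> (real^'n) \<times> real \<Rightarrow> real" where
  "theta_force b a = dF b (0, 1) * (snd a)\<^sup>2 / 2 - dF b a * snd a - fst a $ j1 * snd a"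

lemma theta_force_cong: "tpt P b = tpt P b' \<Longrightarrow> theta_force b a = theta_force b' a"
  using dF_cong[of b b'] by (simp add: theta_force_def)

text \<open>The outer summands are what the product rule yields for the connection form evaluated on
  the velocity of a base curve. They cancel in the derivative of theta and leave
  \<open>theta_force\<close>, which does not depend on \<open>s\<close>.\<close>

lemma fibre_chr_diagonal:
  "fibre_chr s b a a = d\<Phi> s b a \<bullet> a - theta_force b a + (snd a)\<^sup>2 * (\<Phi> s b \<bullet> force b)"
  by (simp add: fibre_chr_def theta_force_def power2_eq_square field_simps)

lemma continuous_theta_force:
  assumes "continuous_on UNIV b" "continuous_on UNIV b'"
  shows "continuous_on UNIV (\<lambda>t. theta_force (b t) (b' t))"
proof -
  have c: "continuous_on UNIV (\<lambda>t. dF (b t) k)" for k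
    by (rule continuous_on_compose2[OF smooth_on_imp_continuous_on[OF smooth_on_frechet_derivative[OF smooth_F]] assms(1)]) auto
  have "dF x a = (\<Sum>k\<in>Basis. (a \<bullet> k) * dF x k)" for x a
  proof -
    have "dF x (\<Sum>k\<in>Basis. (a \<bullet> k) *\<^sub>R k) = (\<Sum>k\<in>Basis. (a \<bullet> k) * dF x k)"
      by (simp only: linear_sum[OF linear_dF] linear_scale[OF linear_dF] real_scaleR_def)
    then show ?thesis by (simp only: euclidean_representation)
  qed
  note e = this
  have "continuous_on UNIV (\<lambda>t. dF (b t) (b' t))"
    unfolding e[of "b t" "b' t" for t] by (intro continuous_intros assms c)
  then show ?thesis unfolding theta_force_def by (intro continuous_intros assms c) simp_all
qed

lemma conn_form_along:
  assumes s: "unit_section P E U s" and m: "tpt P (b t) \<in> U"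
    and b: "(b has_vector_derivative b' t) (at t)" "(b' has_vector_derivative b'') (at t)"
  shows "((\<lambda>\<tau>. \<Phi> s (b \<tau>) \<bullet> b' \<tau>) has_real_derivative d\<Phi> s (b t) (b' t) \<bullet> b' t + \<Phi> s (b t) \<bullet> b'') (at t)"
proof -
  have "((\<lambda>\<tau>. \<Phi> s (b \<tau>)) has_vector_derivative d\<Phi> s (b t) (b' t)) (at t)"
    using vector_derivative_diff_chain_within[OF b(1) has_derivative_at_withinI[OF has_derivative_conn_form[OF s m]]]
    by (simp add: o_def)
  from bounded_bilinear.has_vector_derivative[OF bounded_bilinear_inner this b(2)]
  show ?thesis by (simp add: has_real_derivative_iff_has_vector_derivative add.commute)
qed

section \<open>Geodesics as lifts of base curves, and conversely\<close>

context
  fixes b b' :: "real \<Rightarrow> (real^'n) \<times> real" and \<Theta> :: "real \<Rightarrow> real" and c :: real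
  assumes b: "\<And>t. (b has_vector_derivative b' t) (at t)"
    and b': "\<And>t. (b' has_vector_derivative c\<^sup>2 *\<^sub>R force (b t)) (at t)"
    and c: "\<And>t. snd (b' t) = c"
    and \<Theta>: "\<And>t. (\<Theta> has_real_derivative theta_force (b t) (b' t)) (at t)"
begin

lemma continuous_data: "continuous_on UNIV b'" "continuous_on UNIV \<Theta>"
  by (intro continuous_at_imp_continuous_on ballI has_vector_derivative_continuous[OF b'] DERIV_isCont[OF \<Theta>])+

lemma geodesic_of_lift:
  assumes g: "fibre_lift b b' \<Theta> I g"
  shows "geodesic_on CB G I g"
  unfolding geodesic_on_def
proof
  fix t assume t: "t \<in> I"
  obtain K U s x where K: "open K" "t \<in> K" "K \<subseteq> I" "unit_section P E U s"
     "lift_data b b' \<Theta> g K U s x"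
    using fibre_liftE[OF g t] .
  have m: "tpt P (b t) \<in> U" using K by blast
  obtain D where D: "(x t, b t) \<in> D" "D \<subseteq> UNIV" "(D, U, s) \<in> charts CB"
    by (rule ex_chart[OF K(4) m open_UNIV UNIV_I])
  define u where "u \<tau> = (x \<tau>, b \<tau>)" for \<tau>
  define u' where "u' \<tau> = (\<Theta> \<tau> - \<Phi> s (b \<tau>) \<bullet> b' \<tau>, b' \<tau>)" for \<tau>
  have du: "(u has_vector_derivative u' \<tau>) (at \<tau>)" if "\<tau> \<in> K" for \<tau>
    unfolding u_def[abs_def] u'_def
    using bspec[OF K(5) that] b[of \<tau>] by (auto intro!: has_vector_derivative_Pair simp: has_real_derivative_iff_has_vector_derivative)
  have du': "(u' has_vector_derivative - chr s (b \<tau>) (u' \<tau>) (u' \<tau>)) (at \<tau>)" if "\<tau> \<in> K" for \<tau>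
  proof -
    have m: "tpt P (b \<tau>) \<in> U" using bspec[OF K(5) that] by blast
    note d = DERIV_diff[OF \<Theta>[of \<tau>] conn_form_along[OF K(4) m b b']]
    have "(u' has_vector_derivative (theta_force (b \<tau>) (b' \<tau>) - (d\<Phi> s (b \<tau>) (b' \<tau>) \<bullet> b' \<tau> + \<Phi> s (b \<tau>) \<bullet> (c\<^sup>2 *\<^sub>R force (b \<tau>))),
        c\<^sup>2 *\<^sub>R force (b \<tau>))) (at \<tau>)"
      unfolding u'_def[abs_def]
      by (intro has_vector_derivative_Pair b' d[unfolded has_real_derivative_iff_has_vector_derivative])
    \<comment> \<open>Both entries match because the z-velocity is the constant \<open>c\<close>,
      whose square multiplies \<open>force\<close>.\<close>
    moreover have "(theta_force (b \<tau>) (b' \<tau>) - (d\<Phi> s (b \<tau>) (b' \<tau>) \<bullet> b' \<tau> + \<Phi> s (b \<tau>) \<bullet> (c\<^sup>2 *\<^sub>R force (b \<tau>))),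
        c\<^sup>2 *\<^sub>R force (b \<tau>)) = - chr s (b \<tau>) (u' \<tau>) (u' \<tau>)"
      by (simp add: chr_def u'_def fibre_chr_diagonal c power2_eq_square)
    ultimately show ?thesis by simp
  qed
  have "open D" using D(3) by (simp add: charts_circle_bundle)
  have "continuous_on K u"
    using du has_vector_derivative_continuous by (intro continuous_at_imp_continuous_on ballI) blast
  then have "open (K \<inter> u -` D)" using K(1) \<open>open D\<close> by (rule continuous_open_preimage)
  moreover have "t \<in> K \<inter> u -` D" using K(2) D(1) by (simp add: u_def)
  moreover have "\<forall>\<tau>\<in>K \<inter> u -` D. u \<tau> \<in> cdom CB (D, U, s) \<and> g \<tau> = param CB (D, U, s) (u \<tau>) \<and>
      (u has_vector_derivative u' \<tau>) (at \<tau>) \<and>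
      (u' has_vector_derivative - christoffel G (D, U, s) (u \<tau>) (u' \<tau>) (u' \<tau>)) (at \<tau>)"
  proof
    fix \<tau> assume \<tau>: "\<tau> \<in> K \<inter> u -` D"
    then have uD: "u \<tau> \<in> D" and "\<tau> \<in> K" by auto
    then show "u \<tau> \<in> cdom CB (D, U, s) \<and> g \<tau> = param CB (D, U, s) (u \<tau>) \<and>
      (u has_vector_derivative u' \<tau>) (at \<tau>) \<and>
      (u' has_vector_derivative - christoffel G (D, U, s) (u \<tau>) (u' \<tau>) (u' \<tau>)) (at \<tau>)"
      using K(5) du du' unfolding christoffel_eq[OF D(3) uD] by (simp add: u_def)
  qed
  ultimately show "\<exists>K i u u'. open K \<and> t \<in> K \<and> K \<subseteq> I \<and> i \<in> charts CB \<and>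
        (\<forall>t\<in>K. u t \<in> cdom CB i \<and> g t = param CB i (u t) \<and>
           (u has_vector_derivative u' t) (at t) \<and>
           (u' has_vector_derivative - christoffel G i (u t) (u' t) (u' t)) (at t))"
    using K(3) D(3) by (intro exI[of _ "K \<inter> u -` D"] exI[of _ "(D, U, s)"] exI[of _ u] exI[of _ u']) auto
qed

text \<open>The base coordinates of the geodesic and a lattice translate of \<open>b\<close> solve
  the same Lipschitz system with the same data at \<open>t2\<close>, so they coincide. Then theta of
  the velocity and \<Theta> have equal derivatives and equal values at \<open>t2\<close>.\<close>

lemma lift_of_geodesic:
  assumes i: "(D, U, s) \<in> charts CB" and K: "open K" "convex K" "t2 \<in> K"
    and geo: "\<And>t. t \<in> K \<Longrightarrow> u t \<in> D" "\<And>t. t \<in> K \<Longrightarrow> \<gamma> t = \<Psi> s (u t)"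
      "\<And>t. t \<in> K \<Longrightarrow> (u has_vector_derivative u' t) (at t)"
      "\<And>t. t \<in> K \<Longrightarrow> (u' has_vector_derivative - christoffel G (D, U, s) (u t) (u' t) (u' t)) (at t)"
    and init: "tpt P (snd (u t2)) = tpt P (b t2)" "snd (u' t2) = b' t2"
      "fst (u' t2) + \<Phi> s (snd (u t2)) \<bullet> snd (u' t2) = \<Theta> t2"
  shows "fibre_lift b b' \<Theta> K \<gamma>"
proof -
  have s: "unit_section P E U s" using i by (simp add: charts_circle_bundle)
  have m: "tpt P (snd (u t)) \<in> U" if "t \<in> K" for t using geo(1)[OF that] i by (auto simp: charts_circle_bundle)
  have du: "((\<lambda>t. fst (u t)) has_vector_derivative fst (u' t)) (at t)" "((\<lambda>t. snd (u t)) has_vector_derivative snd (u' t)) (at t)"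
    if "t \<in> K" for t
    using bounded_linear.has_vector_derivative[OF bounded_linear_fst geo(3)[OF that]]
      bounded_linear.has_vector_derivative[OF bounded_linear_snd geo(3)[OF that]] by auto
  have du': "((\<lambda>t. fst (u' t)) has_vector_derivative - fibre_chr s (snd (u t)) (snd (u' t)) (snd (u' t))) (at t)"
    "((\<lambda>t. snd (u' t)) has_vector_derivative (snd (snd (u' t)))\<^sup>2 *\<^sub>R force (snd (u t))) (at t)"
    if "t \<in> K" for t
    using bounded_linear.has_vector_derivative[OF bounded_linear_fst geo(4)[OF that]]
      bounded_linear.has_vector_derivative[OF bounded_linear_snd geo(4)[OF that]]
    unfolding christoffel_eq[OF i geo(1)[OF that]] by (auto simp: chr_def power2_eq_square)
  have const: "h t = h t2" if "\<And>t. t \<in> K \<Longrightarrow> (h has_vector_derivative 0) (at t)" "t \<in> K" for h :: "real \<Rightarrow> real" and t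
  proof -
    have d: "(h has_vector_derivative 0) (at t within K)" if "t \<in> K" for t
      using \<open>\<And>t. t \<in> K \<Longrightarrow> (h has_vector_derivative 0) (at t)\<close>[OF that] by (rule has_vector_derivative_at_within)
    obtain c where "\<forall>t\<in>K. h t = c"
      by (rule has_vector_derivative_zero_constant[OF K(2) d]) blast+
    then show ?thesis using K(3) that(2) by simp
  qed
  have z: "snd (snd (u' t)) = c" if t: "t \<in> K" for t
  proof -
    have "((\<lambda>t. snd (snd (u' t))) has_vector_derivative 0) (at t)" if "t \<in> K" for t
      using bounded_linear.has_vector_derivative[OF bounded_linear_snd du'(2)[OF that]] by (simp add: force_def)
    from const[OF this t] show ?thesis using init(2) c by simp
  qed
  \<comment> \<open>The chart may represent the point \<open>tpt P (b t2)\<close> by another vector;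
    \<mu> is the lattice vector between the two.\<close>
  define \<mu> where "\<mu> = snd (u t2) - b t2"
  have per: "tpt P (x + \<mu>) = tpt P x" for x
    unfolding \<mu>_def by (rule tpt_translate[OF init(1)[symmetric]])
  obtain L where L: "\<And>w w'. norm (flow (c\<^sup>2) w - flow (c\<^sup>2) w') \<le> L * norm (w - w')"
    using flow_lipschitz[of "c\<^sup>2"] by blast
  have eq: "(snd (u t), snd (u' t)) = (b t + \<mu>, b' t)" if t: "t \<in> K" for t
  proof (rule lipschitz_ode_unique[OF L K(2,3) t])
    show "((\<lambda>t. (snd (u t), snd (u' t))) has_vector_derivative
        flow (c\<^sup>2) (snd (u t), snd (u' t))) (at t)" if "t \<in> K" for t
      using has_vector_derivative_Pair[OF du(2)[OF that] du'(2)[OF that]] z[OF that] by (simp add: flow_def)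
    have bd: "((\<lambda>t. b t + \<mu>) has_vector_derivative b' t) (at t)" for t
      using has_vector_derivative_add[OF b has_vector_derivative_const] by simp
    show "((\<lambda>t. (b t + \<mu>, b' t)) has_vector_derivative
        flow (c\<^sup>2) (b t + \<mu>, b' t)) (at t)" for t
      using has_vector_derivative_Pair[OF bd b'] force_cong[OF per] by (simp add: flow_def)
    show "(snd (u t2), snd (u' t2)) = (b t2 + \<mu>, b' t2)" using init(2) by (simp add: \<mu>_def)
  qed
  have same: "tpt P (snd (u t)) = tpt P (b t)" "snd (u' t) = b' t" if "t \<in> K" for t
    using eq[OF that] per by simp_all
  have \<theta>: "fst (u' t) + \<Phi> s (snd (u t)) \<bullet> snd (u' t) = \<Theta> t" if t: "t \<in> K" for t
  proof -
    have "((\<lambda>t. fst (u' t) + \<Phi> s (snd (u t)) \<bullet> snd (u' t) - \<Theta> t) has_vector_derivative 0) (at t)" if t: "t \<in> K" for t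
    proof -
      have "((\<lambda>t. fst (u' t) + \<Phi> s (snd (u t)) \<bullet> snd (u' t) - \<Theta> t) has_real_derivative
          - fibre_chr s (snd (u t)) (snd (u' t)) (snd (u' t))
          + (d\<Phi> s (snd (u t)) (snd (u' t)) \<bullet> snd (u' t) + \<Phi> s (snd (u t)) \<bullet> ((snd (snd (u' t)))\<^sup>2 *\<^sub>R force (snd (u t))))
          - theta_force (b t) (b' t)) (at t)"
        by (intro DERIV_diff DERIV_add \<Theta> conn_form_along[OF s m[OF t] du(2)[OF t] du'(2)[OF t]]
            du'(1)[OF t, folded has_real_derivative_iff_has_vector_derivative])
      moreover have "theta_force (snd (u t)) (snd (u' t)) = theta_force (b t) (b' t)"
        using theta_force_cong[OF same(1)[OF t]] same(2)[OF t] by simp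
      ultimately show ?thesis
        by (simp add: fibre_chr_diagonal has_real_derivative_iff_has_vector_derivative)
    qed
    from const[OF this t] show ?thesis using init(3) by simp
  qed
  show ?thesis
    unfolding fibre_lift_def
  proof (rule ballI, rule exI[of _ K], rule exI[of _ U], rule exI[of _ s], rule exI[of _ "\<lambda>t. fst (u t)"], intro conjI ballI)
    show "open K" "unit_section P E U s" by fact+
    fix t assume t: "t \<in> K"
    show "tpt P (b t) \<in> U" using m[OF t] same(1)[OF t] by simp
    show "\<gamma> t = \<Psi> s (fst (u t), b t)"
      using geo(2)[OF t] same(1)[OF t] by (simp add: bundle_param_def)
    have "fst (u' t) = \<Theta> t - \<Phi> s (b t) \<bullet> b' t"
      using \<theta>[OF t] conn_form_cong[OF same(1)[OF t], of E s] same(2)[OF t] by simp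
    then show "((\<lambda>t. fst (u t)) has_real_derivative \<Theta> t - \<Phi> s (b t) \<bullet> b' t) (at t)"
      using du(1)[OF t] by (simp add: has_real_derivative_iff_has_vector_derivative)
  qed auto
qed

text \<open>Recovers the data required by \<open>lift_of_geodesic\<close> at a time where the curve
  is already known to be a lift, so that the property passes to the next chart. The base parts
  differ by a constant lattice vector.\<close>

lemma lift_initial_data:
  assumes i: "(D, U, s) \<in> charts CB" and K: "open K" "t \<in> K"
    and u: "\<And>t. t \<in> K \<Longrightarrow> u t \<in> D" "\<And>t. t \<in> K \<Longrightarrow> \<gamma> t = \<Psi> s (u t)"
      "\<And>t. t \<in> K \<Longrightarrow> (u has_vector_derivative u' t) (at t)"
    and g: "fibre_lift b b' \<Theta> I \<gamma>" "t \<in> I"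
  shows "tpt P (snd (u t)) = tpt P (b t)" "snd (u' t) = b' t"
    "fst (u' t) + \<Phi> s (snd (u t)) \<bullet> snd (u' t) = \<Theta> t"
proof -
  have s: "unit_section P E U s" using i by (simp add: charts_circle_bundle)
  have m: "tpt P (snd (u t)) \<in> U" if "t \<in> K" for t using u(1)[OF that] i by (auto simp: charts_circle_bundle)
  obtain K' U' s' x where K': "open K'" "t \<in> K'" "K' \<subseteq> I" "unit_section P E U' s'"
     "lift_data b b' \<Theta> \<gamma> K' U' s' x"
    using fibre_liftE[OF g] .
  have "open (K \<inter> K')" "t \<in> K \<inter> K'" using K K' by auto
  then obtain r where r: "r > 0" "ball t r \<subseteq> K \<inter> K'" unfolding open_contains_ball by blast
  have tb: "t \<in> ball t r" using r(1) by simp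
  have rK: "\<tau> \<in> K" "\<tau> \<in> K'" if "\<tau> \<in> ball t r" for \<tau> using r(2) that by auto
  have same: "tpt P (snd (u \<tau>)) = tpt P (b \<tau>)" if "\<tau> \<in> ball t r" for \<tau>
  proof (rule bundle_param_fibre_eq[OF s m[OF rK(1)[OF that]] K'(4)])
    show "tpt P (b \<tau>) \<in> U'" using K'(5) rK(2)[OF that] by blast
    show "\<Psi> s (fst (u \<tau>), snd (u \<tau>)) = \<Psi> s' (x \<tau>, b \<tau>)"
      using u(2)[OF rK(1)[OF that]] bspec[OF K'(5) rK(2)[OF that]] by simp
  qed
  show "tpt P (snd (u t)) = tpt P (b t)" by (rule same[OF tb])
  have du: "((\<lambda>t. fst (u t)) has_vector_derivative fst (u' t)) (at t)" "((\<lambda>t. snd (u t)) has_vector_derivative snd (u' t)) (at t)"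
    if "t \<in> K" for t
    using bounded_linear.has_vector_derivative[OF bounded_linear_fst u(3)[OF that]]
      bounded_linear.has_vector_derivative[OF bounded_linear_snd u(3)[OF that]] by auto
  have "continuous_on (ball t r) (\<lambda>\<tau>. snd (u \<tau>))" "continuous_on (ball t r) b"
    using has_vector_derivative_continuous[OF du(2)] has_vector_derivative_continuous[OF b] rK(1)
    by (auto intro!: continuous_at_imp_continuous_on)
  from tpt_const_diff[OF periods connected_ball this same tb]
  have diff: "snd (u \<tau>) - b \<tau> = snd (u t) - b t" if "\<tau> \<in> ball t r" for \<tau> using that by blast
  have "((\<lambda>\<tau>. b \<tau> + (snd (u t) - b t)) has_vector_derivative b' t) (at t)"
    using has_vector_derivative_add[OF b has_vector_derivative_const] by simp
  then have "((\<lambda>\<tau>. snd (u \<tau>)) has_vector_derivative b' t) (at t)"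
    by (rule has_vector_derivative_transform_within_open[OF _ open_ball tb]) (use diff in \<open>simp add: algebra_simps\<close>)
  then show bt: "snd (u' t) = b' t"
    using du(2)[OF rK(1)[OF tb]] vector_derivative_unique_at by blast
  \<comment> \<open>Two descriptions of the same curve have ratio 1; comparing the zero derivative
    with \<open>ratio_derivative\<close> equates the two values of theta.\<close>
  let ?\<rho> = "\<lambda>\<tau>. lherm E (\<Psi> s (fst (u \<tau>), b \<tau>)) (\<Psi> s' (x \<tau>, b \<tau>))"
  have one: "?\<rho> \<tau> = 1" if "\<tau> \<in> ball t r" for \<tau>
  proof -
    have "\<Psi> s (fst (u \<tau>), b \<tau>) = \<Psi> s' (x \<tau>, b \<tau>)"
      using u(2)[OF rK(1)[OF that]] bspec[OF K'(5) rK(2)[OF that]] same[OF that] by (simp add: bundle_param_def)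
    moreover have "tpt P (b \<tau>) \<in> U'" using bspec[OF K'(5) rK(2)[OF that]] by blast
    ultimately show ?thesis using bundle_param_in_fibre(2)[OF K'(4)] by metis
  qed
  have mU: "tpt P (b t) \<in> U \<inter> U'" using m[OF rK(1)[OF tb]] same[OF tb] bspec[OF K'(5) rK(2)[OF tb]] by simp
  have "(?\<rho> has_vector_derivative
      \<i> * of_real ((fst (u' t) + \<Phi> s (b t) \<bullet> b' t) - ((\<Theta> t - \<Phi> s' (b t) \<bullet> b' t) + \<Phi> s' (b t) \<bullet> b' t)) * ?\<rho> t) (at t)"
    by (rule ratio_derivative[OF s K'(4) mU b])
      (use du(1)[OF rK(1)[OF tb]] bspec[OF K'(5) rK(2)[OF tb]] in \<open>auto simp: has_real_derivative_iff_has_vector_derivative\<close>)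
  moreover have "(?\<rho> has_vector_derivative 0) (at t)"
    by (rule has_vector_derivative_transform_within_open[OF has_vector_derivative_const[of 1] open_ball tb]) (use one in simp)
  ultimately have "\<i> * of_real ((fst (u' t) + \<Phi> s (b t) \<bullet> b' t) - \<Theta> t) * ?\<rho> t = 0"
    using vector_derivative_unique_at by fastforce
  then have "complex_of_real ((fst (u' t) + \<Phi> s (b t) \<bullet> b' t) - \<Theta> t) = 0" using one[OF tb] by simp
  then have "fst (u' t) + \<Phi> s (b t) \<bullet> b' t = \<Theta> t" by (simp only: of_real_eq_0_iff)
  then show "fst (u' t) + \<Phi> s (snd (u t)) \<bullet> snd (u' t) = \<Theta> t"
    using bt conn_form_cong[OF same[OF tb], of E s] by simp
qed

end

section \<open>Continuation of geodesics to all times\<close>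

lemma geodesicE:
  assumes "geodesic_on CB G J \<gamma>" "t0 \<in> J"
  obtains r D U s u u' where "r > 0" "ball t0 r \<subseteq> J" "(D, U, s) \<in> charts CB"
    "\<And>t. t \<in> ball t0 r \<Longrightarrow> u t \<in> D" "\<And>t. t \<in> ball t0 r \<Longrightarrow> \<gamma> t = \<Psi> s (u t)"
    "\<And>t. t \<in> ball t0 r \<Longrightarrow> (u has_vector_derivative u' t) (at t)"
    "\<And>t. t \<in> ball t0 r \<Longrightarrow> (u' has_vector_derivative - christoffel G (D, U, s) (u t) (u' t) (u' t)) (at t)"
proof -
  obtain K i u u' where K: "open K" "t0 \<in> K" "K \<subseteq> J" "i \<in> charts CB"
    "\<forall>t\<in>K. u t \<in> cdom CB i \<and> \<gamma> t = param CB i (u t) \<and> (u has_vector_derivative u' t) (at t) \<and>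
           (u' has_vector_derivative - christoffel G i (u t) (u' t) (u' t)) (at t)"
    using bspec[OF assms(1)[unfolded geodesic_on_def] assms(2)] by (elim exE conjE) (rule that)
  obtain D U s where i: "i = (D, U, s)" by (cases i)
  obtain r where r: "r > 0" "ball t0 r \<subseteq> K" using K(1,2) unfolding open_contains_ball by blast
  show thesis
  proof (rule that[OF r(1) order_trans[OF r(2) K(3)] K(4)[unfolded i]])
    fix t assume "t \<in> ball t0 r"
    then have "t \<in> K" using r(2) by blast
    from bspec[OF K(5) this] show "u t \<in> D" "\<gamma> t = \<Psi> s (u t)" "(u has_vector_derivative u' t) (at t)"
      "(u' has_vector_derivative - christoffel G (D, U, s) (u t) (u' t) (u' t)) (at t)"
      by (simp_all add: i)
  qed
qed

theorem geodesically_complete_CB: "geodesically_complete CB G"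
  unfolding geodesically_complete_def
proof (intro allI impI, elim conjE)
  fix J \<gamma> assume J: "open J" "connected J" "J \<noteq> {}" and geo: "geodesic_on CB G J \<gamma>"
  obtain t0 where t0: "t0 \<in> J" using J(3) by blast
  obtain r D U s u u' where u: "r > 0" "ball t0 r \<subseteq> J" "(D, U, s) \<in> charts CB"
    "\<And>t. t \<in> ball t0 r \<Longrightarrow> u t \<in> D" "\<And>t. t \<in> ball t0 r \<Longrightarrow> \<gamma> t = \<Psi> s (u t)"
    "\<And>t. t \<in> ball t0 r \<Longrightarrow> (u has_vector_derivative u' t) (at t)"
    "\<And>t. t \<in> ball t0 r \<Longrightarrow> (u' has_vector_derivative - christoffel G (D, U, s) (u t) (u' t) (u' t)) (at t)"
    using geodesicE[OF geo t0] by blast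
  obtain b b' where b: "b t0 = snd (u t0)" "b' t0 = snd (u' t0)" "\<And>t. (b has_vector_derivative b' t) (at t)"
    "\<And>t. (b' has_vector_derivative (snd (snd (u' t0)))\<^sup>2 *\<^sub>R force (b t)) (at t)" "\<And>t. snd (b' t) = snd (snd (u' t0))"
    using ex_base_curve[of t0 "snd (u t0)" "snd (u' t0)"] by blast
  have cb: "continuous_on UNIV b" "continuous_on UNIV b'"
    by (intro continuous_at_imp_continuous_on ballI has_vector_derivative_continuous[OF b(3)] has_vector_derivative_continuous[OF b(4)])+
  define k where "k t = theta_force (b t) (b' t)" for t
  have ck: "continuous_on UNIV k" unfolding k_def[abs_def] by (rule continuous_theta_force[OF cb])
  \<comment> \<open>The constant is chosen so that \<open>\<Theta> t0\<close> is theta of the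
    initial velocity.\<close>
  define \<Theta> where "\<Theta> t = (fst (u' t0) + \<Phi> s (snd (u t0)) \<bullet> snd (u' t0) - antideriv k t0) + antideriv k t" for t
  have \<Theta>: "(\<Theta> has_real_derivative theta_force (b t) (b' t)) (at t)" for t
    unfolding \<Theta>_def[abs_def] has_real_derivative_iff_has_vector_derivative
    using has_vector_derivative_add[OF has_vector_derivative_const has_vector_derivative_antideriv[OF ck, of t]]
    by (simp add: k_def)
  note data = b(3,4,5) \<Theta>
  \<comment> \<open>The times near which the geodesic lifts the base curve. \<open>Q\<close> is open
    by construction, and \<open>step\<close> shows that \<open>J - Q\<close> is open too, so
    \<open>Q\<close> exhausts the connected set \<open>J\<close>.\<close>
  define Q where "Q = {t \<in> J. \<exists>K. open K \<and> t \<in> K \<and> K \<subseteq> J \<and> fibre_lift b b' \<Theta> K \<gamma>}"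
  have "fibre_lift b b' \<Theta> (ball t0 r) \<gamma>"
    by (rule lift_of_geodesic[OF data u(3) open_ball convex_ball _ u(4-7), of t0])
      (use u(1) b(1,2) in \<open>simp_all add: \<Theta>_def\<close>)
  then have "t0 \<in> Q" unfolding Q_def using u(1,2) t0 by (auto intro!: exI[of _ "ball t0 r"])
  have step: "ball t1 \<epsilon> \<inter> Q = {} \<or> t1 \<in> Q"
    if t1: "t1 \<in> J" and v: "\<epsilon> > 0" "ball t1 \<epsilon> \<subseteq> J" "(D, U, s) \<in> charts CB"
    "\<And>t. t \<in> ball t1 \<epsilon> \<Longrightarrow> u t \<in> D" "\<And>t. t \<in> ball t1 \<epsilon> \<Longrightarrow> \<gamma> t = \<Psi> s (u t)"
    "\<And>t. t \<in> ball t1 \<epsilon> \<Longrightarrow> (u has_vector_derivative u' t) (at t)"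
    "\<And>t. t \<in> ball t1 \<epsilon> \<Longrightarrow> (u' has_vector_derivative - christoffel G (D, U, s) (u t) (u' t) (u' t)) (at t)"
    for t1 \<epsilon> D U s u u'
  proof (rule disjCI)
    assume "t1 \<notin> Q"
    show "ball t1 \<epsilon> \<inter> Q = {}"
    proof (rule ccontr)
      assume "ball t1 \<epsilon> \<inter> Q \<noteq> {}"
      then obtain t2 K where t2: "t2 \<in> ball t1 \<epsilon>" "t2 \<in> K" "fibre_lift b b' \<Theta> K \<gamma>" unfolding Q_def by blast
      \<comment> \<open>The data at the single time \<open>t2\<close> determine the geodesic on the
        whole chart interval around \<open>t1\<close>.\<close>
      note init = lift_initial_data[OF data v(3) open_ball t2(1) v(4-6) t2(3,2)]
      have "fibre_lift b b' \<Theta> (ball t1 \<epsilon>) \<gamma>"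
        by (rule lift_of_geodesic[OF data v(3) open_ball convex_ball t2(1) v(4-7) init])
      then have "t1 \<in> Q" unfolding Q_def using v(1,2) t1 by (auto intro!: exI[of _ "ball t1 \<epsilon>"])
      with \<open>t1 \<notin> Q\<close> show False by blast
    qed
  qed
  have "open Q"
  proof (subst open_subopen, intro ballI)
    fix t assume "t \<in> Q"
    then obtain K where K: "open K" "t \<in> K" "K \<subseteq> J" "fibre_lift b b' \<Theta> K \<gamma>" unfolding Q_def by blast
    then have "K \<subseteq> Q" unfolding Q_def by blast
    then show "\<exists>T. open T \<and> t \<in> T \<and> T \<subseteq> Q" using K by blast
  qed
  moreover have "open (J - Q)"
  proof (subst open_subopen, intro ballI)
    fix t1 assume t1: "t1 \<in> J - Q"
    then have t1J: "t1 \<in> J" by blast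
    obtain \<epsilon> D U s u u' where v: "\<epsilon> > 0" "ball t1 \<epsilon> \<subseteq> J" "(D, U, s) \<in> charts CB"
    "\<And>t. t \<in> ball t1 \<epsilon> \<Longrightarrow> u t \<in> D" "\<And>t. t \<in> ball t1 \<epsilon> \<Longrightarrow> \<gamma> t = \<Psi> s (u t)"
    "\<And>t. t \<in> ball t1 \<epsilon> \<Longrightarrow> (u has_vector_derivative u' t) (at t)"
    "\<And>t. t \<in> ball t1 \<epsilon> \<Longrightarrow> (u' has_vector_derivative - christoffel G (D, U, s) (u t) (u' t) (u' t)) (at t)"
      using geodesicE[OF geo t1J] by blast
    from step[OF t1J v] t1 have "ball t1 \<epsilon> \<inter> Q = {}" by blast
    then show "\<exists>T. open T \<and> t1 \<in> T \<and> T \<subseteq> J - Q" using v(1,2) by (intro exI[of _ "ball t1 \<epsilon>"]) auto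
  qed
  ultimately have "J \<subseteq> Q"
    using connectedD[OF J(2), of Q "J - Q"] \<open>t0 \<in> Q\<close> t0 by blast
  then have lift: "fibre_lift b b' \<Theta> J \<gamma>"
  proof (intro fibre_lift_union[OF b(3) continuous_data[OF data]])
    fix t assume "J \<subseteq> Q" "t \<in> J"
    then have "t \<in> Q" by blast
    then show "\<exists>J'. t \<in> J' \<and> J' \<subseteq> J \<and> fibre_lift b b' \<Theta> J' \<gamma>" unfolding Q_def by blast
  qed
  note ctx = b(3) continuous_data[OF data]
  obtain g where g: "fibre_lift b b' \<Theta> UNIV g" "g t0 = \<gamma> t0"
    using fibre_lift_global[OF ctx fibre_lift_in_fibre[OF ctx lift t0]] by blast
  have "convex J" using J(2) by (simp add: is_interval_connected_1[symmetric] is_interval_convex_1[symmetric])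
  then have "g t = \<gamma> t" if "t \<in> J" for t
    using fibre_lift_unique[OF ctx g(1) lift, of J t0 t] g(2) t0 that by blast
  moreover have "geodesic_on CB G UNIV g" by (rule geodesic_of_lift[OF data g(1)])
  ultimately show "\<exists>\<gamma>'. geodesic_on CB G UNIV \<gamma>' \<and> (\<forall>t\<in>J. \<gamma>' t = \<gamma> t)" by blast
qed

end

theorem corollary5p3:
  fixes P :: "(real^'n) \<times> real"
    and j1 :: 'n
    and E :: "('v, (real^'n) \<times> real) line_bundle"
    and f :: "((real^'n) \<times> real) set \<Rightarrow> real"
  assumes periods: "\<And>k. k \<in> Basis \<Longrightarrow> 0 < P \<bullet> k"
    and integral: "integral_class P (\<lambda>b a a'. psi j1 b a a' / (2 * pi))"
    and line_bundle_E: "hermitian_line_bundle P E"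
    and connection: "hermitian_connection P E"
    and curvature: "has_curvature_i P E (psi j1)"
    and smooth_f: "torus_smooth_on P (torus P) f"
    and generic: "generic_holonomy CARD('n) (circle_bundle P E)
                    (wave_metric P E eta flat_metric f) vertical"
  shows "compact_space (mtop (circle_bundle P E)) \<and>
    geodesically_complete (circle_bundle P E) (wave_metric P E eta flat_metric f) \<and>
    pp_wave CARD('n) (circle_bundle P E) (wave_metric P E eta flat_metric f)"
proof -
  interpret wave_bundle P E j1 f
    by unfold_locales (use periods line_bundle_E connection curvature smooth_f in auto)
  have "pp_wave CARD('n) (circle_bundle P E) (wave_metric P E eta flat_metric f)"
    by (rule pp_wave_CB) (use generic in \<open>auto simp: generic_holonomy_def\<close>)
  then show ?thesis using compact_space_CB geodesically_complete_CB by blast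
qed

end
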